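(* Let $1\le k<N$ be integers and let $\Omega\subset\mathbb R^N$ be a bounded convex domain. The Dirichlet problem $$\mathcal P_k^+(D^2u)=f(x)\ \text{ in }\Omega,\qquad u=0\ \text{ on }\partial\Omega,$$ has a unique solution $u\in C(\overline\Omega)$ for every bounded $f\in C(\Omega)$ if and only if $\Omega\in\mathcal C_{N-k+1}$.
   Context: For a symmetric $N\times N$ matrix $X$ let $\lambda_1(X)\le\dots\le\lambda_N(X)$ be its ordered eigenvalues and $\mathcal P_k^+(X)=\sum_{i=1}^k\lambda_{N+1-i}(X)$. A domain is a nonempty open connected set. Solutions are understood in the viscosity sense: $u$ is a subsolution (resp. supersolution) of $\mathcal P_k^+(D^2u)=f$ in $\Omega$ if it is upper (resp. lower) semicontinuous and, whenever $\varphi$ is $C^2$ near $x_0\in\Omega$ and $u-\varphi$ has a local maximum (resp. minimum) at $x_0$, one has $\mathcal P_k^+(D^2\varphi(x_0))\ge f(x_0)$ (resp. $\le f(x_0)$); a solution is a continuous function that is both. The boundary condition is understood in the classical pointwise sense. A domain $\omega\subset\mathbb R^j$ is strictly convex if $(1-t)x+ty\in\omega$ for all $x\ne y$ in $\overline\omega$ and $0<t<1$. For $j\in\{1,\dots,N\}$ let $C_j$ be the collection of sets $C=\omega\times\mathbb R^{N-j}\subset\mathbb R^N$ with $\omega\subset\mathbb R^j$ a bounded strictly convex domain. $\mathcal C_j$ is the class of bounded convex domains $\Omega\subset\mathbb R^N$ such that for each $x\in\partial\Omega$ there exist an orthogonal $N\times N$ matrix $O$ and a set $C$ with $\Omega\subset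 OC$ and $x\in\partial(OC)$, where $C\in C_j$ up to translation (i.e. $C=\omega\times\mathbb R^{N-j}$ with $\omega\subset\mathbb R^j$ a bounded strictly convex domain, located anywhere in $\mathbb R^j$). *)

theory Defs
  imports "HOL-Analysis.Analysis" "HOL-Computational_Algebra.Polynomial"
begin

definition is_domain :: "'a::topological_space set \<Rightarrow> bool" where
  "is_domain S \<longleftrightarrow> S \<noteq> {} \<and> open S \<and> connected S"

definition charpoly :: "real^'n^'n \<Rightarrow> real poly" where
  "charpoly X = det (\<chi> i j. (if i = j then [:0, 1:] else 0) - [:X $ i $ j:])"

text \<open>The multiset of real roots of the characteristic polynomial, each with its multiplicity, has
  \<open>CARD('n)\<close> elements if \<open>X\<close> is symmetric. Only symmetric matrices are of interest; for other
  matrices the list below may be too short and the indexed value is then meaningless.\<close>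

definition eigenvalue :: "nat \<Rightarrow> real^'n^'n \<Rightarrow> real" where
  "eigenvalue i X = sorted_list_of_multiset (proots (charpoly X)) ! (i - 1)"

definition Pplus :: "nat \<Rightarrow> real^'n^'n \<Rightarrow> real" where
  "Pplus k X = (\<Sum>i=1..k. eigenvalue (CARD('n) + 1 - i) X)"

text \<open>\<open>C2_near x\<^sub>0 \<phi> X\<close>: the function \<open>\<phi>\<close> is of class \<open>C\<^sup>2\<close> on an open neighbourhood
  of \<open>x\<^sub>0\<close>, with Hessian matrix \<open>X\<close> at \<open>x\<^sub>0\<close>.\<close>

definition C2_near :: "real^'n \<Rightarrow> (real^'n \<Rightarrow> real) \<Rightarrow> real^'n^'n \<Rightarrow> bool" where
  "C2_near x\<^sub>0 \<phi> X \<longleftrightarrow> (\<exists>U G H. open U \<and> x\<^sub>0 \<in> U \<and>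
     (\<forall>x\<in>U. (\<phi> has_derivative (\<lambda>h. G x \<bullet> h)) (at x)) \<and>
     (\<forall>x\<in>U. (G has_derivative (\<lambda>h. H x *v h)) (at x)) \<and>
     continuous_on U H \<and> H x\<^sub>0 = X)"

definition usc_on :: "'a::topological_space set \<Rightarrow> ('a \<Rightarrow> real) \<Rightarrow> bool" where
  "usc_on S u \<longleftrightarrow> (\<forall>x\<in>S. \<forall>c>u x. \<forall>\<^sub>F y in at x within S. u y < c)"

definition lsc_on :: "'a::topological_space set \<Rightarrow> ('a \<Rightarrow> real) \<Rightarrow> bool" where
  "lsc_on S u \<longleftrightarrow> (\<forall>x\<in>S. \<forall>c<u x. \<forall>\<^sub>F y in at x within S. c < u y)"

text \<open>The set \<open>\<Omega>\<close> below is always open, so neighbourhoods in the whole space and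
  neighbourhoods in \<open>\<Omega>\<close> give the same local extrema.\<close>

definition viscosity_subsolution ::
    "nat \<Rightarrow> (real^'n \<Rightarrow> real) \<Rightarrow> (real^'n) set \<Rightarrow> (real^'n \<Rightarrow> real) \<Rightarrow> bool" where
  "viscosity_subsolution k f \<Omega> u \<longleftrightarrow> usc_on \<Omega> u \<and>
     (\<forall>x\<^sub>0\<in>\<Omega>. \<forall>\<phi> X. C2_near x\<^sub>0 \<phi> X \<and> (\<forall>\<^sub>F y in nhds x\<^sub>0. u y - \<phi> y \<le> u x\<^sub>0 - \<phi> x\<^sub>0)
        \<longrightarrow> Pplus k X \<ge> f x\<^sub>0)"

definition viscosity_supersolution ::
    "nat \<Rightarrow> (real^'n \<Rightarrow> real) \<Rightarrow> (real^'n) set \<Rightarrow> (real^'n \<Rightarrow> real) \<Rightarrow> bool" where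
  "viscosity_supersolution k f \<Omega> u \<longleftrightarrow> lsc_on \<Omega> u \<and>
     (\<forall>x\<^sub>0\<in>\<Omega>. \<forall>\<phi> X. C2_near x\<^sub>0 \<phi> X \<and> (\<forall>\<^sub>F y in nhds x\<^sub>0. u y - \<phi> y \<ge> u x\<^sub>0 - \<phi> x\<^sub>0)
        \<longrightarrow> Pplus k X \<le> f x\<^sub>0)"

definition viscosity_solution ::
    "nat \<Rightarrow> (real^'n \<Rightarrow> real) \<Rightarrow> (real^'n) set \<Rightarrow> (real^'n \<Rightarrow> real) \<Rightarrow> bool" where
  "viscosity_solution k f \<Omega> u \<longleftrightarrow> continuous_on \<Omega> u \<and>
     viscosity_subsolution k f \<Omega> u \<and> viscosity_supersolution k f \<Omega> u"

definition dirichlet_solution ::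
    "nat \<Rightarrow> (real^'n \<Rightarrow> real) \<Rightarrow> (real^'n) set \<Rightarrow> (real^'n \<Rightarrow> real) \<Rightarrow> bool" where
  "dirichlet_solution k f \<Omega> u \<longleftrightarrow> continuous_on (closure \<Omega>) u \<and>
     viscosity_solution k f \<Omega> u \<and> (\<forall>x\<in>frontier \<Omega>. u x = 0)"

definition strictly_convex_domain :: "'a::real_normed_vector set \<Rightarrow> bool" where
  "strictly_convex_domain \<omega> \<longleftrightarrow> is_domain \<omega> \<and>
     (\<forall>x\<in>closure \<omega>. \<forall>y\<in>closure \<omega>. \<forall>t. x \<noteq> y \<and> 0 < t \<and> t < 1
        \<longrightarrow> (1 - t) *\<^sub>R x + t *\<^sub>R y \<in> \<omega>)"

text \<open>The product of \<open>\<omega> \<subseteq> \<real>\<^sup>j\<close> and \<open>\<real>\<^sup>N\<^sup>-\<^sup>j\<close>, where \<open>j = CARD('j)\<close> and \<open>N = CARD('n)\<close>.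
  Since the finite type \<open>'n\<close> carries no order, an injection \<open>e\<close> selects the \<open>j\<close> coordinates
  that take the role of the first ones. Two injections differ by a permutation matrix, which is
  orthogonal.\<close>

definition cylinder :: "('j \<Rightarrow> 'n) \<Rightarrow> (real^'j) set \<Rightarrow> (real^'n) set" where
  "cylinder e \<omega> = {x. (\<chi> i. x $ e i) \<in> \<omega>}"

definition cylinders :: "'j::finite itself \<Rightarrow> (real^'n) set set" where
  "cylinders (_ :: 'j::finite itself) = {cylinder e \<omega> | (e :: 'j \<Rightarrow> 'n) \<omega>.
     inj e \<and> bounded \<omega> \<and> strictly_convex_domain \<omega>}"

definition cylinder_class :: "'j::finite itself \<Rightarrow> (real^'n) set set" where
  "cylinder_class (j :: 'j::finite itself) = {\<Omega>. is_domain \<Omega> \<and> bounded \<Omega> \<and> convex \<Omega> \<and>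
     (\<forall>x\<in>frontier \<Omega>. \<exists>Q C. orthogonal_matrix Q \<and> C \<in> cylinders j \<and>
        \<Omega> \<subseteq> (\<lambda>y. Q *v y) ` C \<and> x \<in> frontier ((\<lambda>y. Q *v y) ` C))}"

end

theory Submission
  imports Defs
begin

text \<open>By Ky Fan's principle \<open>Pplus k X\<close> is the maximum, over orthonormal \<open>k\<close>-frames, of the trace of
  \<open>X\<close> on the frame. Hence a supersolution is, for every \<open>k\<close>-dimensional direction, a supersolution of a
  linear constant coefficient equation. Such supersolutions obey a mean value inequality on
  \<open>k\<close>-dimensional spheres, which is linear and therefore survives convolution: mollified supersolutions
  are classical ones. This gives the comparison principle without doubling of variables (only the
  supersolution is regularised, by an inf-convolution followed by a mollification), and with it Perron's
  method and uniqueness.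

  The cylinder condition at a boundary point yields barriers \<open>a + b \<bullet> (y - z) - |\<pi> (y - z)|\<^sup>2\<close>, where
  \<open>\<pi>\<close> projects to \<open>N - k + 1\<close> dimensions, so that every \<open>k\<close>-dimensional space meets the directions of
  concavity. Conversely, the solution for \<open>f = -1\<close> is at least \<open>r\<^sup>2 / 2k\<close> at the centre of every
  \<open>k\<close>-dimensional disc of radius \<open>r\<close> in the domain, so the boundary contains no such disc; every exposed
  face then has dimension less than \<open>k\<close>, and projecting along it exposes the boundary point.\<close>

section \<open>Orthonormal frames and the eigenvalue sum\<close>

text \<open>The obstacle is that averaging does not preserve subsolutions. \<open>Pplus\<close> is a
  maximum of linear operators, so the supersolution condition is a conjunction of linear
  inequalities and survives averaging, while the subsolution condition is a disjunction and does
  not. Hence all regularisation falls on the supersolution, and the subsolution is only tested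
  against the resulting smooth function. Strictness comes from adding \<epsilon> |x|^2, which raises
  \<open>Pplus\<close> by 2 k \<epsilon>.

  Spherical means are expressed without a surface measure: the mean value inequality is tested
  against harmonic functions along a k-dimensional plane, and its additivity rests on the uniform
  density of these functions on the sphere. This is why the Dirichlet problem for polynomials on a
  sphere is first solved algebraically.

  Of the two barriers only the upper one feels the cylinder condition. A supporting hyperplane
  suffices for the lower one, because convexity in one direction, with no curvature in the others,
  already makes \<open>Pplus\<close> large.\<close>

definition onb :: "('n::finite \<Rightarrow> real^'n) \<Rightarrow> bool" where
  "onb \<xi> \<longleftrightarrow> (\<forall>i j. \<xi> i \<bullet> \<xi> j = (if i = j then 1 else 0))"

lemma onb_inner: "onb \<xi> \<Longrightarrow> \<xi> i \<bullet> \<xi> j = (if i = j then 1 else 0)"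
  by (simp add: onb_def)

lemma onb_norm: "onb \<xi> \<Longrightarrow> norm (\<xi> i) = 1"
  by (simp add: onb_def norm_eq_sqrt_inner)

lemma onb_inj: "onb \<xi> \<Longrightarrow> inj \<xi>"
  by (rule injI) (metis onb_inner zero_neq_one)

text \<open>Completion by an orthonormal basis of the orthogonal complement. The result is indexed
  by the coordinate type itself, so that a frame is the column family of an orthogonal matrix and
  sets of indices stand for subspaces.\<close>

lemma onb_of_set:
  fixes B :: "(real^'n) set"
  assumes "pairwise orthogonal B" and nrm: "\<And>x. x \<in> B \<Longrightarrow> norm x = 1"
  shows "\<exists>\<xi> :: 'n \<Rightarrow> real^'n. onb \<xi> \<and> B \<subseteq> range \<xi>"
proof -
  let ?T = "{y. \<forall>x\<in>span B. orthogonal x y}"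
  have sT: "subspace ?T" by (rule subspace_orthogonal_to_vectors)
  obtain B' where B': "B' \<subseteq> ?T" "pairwise orthogonal B'" "\<And>x. x \<in> B' \<Longrightarrow> norm x = 1"
      "independent B'" "span B' = ?T"
    by (rule orthonormal_basis_subspace[OF sT]) blast
  let ?C = "B \<union> B'"
  have BB': "orthogonal x y" if "x \<in> B" "y \<in> B'" for x y using that B'(1) span_base[of x B] by blast
  have o: "pairwise orthogonal ?C"
    unfolding pairwise_def
  proof (intro ballI impI)
    fix x y assume xy: "x \<in> ?C" "y \<in> ?C" "x \<noteq> y"
    then consider "x \<in> B" "y \<in> B" | "x \<in> B'" "y \<in> B'" | "x \<in> B" "y \<in> B'" | "x \<in> B'" "y \<in> B" by blast
    then show "orthogonal x y"
    proof cases
      case 4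
      then show ?thesis using BB'[of y x] by (simp add: orthogonal_commute)
    qed (use assms(1) B'(2) xy(3) BB' in \<open>auto simp: pairwise_def\<close>)
  qed
  have n1: "\<And>x. x \<in> ?C \<Longrightarrow> norm x = 1" using nrm B'(3) by auto
  then have "0 \<notin> ?C" by force
  then have ind: "independent ?C" by (rule pairwise_orthogonal_independent[OF o])
  have sp: "span ?C = UNIV"
  proof -
    have "x \<in> span ?C" for x
    proof -
      obtain y z where yz: "y \<in> span (span B)" "\<And>w. w \<in> span (span B) \<Longrightarrow> orthogonal z w" "x = y + z"
        using orthogonal_subspace_decomp_exists[of "span B" x] by blast
      have "z \<in> span B'" unfolding B'(5) using yz(2) by (auto simp: orthogonal_commute span_base)
      moreover have "y \<in> span B" using yz(1) by (simp only: span_span)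
      ultimately show ?thesis unfolding yz(3)
        by (meson span_add span_mono subsetD sup_ge1 sup_ge2)
    qed
    then show ?thesis by auto
  qed
  have fin: "finite ?C" using independent_imp_finite[OF ind] .
  have "card ?C = CARD('n)"
    using dim_span_eq_card_independent[OF ind] sp by simp
  then obtain \<xi> where bij: "bij_betw \<xi> (UNIV::'n set) ?C"
    using finite_same_card_bij[of "UNIV::'n set" ?C] fin by auto
  have "onb \<xi>" unfolding onb_def
  proof (intro allI)
    fix i j
    have m: "\<xi> i \<in> ?C" "\<xi> j \<in> ?C" using bij by (auto simp: bij_betw_def)
    show "\<xi> i \<bullet> \<xi> j = (if i = j then 1 else 0)"
    proof (cases "i = j")
      case True
      then show ?thesis using n1[OF m(1)] by (simp add: dot_square_norm)
    next
      case False
      then have "\<xi> i \<noteq> \<xi> j" using bij by (metis bij_betw_imp_inj_on injD)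
      then show ?thesis using o m False by (auto simp: pairwise_def orthogonal_def)
    qed
  qed
  moreover have "B \<subseteq> range \<xi>" using bij by (auto simp: bij_betw_def)
  ultimately show ?thesis by blast
qed

lemma onb_expand:
  fixes \<xi> :: "'n::finite \<Rightarrow> real^'n"
  assumes "onb \<xi>"
  shows "(\<Sum>i\<in>UNIV. (\<xi> i \<bullet> x) *\<^sub>R \<xi> i) = x"
proof -
  let ?B = "range \<xi>"
  have "pairwise orthogonal ?B" using assms by (auto simp: pairwise_def orthogonal_def onb_def)
  moreover have "0 \<notin> ?B" using onb_norm[OF assms] by (metis norm_zero rangeE zero_neq_one)
  ultimately have ind: "independent ?B" by (rule pairwise_orthogonal_independent)
  have "card ?B = CARD('n)" using onb_inj[OF assms] by (simp add: card_image)
  then have sp: "span ?B = UNIV"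
    using ind card_eq_dim[of ?B UNIV] by auto
  let ?y = "x - (\<Sum>i\<in>UNIV. (\<xi> i \<bullet> x) *\<^sub>R \<xi> i)"
  have *: "\<xi> j \<bullet> ?y = 0" for j
    by (simp add: inner_diff_right inner_sum_right onb_inner[OF assms] if_distrib cong: if_cong)
  have "orthogonal ?y z" for z
    using * sp by (intro orthogonal_to_span[of z ?B]) (auto simp: orthogonal_def inner_commute)
  then have "?y = 0" using sp by (metis orthogonal_self)
  then show ?thesis by simp
qed

lemma onb_inner_expand:
  assumes "onb \<xi>"
  shows "x \<bullet> y = (\<Sum>i\<in>UNIV. (\<xi> i \<bullet> x) * (\<xi> i \<bullet> y))"
proof -
  have "x \<bullet> y = (\<Sum>i\<in>UNIV. (\<xi> i \<bullet> x) *\<^sub>R \<xi> i) \<bullet> y" using onb_expand[OF assms] by simp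
  then show ?thesis by (simp add: inner_sum_left)
qed

lemma onb_norm_expand:
  assumes "onb \<xi>"
  shows "(norm x)\<^sup>2 = (\<Sum>i\<in>UNIV. (\<xi> i \<bullet> x)\<^sup>2)"
  using onb_inner_expand[OF assms, of x x] by (simp add: power2_norm_eq_inner) (simp add: power2_eq_square)

lemma symmetric_inner:
  fixes X :: "real^'n^'n"
  assumes "transpose X = X" shows "(X *v x) \<bullet> y = x \<bullet> (X *v y)"
  by (metis assms dot_lmul_matrix inner_commute transpose_matrix_vector)

text \<open>Rayleigh quotient argument: for a maximiser x on the unit sphere of S the form
  \<open>b\<close> is nonnegative on S and vanishes at (x, x), hence at (x, y) for every y in S.
  Taking for y the residual \<open>\<mu> *\<^sub>R x - X *v x\<close>, which lies in S by
  invariance, shows that the residual is zero.\<close>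

lemma symmetric_eigenvector_subspace:
  fixes X :: "real^'n^'n"
  assumes X: "transpose X = X" and S: "subspace S" "\<And>x. x \<in> S \<Longrightarrow> X *v x \<in> S" "S \<noteq> {0}"
  shows "\<exists>x \<mu>. x \<in> S \<and> norm x = 1 \<and> X *v x = \<mu> *\<^sub>R x"
proof -
  let ?K = "S \<inter> sphere 0 1"
  have cK: "compact ?K" using closed_subspace[OF S(1)] by (simp add: closed_Int_compact)
  obtain w where w: "w \<in> S" "w \<noteq> 0" using S(1,3) subspace_0 by blast
  then have "(1 / norm w) *\<^sub>R w \<in> ?K" using S(1) by (simp add: subspace_scale)
  then have ne: "?K \<noteq> {}" by blast
  have "continuous_on ?K (\<lambda>x. x \<bullet> (X *v x))"
    by (intro continuous_intros linear_continuous_on matrix_vector_mul_bounded_linear)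
  then obtain x where x: "x \<in> ?K" "\<And>y. y \<in> ?K \<Longrightarrow> y \<bullet> (X *v y) \<le> x \<bullet> (X *v x)"
    using continuous_attains_sup[OF cK ne] by blast
  define \<mu> where "\<mu> = x \<bullet> (X *v x)"
  define b where "b y z = \<mu> * (y \<bullet> z) - y \<bullet> (X *v z)" for y z
  have bpos: "b y y \<ge> 0" if "y \<in> S" for y
  proof (cases "y = 0")
    case False
    let ?u = "(1 / norm y) *\<^sub>R y"
    have "?u \<in> ?K" using that False S(1) by (simp add: subspace_scale)
    then have "?u \<bullet> (X *v ?u) \<le> \<mu>" using x(2) unfolding \<mu>_def by blast
    then have "(y \<bullet> (X *v y)) / (norm y)\<^sup>2 \<le> \<mu>"
      by (simp add: matrix_vector_mult_scaleR power2_eq_square)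
    then show ?thesis using False by (simp add: b_def divide_simps power2_norm_eq_inner split: if_splits)
  qed (simp add: b_def)
  have x1: "x \<bullet> x = 1" "x \<in> S" "norm x = 1" using x(1) by (auto simp: dot_square_norm)
  have b0: "b x y = 0" if y: "y \<in> S" for y
  proof (rule ccontr)
    assume nz: "b x y \<noteq> 0"
    have sym: "b y x = b x y" using symmetric_inner[OF X, of x y] by (simp add: b_def inner_commute)
    have *: "0 \<le> 2 * t * b x y + t\<^sup>2 * b y y" for t
    proof -
      have "b (x + t *\<^sub>R y) (x + t *\<^sub>R y) = b x x + t * b x y + t * b y x + t\<^sup>2 * b y y"
        by (simp add: b_def matrix_vector_right_distrib matrix_vector_mult_scaleR inner_add_left inner_add_right
            power2_eq_square algebra_simps)
      moreover have "b x x = 0" using x1 by (simp add: b_def \<mu>_def)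
      moreover have "x + t *\<^sub>R y \<in> S" using S(1) x1 y by (simp add: subspace_add subspace_scale)
      ultimately show ?thesis using bpos[of "x + t *\<^sub>R y"] sym by simp
    qed
    have byy: "b y y \<ge> 0" by (rule bpos[OF y])
    \<comment> \<open>The quadratic in t is evaluated near its minimiser t = - b x y / b y y; adding
      1 keeps the denominator positive when b y y = 0.\<close>
    let ?c = "b y y + 1"
    have "0 \<le> 2 * (- b x y / ?c) * b x y + (- b x y / ?c)\<^sup>2 * b y y" by (rule *)
    also have "\<dots> = - (b x y)\<^sup>2 * (b y y + 2) / ?c\<^sup>2"
    proof -
      have c: "?c \<noteq> 0" using byy by linarith
      have "2 * (- b x y / ?c) * b x y + (- b x y / ?c)\<^sup>2 * b y y = (- 2 * (b x y)\<^sup>2 * ?c + (b x y)\<^sup>2 * b y y) / ?c\<^sup>2"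
        using c by (simp add: power2_eq_square divide_simps)
      also have "\<dots> = - (b x y)\<^sup>2 * (b y y + 2) / ?c\<^sup>2" by (simp add: algebra_simps)
      finally show ?thesis .
    qed
    also have "\<dots> < 0" using nz byy by (simp add: divide_neg_pos mult_pos_pos)
    finally show False by simp
  qed
  let ?v = "\<mu> *\<^sub>R x - X *v x"
  have "?v \<in> S" using S(1,2) x1 by (simp add: subspace_diff subspace_scale)
  then have "b x ?v = 0" by (rule b0)
  moreover have "b x ?v = ?v \<bullet> ?v"
    using symmetric_inner[OF X, of x ?v] by (simp add: b_def inner_diff_left inner_diff_right inner_commute right_diff_distrib)
  ultimately have "?v = 0" by simp
  then show ?thesis using x1 by (intro exI[of _ x] exI[of _ \<mu>]) auto
qed

text \<open>A largest orthonormal set of eigenvectors exists by the dimension bound. Its orthogonal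
  complement is invariant, so a nonzero complement would supply one more eigenvector.\<close>

lemma symmetric_eigenbasis:
  fixes X :: "real^'n^'n"
  assumes X: "transpose X = X"
  shows "\<exists>\<xi> e. onb \<xi> \<and> (\<forall>i. X *v \<xi> i = e i *\<^sub>R \<xi> i)"
proof -
  define good where "good B \<longleftrightarrow> pairwise orthogonal B \<and> (\<forall>x\<in>B. norm x = 1) \<and> (\<forall>x\<in>B. \<exists>\<mu>. X *v x = \<mu> *\<^sub>R x)" for B
  have bd: "finite B \<and> card B \<le> CARD('n)" if "good B" for B
  proof -
    have "0 \<notin> B" using that by (force simp: good_def)
    then have "independent B" using that pairwise_orthogonal_independent by (auto simp: good_def)
    then show ?thesis using independent_bound by fastforce
  qed
  have "good {}" by (simp add: good_def)
  then obtain B where B: "good B" "\<And>B'. good B' \<Longrightarrow> card B' \<le> card B"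
    using ex_has_greatest_nat[of good "{}" card "Suc CARD('n)"] bd by (auto simp: less_Suc_eq_le)
  let ?S = "{y. \<forall>x\<in>B. orthogonal x y}"
  have S0: "?S = {0}"
  proof (rule ccontr)
    assume ne: "?S \<noteq> {0}"
    have inv: "X *v y \<in> ?S" if "y \<in> ?S" for y
    proof (clarify)
      fix x assume "x \<in> B"
      then obtain \<mu> where "X *v x = \<mu> *\<^sub>R x" using B(1) by (auto simp: good_def)
      then show "orthogonal x (X *v y)" using that \<open>x \<in> B\<close> symmetric_inner[OF X, of x y]
        by (simp add: orthogonal_def)
    qed
    obtain x \<mu> where x: "x \<in> ?S" "norm x = 1" "X *v x = \<mu> *\<^sub>R x"
      using symmetric_eigenvector_subspace[OF X subspace_orthogonal_to_vectors inv ne] by blast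
    have xB: "x \<notin> B" using x(1,2) orthogonal_self by (metis (mono_tags) mem_Collect_eq norm_zero zero_neq_one)
    have "good (insert x B)"
      using B(1) x unfolding good_def pairwise_insert
      by (auto simp: orthogonal_commute)
    then have "card (insert x B) \<le> card B" by (rule B(2))
    then show False using xB bd[OF B(1)] by simp
  qed
  obtain \<xi> :: "'n \<Rightarrow> real^'n" where \<xi>: "onb \<xi>" "B \<subseteq> range \<xi>"
    using onb_of_set[of B] B(1) by (auto simp: good_def)
  have "\<xi> i \<in> B" for i
  proof (rule ccontr)
    assume "\<xi> i \<notin> B"
    then have "\<xi> i \<in> ?S" using \<xi> by (auto simp: orthogonal_def onb_def)
    then show False using S0 onb_norm[OF \<xi>(1), of i] by auto
  qed
  then have "\<forall>i. \<exists>\<mu>. X *v \<xi> i = \<mu> *\<^sub>R \<xi> i" using B(1) by (auto simp: good_def)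
  then show ?thesis using \<xi>(1) by metis
qed


section \<open>The characteristic polynomial and Ky Fan's principle\<close>

lemma det_conj_diag:
  fixes \<xi> :: "'n::finite \<Rightarrow> real^'n"
  assumes "onb \<xi>" and e: "\<And>i. X *v \<xi> i = e i *\<^sub>R \<xi> i"
  shows "det (\<chi> i j. (if i = j then t else 0) - X $ i $ j) = (\<Prod>i\<in>UNIV. t - e i)"
proof -
  define Q :: "real^'n^'n" where "Q = (\<chi> i j. \<xi> j $ i)"
  define A :: "real^'n^'n" where "A = (\<chi> i j. (if i = j then t else 0) - X $ i $ j)"
  define D :: "real^'n^'n" where "D = (\<chi> i j. if i = j then t - e i else 0)"
  have A: "A *v x = t *\<^sub>R x - X *v x" for x
    by (simp add: A_def vec_eq_iff matrix_vector_mult_def left_diff_distrib sum_subtractf if_distrib[of "\<lambda>a. a * _"] cong: if_cong)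
  have "orthogonal_matrix Q"
    unfolding orthogonal_matrix Q_def using assms(1)
    by (simp add: vec_eq_iff matrix_matrix_mult_def transpose_def mat_def onb_def inner_vec_def)
  then have dQ: "det Q \<noteq> 0" using det_orthogonal_matrix by fastforce
  have "A ** Q = Q ** D"
  proof -
    have "(A ** Q) $ i $ j = (Q ** D) $ i $ j" for i j
    proof -
      have "(A ** Q) $ i $ j = (A *v \<xi> j) $ i"
        by (simp add: matrix_matrix_mult_def matrix_vector_mult_def Q_def)
      also have "\<dots> = (t - e j) * \<xi> j $ i" by (simp add: A e left_diff_distrib)
      also have "\<dots> = (Q ** D) $ i $ j"
        by (simp add: matrix_matrix_mult_def Q_def D_def if_distrib[of "\<lambda>a. _ * a"] cong: if_cong)
      finally show ?thesis .
    qed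
    then show ?thesis by (simp add: vec_eq_iff)
  qed
  then have "det A * det Q = det Q * det D" by (metis det_mul)
  then have "det A = det D" using dQ by simp
  also have "det D = (\<Prod>i\<in>UNIV. t - e i)" by (subst det_diagonal) (auto simp: D_def)
  finally show ?thesis unfolding A_def .
qed

lemma poly_charpoly: "poly (charpoly X) t = det (\<chi> i j. (if i = j then t else 0) - X $ i $ j)"
  unfolding charpoly_def det_def poly_sum poly_mult poly_prod
  by (intro sum.cong refl arg_cong2[where f="(*)"] prod.cong) (auto simp: poly_diff)

text \<open>The two polynomials are compared through their values at every real point, which reduces
  the determinant over the polynomial ring to the real determinant of
  \<open>det_conj_diag\<close>.\<close>

lemma proots_charpoly:
  fixes \<xi> :: "'n::finite \<Rightarrow> real^'n"
  assumes "onb \<xi>" and e: "\<And>i. X *v \<xi> i = e i *\<^sub>R \<xi> i"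
  shows "proots (charpoly X) = image_mset e (mset_set UNIV)"
proof -
  have "charpoly X = (\<Prod>i\<in>UNIV. [:- e i, 1:])"
    by (subst poly_eq_poly_eq_iff[symmetric]) (simp add: fun_eq_iff poly_charpoly det_conj_diag[OF assms] poly_prod)
  then have "proots (charpoly X) = (\<Sum>i\<in>UNIV. {#e i#})" by (simp add: proots_prod)
  then show ?thesis by (simp add: sum_unfold_sum_mset)
qed

text \<open>The threshold \<open>\<mu>\<close> between the chosen indices and the others is the form
  in which the ordering of the eigenvalues enters Ky Fan's inequality.\<close>

lemma Pplus_eigenbasis:
  fixes \<xi> :: "'n::finite \<Rightarrow> real^'n"
  assumes "onb \<xi>" and e: "\<And>i. X *v \<xi> i = e i *\<^sub>R \<xi> i" and k: "1 \<le> k" "k \<le> CARD('n)"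
  shows "\<exists>I \<mu>. card I = k \<and> Pplus k X = (\<Sum>i\<in>I. e i) \<and> (\<forall>i\<in>I. e i \<ge> \<mu>) \<and> (\<forall>i. i \<notin> I \<longrightarrow> e i \<le> \<mu>)"
proof -
  obtain ys where ys: "set ys = (UNIV :: 'n set)" "distinct ys" using finite_distinct_list[of "UNIV::'n set"] by auto
  define xs where "xs = sort_key e ys"
  have xs: "set xs = UNIV" "distinct xs" "sorted (map e xs)" "mset xs = mset_set UNIV"
  proof -
    show "mset xs = mset_set UNIV" unfolding xs_def mset_sort ys(1)[symmetric]
      using mset_set_set[OF ys(2)] by simp
  qed (use ys in \<open>simp_all add: xs_def\<close>)
  have len: "length xs = CARD('n)" using xs(1,2) distinct_card by fastforce
  let ?N = "CARD('n)"
  have L: "sorted_list_of_multiset (proots (charpoly X)) = map e xs"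
    by (simp add: proots_charpoly[OF assms(1,2)] xs(4)[symmetric] flip: mset_map)
       (simp add: sorted_sort_id xs(3))
  define I where "I = (\<lambda>m. xs ! m) ` {?N - k..<?N}"
  have inj: "inj_on (\<lambda>m. xs ! m) {..<?N}" using xs(2) len by (auto simp: inj_on_def nth_eq_iff_index_eq)
  have cI: "card I = k" unfolding I_def using inj k by (subst card_image) (auto intro: inj_on_subset)
  \<comment> \<open>Lists are indexed from 0, so the (N + 1 - i)-th eigenvalue is the entry at N -
    i, and the k largest ones occupy the positions N - k to N - 1.\<close>
  have "Pplus k X = (\<Sum>i=1..k. e (xs ! (?N - i)))"
    unfolding Pplus_def eigenvalue_def L using k len by (intro sum.cong) auto
  also have "\<dots> = (\<Sum>m=?N - k..<?N. e (xs ! m))"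
    by (rule sum.reindex_bij_witness[of _ "\<lambda>m. ?N - m" "\<lambda>i. ?N - i"]) (use k in auto)
  also have "\<dots> = (\<Sum>i\<in>I. e i)" unfolding I_def
    by (subst sum.reindex) (use inj in \<open>auto intro: inj_on_subset\<close>)
  finally have P: "Pplus k X = (\<Sum>i\<in>I. e i)" .
  define \<mu> where "\<mu> = e (xs ! (?N - k))"
  have mono: "e (xs ! a) \<le> e (xs ! b)" if "a \<le> b" "b < ?N" for a b
    using sorted_nth_mono[OF xs(3), of a b] that len by simp
  have "e i \<ge> \<mu>" if "i \<in> I" for i using that mono unfolding I_def \<mu>_def by auto
  moreover have "e i \<le> \<mu>" if "i \<notin> I" for i
  proof -
    obtain m where m: "m < ?N" "i = xs ! m" using xs(1) len using in_set_conv_nth[of i xs] by auto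
    then have "m < ?N - k" using that unfolding I_def by force
    then show ?thesis unfolding \<mu>_def m(2) by (intro mono) (use k in auto)
  qed
  ultimately show ?thesis using cI P by blast
qed

lemma Pplus_attained:
  fixes X :: "real^'n^'n"
  assumes "transpose X = X" and k: "1 \<le> k" "k \<le> CARD('n)"
  shows "\<exists>\<xi> I. onb \<xi> \<and> card I = k \<and> Pplus k X = (\<Sum>i\<in>I. \<xi> i \<bullet> (X *v \<xi> i))"
proof -
  obtain \<xi> e where e: "onb \<xi>" "\<And>i. X *v \<xi> i = e i *\<^sub>R \<xi> i" using symmetric_eigenbasis[OF assms(1)] by blast
  obtain I where "card I = k" "Pplus k X = (\<Sum>i\<in>I. e i)" using Pplus_eigenbasis[OF e k] by blast
  then show ?thesis using e by (intro exI[of _ \<xi>] exI[of _ I]) (auto simp: onb_inner)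
qed

text \<open>A small linear programme. The weights \<open>w i\<close>, squared lengths of the
  projections of the eigenvectors onto the span of the frame, lie between 0 and 1 and add up to k.
  Subtracting \<open>\<mu>\<close> from each eigenvalue shows that the weighted sum is largest when
  the weights are the indicator of the top k indices.\<close>

lemma Pplus_ge:
  fixes X :: "real^'n^'n"
  assumes X: "transpose X = X" and k: "1 \<le> k" "k \<le> CARD('n)" and \<eta>: "onb \<eta>" "card J = k"
  shows "(\<Sum>j\<in>J. \<eta> j \<bullet> (X *v \<eta> j)) \<le> Pplus k X"
proof -
  obtain \<xi> e where e: "onb \<xi>" "\<And>i. X *v \<xi> i = e i *\<^sub>R \<xi> i" using symmetric_eigenbasis[OF X] by blast
  obtain I \<mu> where I: "card I = k" "Pplus k X = (\<Sum>i\<in>I. e i)" "\<forall>i\<in>I. e i \<ge> \<mu>" "\<forall>i. i \<notin> I \<longrightarrow> e i \<le> \<mu>"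
    using Pplus_eigenbasis[OF e k] by blast
  define w where "w i = (\<Sum>j\<in>J. (\<xi> i \<bullet> \<eta> j)\<^sup>2)" for i
  have q: "x \<bullet> (X *v x) = (\<Sum>i\<in>UNIV. e i * (\<xi> i \<bullet> x)\<^sup>2)" for x
  proof -
    have *: "\<xi> i \<bullet> (X *v x) = e i * (\<xi> i \<bullet> x)" for i
      using symmetric_inner[OF X, of "\<xi> i" x] e(2)[of i] by simp
    have "x \<bullet> (X *v x) = (\<Sum>i\<in>UNIV. (\<xi> i \<bullet> x) * (\<xi> i \<bullet> (X *v x)))" by (rule onb_inner_expand[OF e(1)])
    then show ?thesis by (simp add: * power2_eq_square mult_ac)
  qed
  have S: "(\<Sum>j\<in>J. \<eta> j \<bullet> (X *v \<eta> j)) = (\<Sum>i\<in>UNIV. e i * w i)"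
    unfolding q w_def sum_distrib_left by (rule sum.swap)
  have w0: "w i \<ge> 0" for i unfolding w_def by (intro sum_nonneg) auto
  have w1: "w i \<le> 1" for i
  proof -
    have "w i \<le> (\<Sum>j\<in>UNIV. (\<xi> i \<bullet> \<eta> j)\<^sup>2)" unfolding w_def by (intro sum_mono2) auto
    also have "\<dots> = (norm (\<xi> i))\<^sup>2" unfolding onb_norm_expand[OF \<eta>(1)] by (simp add: inner_commute)
    finally show ?thesis using onb_norm[OF e(1)] by simp
  qed
  have "(\<Sum>i\<in>UNIV. w i) = (\<Sum>j\<in>J. (norm (\<eta> j))\<^sup>2)"
    unfolding w_def onb_norm_expand[OF e(1)] by (rule sum.swap)
  then have wk: "(\<Sum>i\<in>UNIV. w i) = real k" using \<eta> by (simp add: onb_norm)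
  define d where "d i = (if i \<in> I then 1 else 0 :: real)" for i
  have dk: "(\<Sum>i\<in>UNIV. d i) = real k" using I(1) by (simp add: d_def sum.If_cases)
  have "(\<Sum>i\<in>UNIV. e i * w i) - (\<Sum>i\<in>UNIV. e i * d i) = (\<Sum>i\<in>UNIV. (e i - \<mu>) * (w i - d i))"
    using wk dk by (simp add: algebra_simps sum_subtractf sum.distrib flip: sum_distrib_left)
  also have "\<dots> \<le> 0"
  proof (rule sum_nonpos)
    fix i show "(e i - \<mu>) * (w i - d i) \<le> 0"
      using I(3,4) w0[of i] w1[of i] by (cases "i \<in> I") (auto simp: d_def mult_le_0_iff)
  qed
  finally show ?thesis unfolding S I(2) by (simp add: d_def sum.If_cases if_distrib[of "\<lambda>a. _ * a"] cong: if_cong)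
qed

section \<open>Functions of class \<open>C\<^sup>2\<close>\<close>

lemma norm_matrix_vector_le: "norm (A *v v) \<le> norm A * norm v" for A :: "real^'n^'m"
proof -
  have "norm (A *v v) = L2_set (\<lambda>i. \<bar>A $ i \<bullet> v\<bar>) UNIV"
    by (simp add: norm_vec_def matrix_vector_mul_component)
  also have "\<dots> \<le> L2_set (\<lambda>i. norm (A $ i) * norm v) UNIV"
    by (intro L2_set_mono) (auto simp: Cauchy_Schwarz_ineq2)
  also have "\<dots> = norm A * norm v" by (simp add: norm_vec_def L2_set_left_distrib)
  finally show ?thesis .
qed

lemma bounded_bilinear_matrix_vector: "bounded_bilinear (\<lambda>(A :: real^'n^'m) v. A *v v)"
  by (rule bounded_bilinear.intro)
     (auto simp: matrix_vector_mult_add_rdistrib matrix_vector_right_distrib matrix_vector_mult_scaleR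
        scaleR_matrix_vector_assoc intro!: exI[of _ 1] norm_matrix_vector_le)

lemmas continuous_on_matrix_vector [continuous_intros] =
  bounded_bilinear.continuous_on[OF bounded_bilinear_matrix_vector]

text \<open>Carries gradient and Hessian explicitly, so that sums, multiples and translates can be
  computed, whereas \<open>C2_near\<close> keeps them existential. Symmetry of \<open>H\<close> is
  derived in \<open>C2_on_symmetric\<close>.\<close>

definition C2_on :: "(real^'n) set \<Rightarrow> (real^'n \<Rightarrow> real) \<Rightarrow> (real^'n \<Rightarrow> real^'n) \<Rightarrow> (real^'n \<Rightarrow> real^'n^'n) \<Rightarrow> bool" where
  "C2_on U \<phi> G H \<longleftrightarrow> open U \<and> (\<forall>x\<in>U. (\<phi> has_derivative (\<lambda>h. G x \<bullet> h)) (at x)) \<and>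
     (\<forall>x\<in>U. (G has_derivative (\<lambda>h. H x *v h)) (at x)) \<and> continuous_on U H"

lemma C2_near_iff: "C2_near x \<phi> X \<longleftrightarrow> (\<exists>U G H. x \<in> U \<and> C2_on U \<phi> G H \<and> H x = X)"
  unfolding C2_near_def C2_on_def by metis

lemma C2_onD:
  assumes "C2_on U \<phi> G H"
  shows "open U" "x \<in> U \<Longrightarrow> (\<phi> has_derivative (\<lambda>h. G x \<bullet> h)) (at x)"
    "x \<in> U \<Longrightarrow> (G has_derivative (\<lambda>h. H x *v h)) (at x)" "continuous_on U H"
  using assms by (auto simp: C2_on_def)

lemma C2_on_near: "C2_on U \<phi> G H \<Longrightarrow> x \<in> U \<Longrightarrow> C2_near x \<phi> (H x)"
  by (auto simp: C2_near_iff)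

lemma C2_on_continuous: "C2_on U \<phi> G H \<Longrightarrow> continuous_on U \<phi>"
  by (meson C2_onD(2) continuous_at_imp_continuous_on has_derivative_continuous)

lemma C2_on_subset: "C2_on U \<phi> G H \<Longrightarrow> open V \<Longrightarrow> V \<subseteq> U \<Longrightarrow> C2_on V \<phi> G H"
  unfolding C2_on_def by (meson continuous_on_subset subsetD)

lemma C2_on_add:
  assumes "C2_on U \<phi> G H" "C2_on U \<psi> G' H'"
  shows "C2_on U (\<lambda>x. \<phi> x + \<psi> x) (\<lambda>x. G x + G' x) (\<lambda>x. H x + H' x)"
  using assms unfolding C2_on_def
  by (auto intro!: continuous_intros derivative_eq_intros simp: inner_add_left matrix_vector_mult_add_rdistrib)

lemma C2_on_scale:
  assumes "C2_on U \<phi> G H"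
  shows "C2_on U (\<lambda>x. c * \<phi> x) (\<lambda>x. c *\<^sub>R G x) (\<lambda>x. c *\<^sub>R H x)"
  using assms unfolding C2_on_def
  by (auto intro!: continuous_intros derivative_eq_intros simp: scaleR_matrix_vector_assoc)

lemma C2_on_diff:
  assumes "C2_on U \<phi> G H" "C2_on U \<psi> G' H'"
  shows "C2_on U (\<lambda>x. \<phi> x - \<psi> x) (\<lambda>x. G x - G' x) (\<lambda>x. H x - H' x)"
  using C2_on_add[OF assms(1) C2_on_scale[OF assms(2), of "-1"]] by simp

lemma C2_on_const: "C2_on UNIV (\<lambda>x. c) (\<lambda>x. 0) (\<lambda>x. 0)"
  unfolding C2_on_def
  by (auto simp: has_derivative_const[unfolded fun_eq_iff] intro!: has_derivative_eq_rhs[OF has_derivative_const])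

lemma C2_on_shift:
  assumes "C2_on U \<phi> G H"
  shows "C2_on ((\<lambda>y. y - a) ` U) (\<lambda>y. \<phi> (y + a)) (\<lambda>y. G (y + a)) (\<lambda>y. H (y + a))"
proof -
  have s: "((\<lambda>y. y + a) has_derivative (\<lambda>h. h)) (at x)" for x by (auto intro!: derivative_eq_intros)
  have "open ((\<lambda>y. y - a) ` U)" using open_translation[OF C2_onD(1)[OF assms], of "-a"] by (simp add: image_def)
  moreover have "((\<lambda>y. \<phi> (y + a)) has_derivative (\<lambda>h. G (x + a) \<bullet> h)) (at x)" if "x + a \<in> U" for x
    using has_derivative_compose[OF s C2_onD(2)[OF assms that]] .
  moreover have "((\<lambda>y. G (y + a)) has_derivative (\<lambda>h. H (x + a) *v h)) (at x)" if "x + a \<in> U" for x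
    using has_derivative_compose[OF s C2_onD(3)[OF assms that]] .
  moreover have "continuous_on ((\<lambda>y. y - a) ` U) (\<lambda>y. H (y + a))"
    by (rule continuous_on_compose2[OF C2_onD(4)[OF assms]]) (auto intro!: continuous_intros)
  moreover have "z + a \<in> U" if "z \<in> (\<lambda>y. y - a) ` U" for z using that by auto
  ultimately show ?thesis unfolding C2_on_def by blast
qed

lemma C2_on_linear: "C2_on UNIV (\<lambda>y. b \<bullet> (y - x)) (\<lambda>y. b) (\<lambda>y. 0)"
  unfolding C2_on_def by (auto intro!: derivative_eq_intros)

lemma C2_on_quadratic:
  assumes "transpose A = A"
  shows "C2_on UNIV (\<lambda>y. (y - x) \<bullet> (A *v (y - x))) (\<lambda>y. 2 *\<^sub>R (A *v (y - x))) (\<lambda>y. 2 *\<^sub>R A)"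
proof -
  have "((\<lambda>y. A *v (y - x)) has_derivative (\<lambda>h. A *v h)) (at z)" for z
    by (rule bounded_linear.has_derivative[OF matrix_vector_mul_bounded_linear]) (auto intro!: derivative_eq_intros)
  note AD = this
  have "((\<lambda>y. (y - x) \<bullet> (A *v (y - x))) has_derivative (\<lambda>h. (2 *\<^sub>R (A *v (z - x))) \<bullet> h)) (at z)" for z
  proof -
    have "((\<lambda>y. y - x) has_derivative (\<lambda>h. h)) (at z)" by (auto intro!: derivative_eq_intros)
    then have "((\<lambda>y. (y - x) \<bullet> (A *v (y - x))) has_derivative (\<lambda>h. (z - x) \<bullet> (A *v h) + h \<bullet> (A *v (z - x)))) (at z)"
      by (rule has_derivative_inner[OF _ AD])
    moreover have "(z - x) \<bullet> (A *v h) + h \<bullet> (A *v (z - x)) = (2 *\<^sub>R (A *v (z - x))) \<bullet> h" for h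
      using symmetric_inner[OF assms, of "z - x" h] inner_commute[of h "A *v (z - x)"] by (simp only: inner_scaleR_left)
    ultimately show ?thesis by (simp only:)
  qed
  moreover have "((\<lambda>y. 2 *\<^sub>R (A *v (y - x))) has_derivative (\<lambda>h. (2 *\<^sub>R A) *v h)) (at z)" for z
    using has_derivative_scaleR_right[OF AD, of 2 z] by (simp add: scaleR_matrix_vector_assoc)
  ultimately show ?thesis unfolding C2_on_def by (simp only: open_UNIV continuous_on_const simp_thms ball_UNIV)
qed

lemma C2_on_dist: "C2_on UNIV (\<lambda>y. (norm (y - x))\<^sup>2) (\<lambda>y. 2 *\<^sub>R (y - x)) (\<lambda>y. 2 *\<^sub>R mat 1)"
  using C2_on_quadratic[of "mat 1" x] by (simp add: power2_norm_eq_inner)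

text \<open>For an orthonormal family, the matrix of the orthogonal projection onto the span of the
  \<xi> i with i in I.\<close>

definition proj_mat :: "('i \<Rightarrow> real^'n) \<Rightarrow> 'i set \<Rightarrow> real^'n^'n" where
  "proj_mat \<xi> I = (\<chi> a b. \<Sum>i\<in>I. \<xi> i $ a * \<xi> i $ b)"

lemma proj_mat_sym: "transpose (proj_mat \<xi> I) = proj_mat \<xi> I"
  by (simp add: proj_mat_def transpose_def mult.commute)

lemma proj_mat_apply: "proj_mat \<xi> I *v v = (\<Sum>i\<in>I. (\<xi> i \<bullet> v) *\<^sub>R \<xi> i)"
  by (simp add: proj_mat_def vec_eq_iff matrix_vector_mult_def inner_vec_def sum_distrib_left sum_distrib_right
      sum.swap[of _ UNIV I] mult_ac)

lemma proj_mat_quad: "v \<bullet> (proj_mat \<xi> I *v v) = (\<Sum>i\<in>I. (\<xi> i \<bullet> v)\<^sup>2)"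
  by (simp add: proj_mat_apply inner_sum_right inner_commute power2_eq_square)

lemma C2_on_proj: "C2_on UNIV (\<lambda>y. \<Sum>i\<in>I. (\<xi> i \<bullet> (y - x))\<^sup>2) (\<lambda>y. 2 *\<^sub>R (proj_mat \<xi> I *v (y - x))) (\<lambda>y. 2 *\<^sub>R proj_mat \<xi> I)"
  using C2_on_quadratic[OF proj_mat_sym[of \<xi> I], of x] by (simp add: proj_mat_quad)

text \<open>The mean value theorem in the direction u turns the second difference into a difference
  of gradients, which differentiability of \<open>G\<close> at the single point x evaluates.\<close>

lemma second_difference:
  assumes C: "C2_on U \<phi> G H" and x: "x \<in> U" and "e > 0"
  shows "\<exists>d>0. \<forall>t. 0 < t \<and> t < d \<longrightarrow>
    \<bar>\<phi> (x + t *\<^sub>R u + t *\<^sub>R w) - \<phi> (x + t *\<^sub>R u) - \<phi> (x + t *\<^sub>R w) + \<phi> x - t\<^sup>2 * ((H x *v w) \<bullet> u)\<bar> \<le> e * t\<^sup>2"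
proof -
  define M where "M = norm u + norm w + 1"
  have M: "M > 0" "norm u \<le> M" "norm w \<le> M" "norm u + norm w < M" by (auto simp: M_def add_nonneg_pos)
  \<comment> \<open>Two gradient errors of size e' t M each are paired with t u, where |u| is at
    most M, so the total is 2 e' M^2 t^2 = e t^2.\<close>
  define e' where "e' = e / (2 * M * M)"
  have e': "e' > 0" using \<open>e > 0\<close> M by (simp add: e'_def)
  obtain d1 where d1: "d1 > 0" "ball x d1 \<subseteq> U" using C2_onD(1)[OF C] x open_contains_ball by blast
  obtain d2 where d2: "d2 > 0" "\<And>y. norm (y - x) < d2 \<Longrightarrow> norm (G y - G x - H x *v (y - x)) \<le> e' * norm (y - x)"
    using C2_onD(3)[OF C x] e' unfolding has_derivative_at_alt by blast
  have "\<bar>\<phi> (x + t *\<^sub>R u + t *\<^sub>R w) - \<phi> (x + t *\<^sub>R u) - \<phi> (x + t *\<^sub>R w) + \<phi> x - t\<^sup>2 * ((H x *v w) \<bullet> u)\<bar> \<le> e * t\<^sup>2"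
    if t: "0 < t" "t < min d1 d2 / M" for t
  proof -
    have tM: "t * M < d1" "t * M < d2" using t M by (auto simp: field_simps)
    have near: "norm (s *\<^sub>R u + r *\<^sub>R w) \<le> t * M" if "0 \<le> s" "s \<le> t" "0 \<le> r" "r \<le> t" for s r
    proof -
      have "norm (s *\<^sub>R u + r *\<^sub>R w) \<le> s * norm u + r * norm w"
        using norm_triangle_ineq[of "s *\<^sub>R u" "r *\<^sub>R w"] that by simp
      also have "\<dots> \<le> t * norm u + t * norm w" using that by (intro add_mono mult_right_mono) auto
      also have "\<dots> \<le> t * M" using t M by (simp flip: distrib_left)
      finally show ?thesis .
    qed
    have U: "x + s *\<^sub>R u + r *\<^sub>R w \<in> U" if "0 \<le> s" "s \<le> t" "0 \<le> r" "r \<le> t" for s r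
      using near[OF that] tM d1(2) by (auto simp: dist_norm subset_iff add.assoc norm_minus_commute)
    define g where "g s = \<phi> (x + s *\<^sub>R u + t *\<^sub>R w) - \<phi> (x + s *\<^sub>R u)" for s
    have D: "(g has_derivative (\<lambda>r. G (x + s *\<^sub>R u + t *\<^sub>R w) \<bullet> (r *\<^sub>R u) - G (x + s *\<^sub>R u) \<bullet> (r *\<^sub>R u))) (at s within {0..t})"
      if s: "s \<in> {0..t}" for s
    proof -
      have 1: "((\<lambda>s. x + s *\<^sub>R u + c) has_derivative (\<lambda>r. r *\<^sub>R u)) (at s within {0..t})" for c
        by (auto intro!: derivative_eq_intros)
      have 2: "((\<lambda>s. \<phi> (x + s *\<^sub>R u + c)) has_derivative (\<lambda>r. G (x + s *\<^sub>R u + c) \<bullet> (r *\<^sub>R u))) (at s within {0..t})"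
        if "x + s *\<^sub>R u + c \<in> U" for c
        by (rule has_derivative_compose[OF 1 C2_onD(2)[OF C that]])
      show ?thesis
        unfolding g_def
        using has_derivative_diff[OF 2[OF U[of s t]] 2[of 0]] U[of s 0] s t by simp
    qed
    obtain s0 where "s0 \<in> {0<..<t}" "g t - g 0 = G (x + s0 *\<^sub>R u + t *\<^sub>R w) \<bullet> ((t - 0) *\<^sub>R u) - G (x + s0 *\<^sub>R u) \<bullet> ((t - 0) *\<^sub>R u)"
      using mvt_simple[OF t(1) D] by auto
    then obtain s where s: "0 < s" "s < t"
      "g t - g 0 = t * ((G (x + s *\<^sub>R u + t *\<^sub>R w) - G (x + s *\<^sub>R u)) \<bullet> u)"
      by (auto simp: inner_diff_left algebra_simps)
    let ?D = "G (x + s *\<^sub>R u + t *\<^sub>R w) - G (x + s *\<^sub>R u)"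
    have n: "norm (G (x + z) - G x - H x *v z) \<le> e' * (t * M)" if "norm z \<le> t * M" for z
      using d2(2)[of "x + z"] that tM e' by (auto intro: order_trans)
    have "norm (?D - t *\<^sub>R (H x *v w)) =
        norm ((G (x + (s *\<^sub>R u + t *\<^sub>R w)) - G x - H x *v (s *\<^sub>R u + t *\<^sub>R w)) - (G (x + s *\<^sub>R u) - G x - H x *v (s *\<^sub>R u)))"
      by (rule arg_cong[of _ _ norm]) (simp add: matrix_vector_right_distrib matrix_vector_mult_scaleR algebra_simps)
    also have "\<dots> \<le> e' * (t * M) + e' * (t * M)"
      by (rule order_trans[OF norm_triangle_ineq4], rule add_mono)
         (use n[OF near[of s t]] n[of "s *\<^sub>R u"] near[of s 0] s t in auto)
    finally have D: "norm (?D - t *\<^sub>R (H x *v w)) \<le> 2 * e' * (t * M)" by (simp add: mult_ac)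
    have "\<bar>(g t - g 0) - t\<^sup>2 * ((H x *v w) \<bullet> u)\<bar> = t * \<bar>(?D - t *\<^sub>R (H x *v w)) \<bullet> u\<bar>"
    proof -
      have "(g t - g 0) - t\<^sup>2 * ((H x *v w) \<bullet> u) = t * ((?D - t *\<^sub>R (H x *v w)) \<bullet> u)"
        unfolding s(3) by (simp add: inner_diff_left power2_eq_square algebra_simps)
      then show ?thesis using t by (simp add: abs_mult)
    qed
    also have "\<dots> \<le> t * ((2 * e' * (t * M)) * M)"
      using t D M e' by (intro mult_left_mono order_trans[OF Cauchy_Schwarz_ineq2] mult_mono) auto
    also have "\<dots> = e * t\<^sup>2" using M by (simp add: e'_def power2_eq_square field_simps)
    finally show ?thesis by (simp add: g_def algebra_simps)
  qed
  then show ?thesis using d1 d2 M by (intro exI[of _ "min d1 d2 / M"]) auto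
qed

text \<open>The second difference does not change when u and w are exchanged. Symmetry matters
  because eigenvalue sums are meaningful, and Ky Fan's principle holds, for symmetric
  matrices.\<close>

lemma C2_on_symmetric:
  assumes C: "C2_on U \<phi> G H" and x: "x \<in> U"
  shows "transpose (H x) = H x"
proof -
  have *: "(H x *v w) \<bullet> u = (H x *v u) \<bullet> w" for u w
  proof -
    have "\<bar>(H x *v w) \<bullet> u - (H x *v u) \<bullet> w\<bar> \<le> 0 + e" if ep: "e > 0" for e
    proof -
      obtain d where d: "d > 0" "\<And>t. 0 < t \<and> t < d \<Longrightarrow>
    \<bar>\<phi> (x + t *\<^sub>R u + t *\<^sub>R w) - \<phi> (x + t *\<^sub>R u) - \<phi> (x + t *\<^sub>R w) + \<phi> x - t\<^sup>2 * ((H x *v w) \<bullet> u)\<bar> \<le> (e/2) * t\<^sup>2"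
        using second_difference[OF C x, of "e/2" u w] half_gt_zero[OF ep] by blast
      obtain d' where d': "d' > 0" "\<And>t. 0 < t \<and> t < d' \<Longrightarrow>
    \<bar>\<phi> (x + t *\<^sub>R w + t *\<^sub>R u) - \<phi> (x + t *\<^sub>R w) - \<phi> (x + t *\<^sub>R u) + \<phi> x - t\<^sup>2 * ((H x *v u) \<bullet> w)\<bar> \<le> (e/2) * t\<^sup>2"
        using second_difference[OF C x, of "e/2" w u] half_gt_zero[OF ep] by blast
      define t where "t = min d d' / 2"
      have t: "0 < t" "t < d" "t < d'" using d(1) d'(1) by (auto simp: t_def)
      have c: "x + t *\<^sub>R w + t *\<^sub>R u = x + t *\<^sub>R u + t *\<^sub>R w" by simp
      have "\<bar>t\<^sup>2 * ((H x *v w) \<bullet> u) - t\<^sup>2 * ((H x *v u) \<bullet> w)\<bar> \<le> e * t\<^sup>2"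
        using d(2)[of t] d'(2)[of t] t unfolding c by (simp add: abs_if split: if_splits)
      then have "t\<^sup>2 * \<bar>(H x *v w) \<bullet> u - (H x *v u) \<bullet> w\<bar> \<le> t\<^sup>2 * e"
        by (simp add: abs_mult mult.commute flip: right_diff_distrib)
      then show ?thesis using t by simp
    qed
    then have "\<bar>(H x *v w) \<bullet> u - (H x *v u) \<bullet> w\<bar> \<le> 0" by (rule field_le_epsilon)
    then show ?thesis by simp
  qed
  have "H x $ i $ j = H x $ j $ i" for i j
    using *[of "axis j 1" "axis i 1"] by (simp add: matrix_vector_mul_component inner_axis inner_axis' )
  then show ?thesis by (simp add: transpose_def vec_eq_iff)
qed

lemma C2_near_symmetric: "C2_near x \<phi> X \<Longrightarrow> transpose X = X"
  using C2_on_symmetric unfolding C2_near_iff by metis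

text \<open>The mean value theorem along the segment, applied to the remainder, whose gradient is
  o(|y - x|) by differentiability of \<open>G\<close> at x.\<close>

lemma C2_on_taylor:
  assumes C: "C2_on U \<phi> G H" and x: "x \<in> U" and "e > 0"
  shows "\<exists>d>0. \<forall>y. dist y x < d \<longrightarrow>
    \<bar>\<phi> y - (\<phi> x + G x \<bullet> (y - x) + (y - x) \<bullet> (H x *v (y - x)) / 2)\<bar> \<le> e * (norm (y - x))\<^sup>2"
proof -
  let ?r = "\<lambda>y. \<phi> y - (\<phi> x + G x \<bullet> (y - x) + (y - x) \<bullet> (H x *v (y - x)) / 2)"
  have Q: "C2_on U (\<lambda>y. \<phi> x + G x \<bullet> (y - x) + (1/2) * ((y - x) \<bullet> (H x *v (y - x))))
     (\<lambda>y. 0 + G x + (1/2) *\<^sub>R (2 *\<^sub>R (H x *v (y - x)))) (\<lambda>y. 0 + 0 + (1/2) *\<^sub>R (2 *\<^sub>R H x))"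
    using C2_on_subset[OF C2_on_add[OF C2_on_add[OF C2_on_const C2_on_linear] C2_on_scale[OF C2_on_quadratic[OF C2_on_symmetric[OF C x]]]] C2_onD(1)[OF C]]
    by blast
  have R: "(?r has_derivative (\<lambda>h. (G y - G x - H x *v (y - x)) \<bullet> h)) (at y)" if "y \<in> U" for y
  proof -
    have "G y - (0 + G x + (1 / 2) *\<^sub>R (2 *\<^sub>R (H x *v (y - x)))) = G y - G x - H x *v (y - x)" by simp
    then show ?thesis using C2_onD(2)[OF C2_on_diff[OF C Q] that] by (simp only:) simp
  qed
  obtain d1 where d1: "d1 > 0" "ball x d1 \<subseteq> U" using C2_onD(1)[OF C] x open_contains_ball by blast
  obtain d2 where d2: "d2 > 0" "\<And>y. norm (y - x) < d2 \<Longrightarrow> norm (G y - G x - H x *v (y - x)) \<le> e * norm (y - x)"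
    using C2_onD(3)[OF C x] \<open>e > 0\<close> unfolding has_derivative_at_alt by blast
  have "\<bar>?r y\<bar> \<le> e * (norm (y - x))\<^sup>2" if y: "dist y x < min d1 d2" for y
  proof -
    define g where "g s = ?r (x + s *\<^sub>R (y - x))" for s
    have ns: "norm (s *\<^sub>R (y - x)) \<le> norm (y - x)" if "0 \<le> s" "s \<le> 1" for s
      using that by (simp add: mult_left_le_one_le)
    have D: "(g has_derivative (\<lambda>r. (G (x + s *\<^sub>R (y - x)) - G x - H x *v (x + s *\<^sub>R (y - x) - x)) \<bullet> (r *\<^sub>R (y - x)))) (at s within {0..1})"
      if s: "s \<in> {0..1}" for s
    proof -
      have "norm (s *\<^sub>R (y - x)) < d1" using ns[of s] s y by (auto simp: dist_norm)
      then have U: "x + s *\<^sub>R (y - x) \<in> U" using d1(2) by (auto simp: subset_iff dist_norm)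
      have 1: "((\<lambda>s. x + s *\<^sub>R (y - x)) has_derivative (\<lambda>r. r *\<^sub>R (y - x))) (at s within {0..1})"
        by (auto intro!: derivative_eq_intros)
      show ?thesis
        unfolding g_def by (rule has_derivative_compose[OF 1 R[OF U]])
    qed
    obtain s0 where "s0 \<in> {0<..<1}" "g 1 - g 0 = (G (x + s0 *\<^sub>R (y - x)) - G x - H x *v (x + s0 *\<^sub>R (y - x) - x)) \<bullet> ((1 - 0) *\<^sub>R (y - x))"
      using mvt_simple[OF zero_less_one D] by auto
    then obtain s where s: "0 < s" "s < 1" "g 1 - g 0 = (G (x + s *\<^sub>R (y - x)) - G x - H x *v (s *\<^sub>R (y - x))) \<bullet> (y - x)"
      by auto
    have "norm (G (x + s *\<^sub>R (y - x)) - G x - H x *v (s *\<^sub>R (y - x))) \<le> e * norm (s *\<^sub>R (y - x))"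
      using d2(2)[of "x + s *\<^sub>R (y - x)"] ns[of s] s y by (auto simp: dist_norm)
    also have "\<dots> \<le> e * norm (y - x)" using ns[of s] s \<open>e > 0\<close> by (intro mult_left_mono) auto
    finally have "\<bar>g 1 - g 0\<bar> \<le> e * norm (y - x) * norm (y - x)" unfolding s(3)
      by (intro order_trans[OF Cauchy_Schwarz_ineq2] mult_right_mono) auto
    then show ?thesis by (simp add: g_def power2_eq_square)
  qed
  then show ?thesis using d1 d2 by (intro exI[of _ "min d1 d2"]) auto
qed

lemma C2_on_local_min:
  assumes C: "C2_on U \<phi> G H" and x: "x \<in> U" and m: "\<forall>\<^sub>F y in nhds x. \<phi> x \<le> \<phi> y"
  shows "0 \<le> v \<bullet> (H x *v v)"
proof (rule ccontr)
  assume neg: "\<not> 0 \<le> v \<bullet> (H x *v v)"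
  define q where "q = v \<bullet> (H x *v v)"
  have q: "q < 0" using neg by (simp add: q_def)
  have v: "v \<noteq> 0" using neg by auto
  \<comment> \<open>The Taylor error along s v then has size - s^2 q / 4, half of the quadratic
    term. Both signs s = t and s = - t are used at the end, so that the gradient term
    cancels.\<close>
  define e where "e = - q / (4 * (norm v)\<^sup>2)"
  have e: "e > 0" using q v by (simp add: e_def divide_neg_pos)
  obtain d where d: "d > 0" "\<And>y. dist y x < d \<Longrightarrow>
    \<bar>\<phi> y - (\<phi> x + G x \<bullet> (y - x) + (y - x) \<bullet> (H x *v (y - x)) / 2)\<bar> \<le> e * (norm (y - x))\<^sup>2"
    using C2_on_taylor[OF C x e] by blast
  obtain d' where d': "d' > 0" "\<And>y. dist y x < d' \<Longrightarrow> \<phi> x \<le> \<phi> y"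
    using m unfolding eventually_nhds_metric by blast
  define t where "t = min d d' / (2 * norm v)"
  have t: "t > 0" using d(1) d'(1) v by (simp add: t_def)
  have tn: "t * norm v < d" "t * norm v < d'" using d(1) d'(1) v by (auto simp: t_def)
  have *: "\<phi> (x + s *\<^sub>R v) \<le> \<phi> x + s * (G x \<bullet> v) + s\<^sup>2 * q / 4" "\<phi> x \<le> \<phi> (x + s *\<^sub>R v)" if "\<bar>s\<bar> = t" for s
  proof -
    have n: "dist (x + s *\<^sub>R v) x < d" "dist (x + s *\<^sub>R v) x < d'" using tn that by (auto simp: dist_norm)
    have "e * (norm (s *\<^sub>R v))\<^sup>2 = - s\<^sup>2 * q / 4" using v by (simp add: e_def power_mult_distrib)
    then show "\<phi> (x + s *\<^sub>R v) \<le> \<phi> x + s * (G x \<bullet> v) + s\<^sup>2 * q / 4"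
      using d(2)[OF n(1)] by (simp add: matrix_vector_mult_scaleR q_def power2_eq_square abs_le_iff)
    show "\<phi> x \<le> \<phi> (x + s *\<^sub>R v)" by (rule d'(2)[OF n(2)])
  qed
  have "t\<^sup>2 * q < 0" using t q by (simp add: mult_pos_neg)
  then show False using *[of t] *[of "-t"] t by simp
qed

section \<open>Monotonicity and continuity of the eigenvalue sum\<close>

lemma Pplus_le_Pplus:
  fixes X Y :: "real^'n^'n"
  assumes sym: "transpose X = X" "transpose Y = Y" and k: "1 \<le> k" "k \<le> CARD('n)"
    and le: "\<And>v. v \<bullet> (X *v v) \<le> v \<bullet> (Y *v v) + c * (norm v)\<^sup>2"
  shows "Pplus k X \<le> Pplus k Y + k * c"
proof -
  obtain \<xi> I where I: "onb \<xi>" "card I = k" "Pplus k X = (\<Sum>i\<in>I. \<xi> i \<bullet> (X *v \<xi> i))"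
    using Pplus_attained[OF sym(1) k] by blast
  have "(\<Sum>i\<in>I. \<xi> i \<bullet> (X *v \<xi> i)) \<le> (\<Sum>i\<in>I. \<xi> i \<bullet> (Y *v \<xi> i) + c)"
    using le[of "\<xi> _"] onb_norm[OF I(1)] by (intro sum_mono) simp
  also have "\<dots> = (\<Sum>i\<in>I. \<xi> i \<bullet> (Y *v \<xi> i)) + k * c" by (simp add: sum.distrib I(2))
  also have "\<dots> \<le> Pplus k Y + k * c" using Pplus_ge[OF sym(2) k I(1,2)] by simp
  finally show ?thesis using I(3) by simp
qed

lemma Pplus_mono:
  fixes X Y :: "real^'n^'n"
  assumes "transpose X = X" "transpose Y = Y" "1 \<le> k" "k \<le> CARD('n)" "\<And>v. v \<bullet> (X *v v) \<le> v \<bullet> (Y *v v)"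
  shows "Pplus k X \<le> Pplus k Y"
  using Pplus_le_Pplus[OF assms(1-4), of 0] assms(5) by simp

lemma Pplus_lipschitz:
  fixes X Y :: "real^'n^'n"
  assumes sym: "transpose X = X" "transpose Y = Y" and k: "1 \<le> k" "k \<le> CARD('n)"
  shows "\<bar>Pplus k X - Pplus k Y\<bar> \<le> k * dist X Y"
proof -
  have *: "v \<bullet> (A *v v) \<le> v \<bullet> (B *v v) + dist A B * (norm v)\<^sup>2" for A B :: "real^'n^'n" and v
  proof -
    have "v \<bullet> ((A - B) *v v) \<le> norm v * (norm (A - B) * norm v)"
      by (intro order_trans[OF norm_cauchy_schwarz] mult_left_mono norm_matrix_vector_le) auto
    then show ?thesis by (simp add: matrix_vector_mult_diff_rdistrib inner_diff_right dist_norm power2_eq_square mult_ac)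
  qed
  show ?thesis
    using Pplus_le_Pplus[OF sym k *] Pplus_le_Pplus[OF sym(2,1) k *] by (simp add: dist_commute)
qed

lemma C2_on_Pplus_continuous:
  fixes \<phi> :: "real^'n \<Rightarrow> real"
  assumes C: "C2_on U \<phi> G H" and k: "1 \<le> k" "k \<le> CARD('n)"
  shows "continuous_on U (\<lambda>x. Pplus k (H x))"
  unfolding continuous_on_iff
proof (intro ballI allI impI)
  fix x and e :: real assume x: "x \<in> U" and e: "e > 0"
  obtain d where d: "d > 0" "\<And>y. y \<in> U \<Longrightarrow> dist y x < d \<Longrightarrow> dist (H y) (H x) < e / k"
    using C2_onD(4)[OF C, unfolded continuous_on_iff, rule_format, OF x, of "e / k"] e k by auto
  have "dist (Pplus k (H y)) (Pplus k (H x)) < e" if "y \<in> U" "dist y x < d" for y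
  proof -
    have "\<bar>Pplus k (H y) - Pplus k (H x)\<bar> \<le> k * dist (H y) (H x)"
      by (intro Pplus_lipschitz C2_on_symmetric[OF C] x that k)
    also have "\<dots> < e" using d(2)[OF that] k by (simp add: field_simps)
    finally show ?thesis by (simp add: dist_real_def)
  qed
  then show "\<exists>d>0. \<forall>x'\<in>U. dist x' x < d \<longrightarrow> dist (Pplus k (H x')) (Pplus k (H x)) < e" using d(1) by blast
qed

text \<open>Both inequalities are instances of \<open>Pplus_le_Pplus\<close>, with c and with - c.
  This is how a quadratic perturbation makes a viscosity inequality strict by a known
  amount.\<close>

lemma Pplus_add_id:
  fixes X :: "real^'n^'n"
  assumes "transpose X = X" and k: "1 \<le> k" "k \<le> CARD('n)"
  shows "Pplus k (X + c *\<^sub>R mat 1) = Pplus k X + k * c"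
proof -
  have t: "transpose (X + c *\<^sub>R mat 1) = X + c *\<^sub>R mat 1"
    using assms(1) by (simp add: transpose_def vec_eq_iff mat_def)
  have q: "v \<bullet> ((X + c *\<^sub>R mat 1) *v v) = v \<bullet> (X *v v) + c * (norm v)\<^sup>2" for v
    by (simp add: matrix_vector_mult_add_rdistrib inner_add_right power2_norm_eq_inner flip: scaleR_matrix_vector_assoc)
  show ?thesis
    using Pplus_le_Pplus[OF t assms(1) k, of c] Pplus_le_Pplus[OF assms(1) t k, of "-c"] by (simp add: q)
qed

section \<open>Harmonic extension of polynomials from a sphere\<close>

text \<open>The data of an affine plane through x with the directions \<xi> i, i in I. The other
  frame vectors are kept because test functions live on the whole space; \<open>lap\<close> is the
  Laplacian along the plane.\<close>

locale frame =
  fixes \<xi> :: "'n::finite \<Rightarrow> real^'n" and I :: "'n set" and x :: "real^'n"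
  assumes onb: "onb \<xi>" and I_ne: "I \<noteq> {}"
begin

definition coord :: "'n \<Rightarrow> real^'n \<Rightarrow> real" where "coord i y = \<xi> i \<bullet> (y - x)"

definition rho :: "real^'n \<Rightarrow> real" where "rho y = (\<Sum>i\<in>I. (coord i y)\<^sup>2)"

text \<open>Homogeneous polynomials in the coordinates of the plane, generated so that rule
  induction proves closure under differentiation. Every degree contains the zero function because I
  is nonempty.\<close>

inductive homog :: "nat \<Rightarrow> (real^'n \<Rightarrow> real) \<Rightarrow> bool" where
  const: "homog 0 (\<lambda>_. a)"
| mult: "i \<in> I \<Longrightarrow> homog m p \<Longrightarrow> homog (Suc m) (\<lambda>y. coord i y * p y)"
| add: "homog m p \<Longrightarrow> homog m q \<Longrightarrow> homog m (\<lambda>y. p y + q y)"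

definition pd :: "'n \<Rightarrow> (real^'n \<Rightarrow> real) \<Rightarrow> real^'n \<Rightarrow> real" where
  "pd j p y = frechet_derivative p (at y) (\<xi> j)"

definition lap :: "(real^'n \<Rightarrow> real) \<Rightarrow> real^'n \<Rightarrow> real" where
  "lap p y = (\<Sum>j\<in>I. pd j (pd j p) y)"

lemma coord_deriv: "(coord i has_derivative (\<lambda>h. \<xi> i \<bullet> h)) (at y)"
  unfolding coord_def by (auto intro!: derivative_eq_intros)

lemma homog_zero: "homog m (\<lambda>_. 0)"
proof (induction m)
  case (Suc m)
  obtain i where "i \<in> I" using I_ne by blast
  from homog.mult[OF this Suc] show ?case by simp
qed (rule homog.const)

lemma homog_scale: "homog m p \<Longrightarrow> homog m (\<lambda>y. a * p y)"
proof (induction rule: homog.induct)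
  case (mult i m p)
  then show ?case using homog.mult[of i m "\<lambda>y. a * p y"] by (simp add: mult.left_commute)
next
  case (add m p q)
  then show ?case using homog.add[of m "\<lambda>y. a * p y" "\<lambda>y. a * q y"] by (simp add: distrib_left)
qed (rule homog.const)

lemma homog_sum: "(\<And>j. j \<in> J \<Longrightarrow> homog m (f j)) \<Longrightarrow> homog m (\<lambda>y. \<Sum>j\<in>J. f j y)"
proof (induction J rule: infinite_finite_induct)
  case (insert j J)
  then show ?case using homog.add[of m "f j" "\<lambda>y. \<Sum>j\<in>J. f j y"] by simp
qed (auto simp: homog_zero)

lemma homog_diff: "homog m p \<Longrightarrow> homog m q \<Longrightarrow> homog m (\<lambda>y. p y - q y)"
  using homog.add[OF _ homog_scale[of m q "-1"], of p] by simp

text \<open>The last conjunct is Euler's identity. The clause for m = 0 stands separately because m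
  - 1 truncates to 0 there, and the degree alone would not say that the derivative vanishes.\<close>

lemma homog_deriv:
  "homog m p \<Longrightarrow> \<exists>d. (\<forall>j. homog (m - 1) (d j)) \<and> (m = 0 \<longrightarrow> (\<forall>j. d j = (\<lambda>_. 0))) \<and>
     (\<forall>y. (p has_derivative (\<lambda>h. \<Sum>j\<in>I. d j y * (\<xi> j \<bullet> h))) (at y)) \<and>
     (\<forall>y. (\<Sum>j\<in>I. coord j y * d j y) = m * p y)"
proof (induction rule: homog.induct)
  case (const a)
  then show ?case by (intro exI[of _ "\<lambda>j y. 0"]) (auto intro: homog.const)
next
  case (mult i m p)
  then obtain d where d: "\<And>j. homog (m - 1) (d j)" "m = 0 \<Longrightarrow> d j = (\<lambda>_. 0)"
     "\<And>y. (p has_derivative (\<lambda>h. \<Sum>j\<in>I. d j y * (\<xi> j \<bullet> h))) (at y)"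
     "\<And>y. (\<Sum>j\<in>I. coord j y * d j y) = m * p y" for j by blast
  let ?d = "\<lambda>j y. coord i y * d j y + (if j = i then p y else 0)"
  have "homog m (?d j)" for j
  proof -
    have "homog m (\<lambda>y. coord i y * d j y)"
    proof (cases m)
      case 0
      then show ?thesis using d(2) homog_zero by simp
    next
      case (Suc n)
      then show ?thesis using homog.mult[OF mult(1) d(1)[of j]] by simp
    qed
    moreover have "homog m (\<lambda>y. if j = i then p y else 0)" using mult(2) homog_zero by (cases "j = i") auto
    ultimately show ?thesis by (rule homog.add)
  qed
  moreover have "((\<lambda>y. coord i y * p y) has_derivative (\<lambda>h. \<Sum>j\<in>I. ?d j y * (\<xi> j \<bullet> h))) (at y)" for y
  proof -
    have "((\<lambda>y. coord i y * p y) has_derivative (\<lambda>h. coord i y * (\<Sum>j\<in>I. d j y * (\<xi> j \<bullet> h)) + (\<xi> i \<bullet> h) * p y)) (at y)"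
      by (rule has_derivative_mult[OF coord_deriv d(3)])
    moreover have "coord i y * (\<Sum>j\<in>I. d j y * (\<xi> j \<bullet> h)) + (\<xi> i \<bullet> h) * p y = (\<Sum>j\<in>I. ?d j y * (\<xi> j \<bullet> h))" for h
    proof -
      have "(\<Sum>j\<in>I. ?d j y * (\<xi> j \<bullet> h)) = (\<Sum>j\<in>I. coord i y * (d j y * (\<xi> j \<bullet> h)) + (if j = i then p y * (\<xi> i \<bullet> h) else 0))"
        by (intro sum.cong) (auto simp: algebra_simps)
      then show ?thesis using mult(1) by (simp add: sum.distrib sum_distrib_left mult.commute)
    qed
    ultimately show ?thesis by simp
  qed
  moreover have "(\<Sum>j\<in>I. coord j y * ?d j y) = Suc m * (coord i y * p y)" for y
  proof -
    have "(\<Sum>j\<in>I. coord j y * ?d j y) = coord i y * (\<Sum>j\<in>I. coord j y * d j y) + coord i y * p y"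
      using mult(1) by (simp add: distrib_left sum.distrib sum_distrib_left mult_ac if_distrib[of "\<lambda>a. _ * a"] cong: if_cong)
    then show ?thesis using d(4) by (simp add: algebra_simps)
  qed
  ultimately show ?case by (intro exI[of _ ?d]) auto
next
  case (add m p q)
  obtain d where d: "\<And>j. homog (m - 1) (d j)" "m = 0 \<Longrightarrow> d j = (\<lambda>_. 0)"
     "\<And>y. (p has_derivative (\<lambda>h. \<Sum>j\<in>I. d j y * (\<xi> j \<bullet> h))) (at y)"
     "\<And>y. (\<Sum>j\<in>I. coord j y * d j y) = m * p y" for j using add(3) by blast
  obtain d' where d': "\<And>j. homog (m - 1) (d' j)" "m = 0 \<Longrightarrow> d' j = (\<lambda>_. 0)"
     "\<And>y. (q has_derivative (\<lambda>h. \<Sum>j\<in>I. d' j y * (\<xi> j \<bullet> h))) (at y)"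
     "\<And>y. (\<Sum>j\<in>I. coord j y * d' j y) = m * q y" for j using add(4) by blast
  show ?case
  proof (intro exI[of _ "\<lambda>j y. d j y + d' j y"] conjI allI impI)
    show "homog (m - 1) (\<lambda>y. d j y + d' j y)" for j using d(1) d'(1) by (rule homog.add)
    show "(\<lambda>y. d j y + d' j y) = (\<lambda>_. 0)" if "m = 0" for j using that d(2) d'(2) by simp
    show "((\<lambda>y. p y + q y) has_derivative (\<lambda>h. \<Sum>j\<in>I. (d j y + d' j y) * (\<xi> j \<bullet> h))) (at y)" for y
      using has_derivative_add[OF d(3) d'(3), of y] by (simp add: distrib_right sum.distrib)
    show "(\<Sum>j\<in>I. coord j y * (d j y + d' j y)) = m * (p y + q y)" for y
      using d(4) d'(4) by (simp add: distrib_left sum.distrib)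
  qed
qed

lemma pd_eq: "(\<And>y. (p has_derivative D y) (at y)) \<Longrightarrow> pd j p = (\<lambda>y. D y (\<xi> j))"
  unfolding pd_def by (metis frechet_derivative_at)

lemma homog_pd:
  assumes "homog m p"
  shows "j \<in> I \<Longrightarrow> homog (m - 1) (pd j p)" "j \<in> I \<Longrightarrow> m = 0 \<Longrightarrow> pd j p = (\<lambda>_. 0)"
    "(p has_derivative (\<lambda>h. \<Sum>j\<in>I. pd j p y * (\<xi> j \<bullet> h))) (at y)"
    "(\<Sum>j\<in>I. coord j y * pd j p y) = m * p y"
proof -
  obtain d where d: "\<And>j. homog (m - 1) (d j)" "m = 0 \<Longrightarrow> d j = (\<lambda>_. 0)"
     "\<And>y. (p has_derivative (\<lambda>h. \<Sum>j\<in>I. d j y * (\<xi> j \<bullet> h))) (at y)"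
     "\<And>y. (\<Sum>j\<in>I. coord j y * d j y) = m * p y" for j using homog_deriv[OF assms] by blast
  have e: "pd j p = d j" if "j \<in> I" for j
    unfolding pd_eq[OF d(3)] using that
    by (simp add: onb_inner[OF onb] if_distrib[of "\<lambda>a. _ * a"] fun_eq_iff cong: if_cong)
  show "j \<in> I \<Longrightarrow> homog (m - 1) (pd j p)" "j \<in> I \<Longrightarrow> m = 0 \<Longrightarrow> pd j p = (\<lambda>_. 0)" using d(1,2) e by auto
  show "(p has_derivative (\<lambda>h. \<Sum>j\<in>I. pd j p y * (\<xi> j \<bullet> h))) (at y)" using d(3)[of y] e by simp
  show "(\<Sum>j\<in>I. coord j y * pd j p y) = m * p y" using d(4)[of y] e by simp
qed

inductive polyn :: "(real^'n \<Rightarrow> real) \<Rightarrow> bool" where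
  homog: "homog m p \<Longrightarrow> polyn p"
| add: "polyn p \<Longrightarrow> polyn q \<Longrightarrow> polyn (\<lambda>y. p y + q y)"

lemma polyn_scale: "polyn p \<Longrightarrow> polyn (\<lambda>y. a * p y)"
  by (induction rule: polyn.induct) (auto simp: distrib_left intro: polyn.intros homog_scale)

lemma polyn_diff: "polyn p \<Longrightarrow> polyn q \<Longrightarrow> polyn (\<lambda>y. p y - q y)"
  using polyn.add[OF _ polyn_scale[of q "-1"], of p] by simp

lemma polyn_const: "polyn (\<lambda>_. a)" by (rule polyn.homog[OF homog.const])

lemma polyn_sum: "(\<And>j. j \<in> J \<Longrightarrow> polyn (f j)) \<Longrightarrow> polyn (\<lambda>y. \<Sum>j\<in>J. f j y)"
proof (induction J rule: infinite_finite_induct)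
  case (insert j J)
  then show ?case using polyn.add[of "f j" "\<lambda>y. \<Sum>j\<in>J. f j y"] by simp
qed (auto simp: polyn_const)

lemma polyn_coord_mult: "i \<in> I \<Longrightarrow> polyn p \<Longrightarrow> polyn (\<lambda>y. coord i y * p y)"
  by (rotate_tac, induction rule: polyn.induct) (auto simp: distrib_left intro: polyn.intros homog.mult)

lemma polyn_mult: "polyn p \<Longrightarrow> polyn q \<Longrightarrow> polyn (\<lambda>y. p y * q y)"
proof (induction rule: polyn.induct)
  case (homog m p)
  then show ?case
    by (induction rule: homog.induct) (auto simp: distrib_right mult.assoc intro: polyn.add polyn_coord_mult polyn_scale)
qed (auto simp: distrib_right intro: polyn.add)

lemma polyn_deriv: "polyn p \<Longrightarrow> (p has_derivative (\<lambda>h. \<Sum>j\<in>I. pd j p y * (\<xi> j \<bullet> h))) (at y)"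
proof (induction arbitrary: y rule: polyn.induct)
  case (homog m p)
  then show ?case by (rule homog_pd(3))
next
  case (add p q)
  have D: "((\<lambda>y. p y + q y) has_derivative (\<lambda>h. (\<Sum>j\<in>I. pd j p y * (\<xi> j \<bullet> h)) + (\<Sum>j\<in>I. pd j q y * (\<xi> j \<bullet> h)))) (at y)" for y
    by (rule has_derivative_add[OF add.IH])
  have "(\<Sum>j\<in>I. pd j p y * (\<xi> j \<bullet> h)) + (\<Sum>j\<in>I. pd j q y * (\<xi> j \<bullet> h))
      = (\<Sum>j\<in>I. pd j (\<lambda>y. p y + q y) y * (\<xi> j \<bullet> h))" for h
    unfolding pd_eq[OF D]
    by (simp add: onb_inner[OF onb] if_distrib[of "\<lambda>a. _ * a"] distrib_right sum.distrib cong: if_cong)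
  then show ?case using D[of y] by simp
qed

lemma pd_add: "polyn p \<Longrightarrow> polyn q \<Longrightarrow> pd j (\<lambda>y. p y + q y) = (\<lambda>y. pd j p y + pd j q y)"
  using pd_eq[OF has_derivative_add[OF polyn_deriv[of p] polyn_deriv[of q]], of j]
    pd_eq[OF polyn_deriv[of p], of j] pd_eq[OF polyn_deriv[of q], of j] by (simp add: fun_eq_iff)

lemma pd_scale: "polyn p \<Longrightarrow> pd j (\<lambda>y. a * p y) = (\<lambda>y. a * pd j p y)"
  using pd_eq[OF has_derivative_mult_right[OF polyn_deriv[of p], of a], of j]
    pd_eq[OF polyn_deriv[of p], of j] by (simp add: fun_eq_iff)

lemma pd_mult: "polyn p \<Longrightarrow> polyn q \<Longrightarrow> pd j (\<lambda>y. p y * q y) = (\<lambda>y. p y * pd j q y + pd j p y * q y)"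
  using pd_eq[OF has_derivative_mult[OF polyn_deriv[of p] polyn_deriv[of q]], of j]
    pd_eq[OF polyn_deriv[of p], of j] pd_eq[OF polyn_deriv[of q], of j] by (simp add: fun_eq_iff)

lemma polyn_pd: "polyn p \<Longrightarrow> j \<in> I \<Longrightarrow> polyn (pd j p)"
  by (induction rule: polyn.induct) (auto simp: pd_add intro: polyn.intros homog_pd(1))

lemma polyn_lap: "polyn p \<Longrightarrow> polyn (lap p)"
  unfolding lap_def[abs_def] by (intro polyn_sum polyn_pd)

lemma lap_add: "polyn p \<Longrightarrow> polyn q \<Longrightarrow> lap (\<lambda>y. p y + q y) = (\<lambda>y. lap p y + lap q y)"
  by (simp add: lap_def fun_eq_iff pd_add polyn_pd sum.distrib)

lemma lap_scale: "polyn p \<Longrightarrow> lap (\<lambda>y. a * p y) = (\<lambda>y. a * lap p y)"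
  by (simp add: lap_def fun_eq_iff pd_scale polyn_pd sum_distrib_left)

lemma lap_diff: "polyn p \<Longrightarrow> polyn q \<Longrightarrow> lap (\<lambda>y. p y - q y) = (\<lambda>y. lap p y - lap q y)"
  using lap_add[OF _ polyn_scale[of q "-1"], of p] lap_scale[of q "-1"] by simp

lemma homog_lap: "homog m p \<Longrightarrow> homog (m - 2) (lap p)"
  unfolding lap_def[abs_def]
  using homog_pd(1) by (intro homog_sum) (metis diff_diff_left one_add_one)

lemma lap_low: "homog m p \<Longrightarrow> m \<le> 1 \<Longrightarrow> lap p = (\<lambda>_. 0)"
  unfolding lap_def[abs_def] using homog_pd(1)[of m p] homog_pd(2)[of 0] by (simp add: fun_eq_iff)

lemma polyn_rho: "polyn rho"
proof -
  have "polyn (\<lambda>y. \<Sum>i\<in>I. coord i y * (coord i y * 1))" by (intro polyn_sum polyn_coord_mult polyn_const)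
  then show ?thesis by (simp add: rho_def[abs_def] power2_eq_square)
qed

lemma homog_rho: "homog m a \<Longrightarrow> homog (m + 2) (\<lambda>y. rho y * a y)"
proof -
  assume "homog m a"
  then have "homog (m + 2) (\<lambda>y. \<Sum>i\<in>I. coord i y * (coord i y * a y))" by (auto intro!: homog_sum homog.mult)
  then show ?thesis by (simp add: rho_def power2_eq_square sum_distrib_right mult.assoc)
qed

lemma polyn_coord: "i \<in> I \<Longrightarrow> polyn (coord i)"
  using polyn_coord_mult[OF _ polyn_const[of 1]] by simp

lemma pd_coord: "j \<in> I \<Longrightarrow> pd j (coord i) = (\<lambda>_. if i = j then 1 else 0)"
  using pd_eq[OF coord_deriv, of j i] by (simp add: onb_inner[OF onb])

lemma pd_rho: "j \<in> I \<Longrightarrow> pd j rho = (\<lambda>y. 2 * coord j y)"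
proof -
  assume j: "j \<in> I"
  have "(rho has_derivative (\<lambda>h. \<Sum>i\<in>I. 2 * coord i y * (\<xi> i \<bullet> h))) (at y)" for y
    unfolding rho_def[abs_def] by (auto intro!: derivative_eq_intros coord_deriv sum.cong simp: mult_ac)
  from pd_eq[OF this, of j] j show ?thesis
    by (simp add: onb_inner[OF onb] if_distrib[of "\<lambda>a. _ * a"] cong: if_cong)
qed

text \<open>Product rule: the cross terms add up to 4 m a by Euler's identity, and the Laplacian of
  \<open>rho\<close> is twice the dimension of the plane.\<close>

lemma lap_rho:
  assumes a: "homog m a"
  shows "lap (\<lambda>y. rho y * a y) y = rho y * lap a y + (4 * real m + 2 * real (card I)) * a y"
proof -
  have pa: "polyn a" using a by (rule polyn.homog)
  have "pd j (pd j (\<lambda>y. rho y * a y)) y = rho y * pd j (pd j a) y + 4 * (coord j y * pd j a y) + 2 * a y" if j: "j \<in> I" for j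
  proof -
    have "pd j (\<lambda>y. rho y * a y) = (\<lambda>y. rho y * pd j a y + 2 * (coord j y * a y))"
      unfolding pd_mult[OF polyn_rho pa] pd_rho[OF j] by (simp add: mult_ac)
    moreover have "pd j (\<lambda>y. rho y * pd j a y + 2 * (coord j y * a y))
       = (\<lambda>y. (rho y * pd j (pd j a) y + 2 * coord j y * pd j a y) + 2 * (coord j y * pd j a y + a y))"
      using j by (simp add: pd_add pd_scale pd_mult pd_rho pd_coord polyn_mult polyn_rho polyn_pd pa polyn_scale polyn_coord)
    ultimately show ?thesis by simp
  qed
  then have "lap (\<lambda>y. rho y * a y) y = (\<Sum>j\<in>I. rho y * pd j (pd j a) y + 4 * (coord j y * pd j a y) + 2 * a y)"
    by (simp add: lap_def)
  also have "\<dots> = rho y * lap a y + 4 * (m * a y) + card I * (2 * a y)"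
    using homog_pd(4)[OF a, of y] by (simp add: lap_def sum.distrib flip: sum_distrib_left)
  finally show ?thesis by (simp add: algebra_simps)
qed

text \<open>The commutator identity \<open>lap_rho\<close> turns the ansatz \<open>q = (g - rho a) / b\<close> into an equation of the same
  form for \<open>a\<close>, of degree \<open>m - 2\<close> and with a larger constant.\<close>

lemma solve_homogeneous:
  "homog m g \<Longrightarrow> b > 0 \<Longrightarrow> \<exists>q. homog m q \<and> (\<forall>y. rho y * lap q y + b * q y = g y)"
proof (induction m arbitrary: g b rule: less_induct)
  case (less m)
  show ?case
  proof (cases "m \<le> 1")
    case True
    have "homog m (\<lambda>y. (1 / b) * g y)" by (rule homog_scale[OF less.prems(1)])
    then show ?thesis using lap_low[OF _ True] less.prems(2) by (intro exI[of _ "\<lambda>y. (1 / b) * g y"]) auto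
  next
    case False
    let ?b = "b + (4 * real (m - 2) + 2 * real (card I))"
    obtain a where a: "homog (m - 2) a" "\<And>y. rho y * lap a y + ?b * a y = lap g y"
      using less.IH[of "m - 2" "lap g" ?b] homog_lap[OF less.prems(1)] False less.prems(2) by auto
    let ?q = "\<lambda>y. (1 / b) * (g y - rho y * a y)"
    have ra: "homog m (\<lambda>y. rho y * a y)" using homog_rho[OF a(1)] False by (metis One_nat_def Suc_1 le_add_diff_inverse2 not_less_eq_eq)
    have q: "homog m ?q" by (intro homog_scale homog_diff less.prems(1) ra)
    have "lap ?q y = a y" for y
    proof -
      have "lap ?q y = (1 / b) * (lap g y - lap (\<lambda>y. rho y * a y) y)"
        using less.prems(1) ra by (simp only: lap_scale[OF polyn_diff] lap_diff polyn.homog)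
      also have "\<dots> = (1 / b) * (b * a y)"
        unfolding lap_rho[OF a(1)] a(2)[symmetric] by (simp add: algebra_simps)
      finally show ?thesis using less.prems(2) by simp
    qed
    then show ?thesis using q less.prems(2) by (intro exI[of _ ?q]) (simp add: field_simps)
  qed
qed

text \<open>The solution is q2 - q1. The constant is that of \<open>lap_rho\<close>, so q1 from
  \<open>solve_homogeneous\<close> makes the Laplacian of rho q1 equal to g; the leftover R lap q1
  has degree m - 2 and is absorbed by q2 from the induction hypothesis. In degrees at most 1 there
  is no leftover.\<close>

lemma solve_homog:
  "homog m g \<Longrightarrow> \<exists>q. polyn q \<and> (\<forall>y. lap (\<lambda>y. (R - rho y) * q y) y = g y)"
proof (induction m arbitrary: g rule: less_induct)
  case (less m)
  have L: "lap (\<lambda>y. (R - rho y) * q y) y = R * lap q y - lap (\<lambda>y. rho y * q y) y" if "polyn q" for q y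
    using lap_diff[of "\<lambda>y. R * q y" "\<lambda>y. rho y * q y"] that
    by (simp add: left_diff_distrib polyn_mult polyn_rho polyn_scale lap_scale)
  have "4 * real m + 2 * real (card I) > 0"
  proof -
    have "card I > 0" using I_ne by (simp add: card_gt_0_iff)
    then show ?thesis by simp
  qed
  then obtain q1 where q1: "homog m q1" "\<And>y. rho y * lap q1 y + (4 * real m + 2 * real (card I)) * q1 y = g y"
    using solve_homogeneous[OF less.prems] by blast
  have L1: "lap (\<lambda>y. (R - rho y) * q1 y) y = R * lap q1 y - g y" for y
    unfolding L[OF polyn.homog[OF q1(1)]] lap_rho[OF q1(1)] q1(2)[symmetric] by simp
  have "\<exists>q2. polyn q2 \<and> (\<forall>y. lap (\<lambda>y. (R - rho y) * q2 y) y = R * lap q1 y)"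
  proof (cases "m \<le> 1")
    case True
    have "lap (\<lambda>y. 0) y = 0" for y using lap_low[OF homog_zero[of 0]] by simp
    then show ?thesis using lap_low[OF q1(1) True] by (intro exI[of _ "\<lambda>_. 0"]) (simp add: polyn_const)
  next
    case False
    then show ?thesis using less.IH[of "m - 2" "\<lambda>y. R * lap q1 y"] homog_scale[OF homog_lap[OF q1(1)]] by simp
  qed
  then obtain q2 where q2: "polyn q2" "\<And>y. lap (\<lambda>y. (R - rho y) * q2 y) y = R * lap q1 y" by blast
  have p: "polyn (\<lambda>y. (R - rho y) * q y)" if "polyn q" for q by (intro polyn_mult that polyn_diff polyn_const polyn_rho)
  have "lap (\<lambda>y. (R - rho y) * (q2 y - q1 y)) y = g y" for y
    using lap_diff[OF p[OF q2(1)] p[OF polyn.homog[OF q1(1)]]] q2(2) L1 by (simp add: right_diff_distrib)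
  then show ?case using polyn_diff[OF q2(1) polyn.homog[OF q1(1)]] by blast
qed

lemma solve_polyn:
  "polyn g \<Longrightarrow> \<exists>q. polyn q \<and> (\<forall>y. lap (\<lambda>y. (R - rho y) * q y) y = g y)"
proof (induction rule: polyn.induct)
  case (homog m p)
  then show ?case by (rule solve_homog)
next
  case (add g g')
  then obtain q q' where q: "polyn q" "\<And>y. lap (\<lambda>y. (R - rho y) * q y) y = g y"
    "polyn q'" "\<And>y. lap (\<lambda>y. (R - rho y) * q' y) y = g' y" by blast
  have p: "polyn (\<lambda>y. (R - rho y) * q y)" if "polyn q" for q by (intro polyn_mult that polyn_diff polyn_const polyn_rho)
  have "lap (\<lambda>y. (R - rho y) * (q y + q' y)) y = g y + g' y" for y
    using lap_add[OF p[OF q(1)] p[OF q(3)]] q(2,4) by (simp add: distrib_left)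
  then show ?case using polyn.add[OF q(1,3)] by blast
qed

text \<open>Subtracting a multiple of R - rho changes nothing on the sphere rho = R, so it suffices
  to match the Laplacian of p by that of such a multiple.\<close>

lemma harmonic_extension:
  assumes "polyn p"
  shows "\<exists>h. polyn h \<and> (\<forall>y. lap h y = 0) \<and> (\<forall>y. rho y = R \<longrightarrow> h y = p y)"
proof -
  obtain q where q: "polyn q" "\<And>y. lap (\<lambda>y. (R - rho y) * q y) y = lap p y"
    using solve_polyn[OF polyn_lap[OF assms]] by blast
  have p: "polyn (\<lambda>y. (R - rho y) * q y)" by (intro polyn_mult q(1) polyn_diff polyn_const polyn_rho)
  show ?thesis
    using polyn_diff[OF assms p] lap_diff[OF assms p] q(2)
    by (intro exI[of _ "\<lambda>y. p y - (R - rho y) * q y"]) simp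
qed

lemma polyn_C2:
  assumes p: "polyn p"
  shows "\<exists>G H. C2_on UNIV p G H \<and> (\<forall>y. (\<Sum>i\<in>I. \<xi> i \<bullet> (H y *v \<xi> i)) = lap p y)"
proof -
  define G where "G y = (\<Sum>j\<in>I. pd j p y *\<^sub>R \<xi> j)" for y
  define H :: "real^'n \<Rightarrow> real^'n^'n" where
    "H y = (\<chi> a b. \<Sum>j\<in>I. \<Sum>i\<in>I. pd i (pd j p) y * \<xi> j $ a * \<xi> i $ b)" for y
  have Hv: "H y *v v = (\<Sum>j\<in>I. (\<Sum>i\<in>I. pd i (pd j p) y * (\<xi> i \<bullet> v)) *\<^sub>R \<xi> j)" for y v
    by (simp add: H_def vec_eq_iff matrix_vector_mult_def inner_vec_def sum_distrib_left sum_distrib_right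
        sum.swap[of _ UNIV I] mult_ac)
  have cont: "continuous_on UNIV q" if "polyn q" for q
    using polyn_deriv[OF that] by (meson continuous_at_imp_continuous_on has_derivative_continuous)
  have "(p has_derivative (\<lambda>h. G y \<bullet> h)) (at y)" for y
    using polyn_deriv[OF p, of y] by (simp add: G_def inner_sum_left)
  moreover have "(G has_derivative (\<lambda>h. H y *v h)) (at y)" for y
    unfolding G_def[abs_def] Hv
    by (intro has_derivative_sum has_derivative_scaleR_left polyn_deriv polyn_pd p)
  moreover have "continuous_on UNIV H" unfolding H_def[abs_def]
    by (intro continuous_intros cont polyn_pd p) auto
  moreover have "(\<Sum>i\<in>I. \<xi> i \<bullet> (H y *v \<xi> i)) = lap p y" for y
    unfolding Hv by (simp add: inner_sum_right onb_inner[OF onb] lap_def if_distrib[of "\<lambda>a. _ * a"] cong: if_cong)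
  ultimately show ?thesis unfolding C2_on_def by blast
qed

section \<open>Density of harmonic functions on a sphere\<close>

lemma polyn_of_polynomial:
  "real_polynomial_function P \<Longrightarrow> \<exists>p. polyn p \<and> (\<forall>y. (\<forall>j. j \<notin> I \<longrightarrow> coord j y = 0) \<longrightarrow> P y = p y)"
proof (induction rule: real_polynomial_function.induct)
  case (linear f)
  let ?p = "\<lambda>y. f x + (\<Sum>i\<in>I. coord i y * f (\<xi> i))"
  have "polyn ?p" by (intro polyn.add polyn_const polyn_sum polyn_coord_mult)
  moreover have "f y = ?p y" if y: "\<And>j. j \<notin> I \<Longrightarrow> coord j y = 0" for y
  proof -
    \<comment> \<open>On the plane only the coordinates in I vary, so the expansion in the frame
      loses all other terms.\<close>
    have "y - x = (\<Sum>i\<in>UNIV. coord i y *\<^sub>R \<xi> i)" using onb_expand[OF onb, of "y - x"] by (simp add: coord_def)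
    also have "\<dots> = (\<Sum>i\<in>I. coord i y *\<^sub>R \<xi> i)" by (rule sum.mono_neutral_right) (auto simp: y)
    finally have "f (y - x) = (\<Sum>i\<in>I. coord i y * f (\<xi> i))"
      using linear by (simp add: linear_sum[OF bounded_linear.linear] linear_scale[OF bounded_linear.linear])
    then show ?thesis using linear by (simp add: linear_diff[OF bounded_linear.linear])
  qed
  ultimately show ?case by blast
next
  case (const a)
  then show ?case using polyn_const by blast
next
  case (add f g)
  then obtain p q where "polyn p" "polyn q" "\<forall>y. (\<forall>j. j \<notin> I \<longrightarrow> coord j y = 0) \<longrightarrow> f y = p y"
    "\<forall>y. (\<forall>j. j \<notin> I \<longrightarrow> coord j y = 0) \<longrightarrow> g y = q y" by blast
  then show ?case using polyn.add[of p q] by (intro exI[of _ "\<lambda>y. p y + q y"]) auto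
next
  case (mult f g)
  then obtain p q where "polyn p" "polyn q" "\<forall>y. (\<forall>j. j \<notin> I \<longrightarrow> coord j y = 0) \<longrightarrow> f y = p y"
    "\<forall>y. (\<forall>j. j \<notin> I \<longrightarrow> coord j y = 0) \<longrightarrow> g y = q y" by blast
  then show ?case using polyn_mult[of p q] by (intro exI[of _ "\<lambda>y. p y * q y"]) auto
qed

definition sphere_on :: "real \<Rightarrow> (real^'n) set" where
  "sphere_on r = {y. rho y = r\<^sup>2 \<and> (\<forall>j. j \<notin> I \<longrightarrow> coord j y = 0)}"

definition disc_on :: "real \<Rightarrow> (real^'n) set" where
  "disc_on r = {y. rho y \<le> r\<^sup>2 \<and> (\<forall>j. j \<notin> I \<longrightarrow> coord j y = 0)}"

lemma norm_split: "(norm (y - x))\<^sup>2 = rho y + (\<Sum>j\<in>-I. (coord j y)\<^sup>2)"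
  unfolding onb_norm_expand[OF onb] rho_def coord_def
  using sum.union_disjoint[of I "-I" "\<lambda>i. (\<xi> i \<bullet> (y - x))\<^sup>2"] by simp

lemma continuous_coord: "continuous_on S (coord i)"
  unfolding coord_def[abs_def] by (intro continuous_intros)

lemma continuous_rho: "continuous_on S rho"
  unfolding rho_def[abs_def] by (intro continuous_intros continuous_coord)

lemma disc_on_norm: "y \<in> disc_on r \<Longrightarrow> 0 \<le> r \<Longrightarrow> norm (y - x) \<le> r"
proof -
  assume y: "y \<in> disc_on r" and r: "0 \<le> r"
  have "(\<Sum>j\<in>-I. (coord j y)\<^sup>2) = 0" by (intro sum.neutral) (use y in \<open>auto simp: disc_on_def\<close>)
  then have "(norm (y - x))\<^sup>2 \<le> r\<^sup>2" using y norm_split[of y] by (simp add: disc_on_def)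
  then show ?thesis using r by (rule power2_le_imp_le)
qed

lemma sphere_subset_disc: "sphere_on r \<subseteq> disc_on r" by (auto simp: sphere_on_def disc_on_def)

lemma compact_sphere_on: "0 \<le> r \<Longrightarrow> compact (sphere_on r)"
proof -
  assume r: "0 \<le> r"
  have "closed (sphere_on r)"
  proof -
    have eq: "sphere_on r = {y. rho y = r\<^sup>2} \<inter> (\<Inter>j\<in>-I. {y. coord j y = 0})" by (auto simp: sphere_on_def)
    show ?thesis unfolding eq
      by (intro closed_Int closed_INT ballI closed_Collect_eq continuous_rho continuous_coord continuous_on_const)
  qed
  moreover have "bounded (sphere_on r)"
    using disc_on_norm[OF _ r] sphere_subset_disc
    by (intro boundedI[of _ "r + norm x"]) (smt (verit, best) norm_triangle_sub subsetD)
  ultimately show ?thesis by (simp add: compact_eq_bounded_closed)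
qed

text \<open>Stone-Weierstrass gives a polynomial close to W on the sphere, and its harmonic
  extension has the same values there. This density takes the place of the Poisson integral.\<close>

lemma harmonic_approx:
  assumes "continuous_on (sphere_on r) W" "0 \<le> r" "e > 0"
  shows "\<exists>h G H. C2_on UNIV h G H \<and> (\<forall>y. (\<Sum>i\<in>I. \<xi> i \<bullet> (H y *v \<xi> i)) = 0) \<and> (\<forall>y\<in>sphere_on r. \<bar>W y - h y\<bar> < e)"
proof -
  obtain P where P: "real_polynomial_function P" "\<And>y. y \<in> sphere_on r \<Longrightarrow> \<bar>W y - P y\<bar> < e"
    using Stone_Weierstrass_real_polynomial_function[OF compact_sphere_on[OF assms(2)] assms(1,3)] by blast
  obtain p where p: "polyn p" "\<And>y. (\<And>j. j \<notin> I \<Longrightarrow> coord j y = 0) \<Longrightarrow> P y = p y"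
    using polyn_of_polynomial[OF P(1)] by blast
  obtain h where h: "polyn h" "\<And>y. lap h y = 0" "\<And>y. rho y = r\<^sup>2 \<Longrightarrow> h y = p y"
    using harmonic_extension[OF p(1), of "r\<^sup>2"] by blast
  obtain G H where "C2_on UNIV h G H" "\<And>y. (\<Sum>i\<in>I. \<xi> i \<bullet> (H y *v \<xi> i)) = lap h y" using polyn_C2[OF h(1)] by blast
  moreover have "\<bar>W y - h y\<bar> < e" if "y \<in> sphere_on r" for y
    using P(2)[OF that] h(3)[of y] p(2)[of y] that by (simp add: sphere_on_def)
  ultimately show ?thesis using h(2) by (intro exI[of _ h] exI[of _ G] exI[of _ H]) auto
qed

end

section \<open>The mean value inequality on spheres\<close>

text \<open>Uniformity in the parameter y makes a convolution with a nonnegative kernel a uniform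
  limit of finite nonnegative combinations of translates, so that a property closed under these
  operations passes to it.\<close>

lemma uniform_riemann:
  fixes F :: "'a::euclidean_space \<times> 'b::metric_space \<Rightarrow> real"
  assumes "compact K" and cont: "continuous_on (cbox u v \<times> K) F" and "e > 0"
  shows "\<exists>d>0. \<forall>p. p tagged_division_of cbox u v \<and> (\<lambda>x. ball x d) fine p \<longrightarrow>
    (\<forall>y\<in>K. \<bar>(\<Sum>(a,T)\<in>p. measure lborel T * F (a, y)) - integral (cbox u v) (\<lambda>a. F (a, y))\<bar> \<le> e)"
proof -
  \<comment> \<open>The summand 1 keeps the denominator positive for a degenerate box.\<close>
  define e' where "e' = e / (measure lborel (cbox u v) + 1)"
  have e': "e' > 0" unfolding e'_def using \<open>e > 0\<close> by (simp add: add_nonneg_pos)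
  have "uniformly_continuous_on (cbox u v \<times> K) F"
    by (intro compact_uniformly_continuous cont compact_Times compact_cbox assms)
  then obtain d where d: "d > 0" "\<And>z z'. z \<in> cbox u v \<times> K \<Longrightarrow> z' \<in> cbox u v \<times> K \<Longrightarrow> dist z' z < d \<Longrightarrow> dist (F z') (F z) < e'"
    using e' unfolding uniformly_continuous_on_def by metis
  have "\<bar>(\<Sum>(a,T)\<in>p. measure lborel T * F (a, y)) - integral (cbox u v) (\<lambda>a. F (a, y))\<bar> \<le> e"
    if p: "p tagged_division_of cbox u v" "(\<lambda>x. ball x d) fine p" and y: "y \<in> K" for p y
  proof -
    let ?f = "\<lambda>a. F (a, y)"
    have "continuous_on (cbox u v) ?f"
      by (rule continuous_on_compose2[OF cont]) (use y in \<open>auto intro!: continuous_intros\<close>)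
    then have int: "?f integrable_on cbox u v" by (rule integrable_continuous)
    have "integral (cbox u v) ?f = (\<Sum>(a,T)\<in>p. integral T ?f)"
      by (rule integral_combine_tagged_division_topdown[OF int p(1)])
    then have "\<bar>(\<Sum>(a,T)\<in>p. measure lborel T * ?f a) - integral (cbox u v) ?f\<bar> = \<bar>\<Sum>(a,T)\<in>p. (measure lborel T * ?f a - integral T ?f)\<bar>"
      by (simp add: sum_subtractf case_prod_unfold)
    also have "\<dots> \<le> (\<Sum>(a,T)\<in>p. e' * measure lborel T)"
    proof (rule order_trans[OF sum_abs sum_mono], clarsimp)
      fix a T assume aT: "(a, T) \<in> p"
      obtain l m where T: "T = cbox l m" "a \<in> T" "T \<subseteq> cbox u v" using tagged_division_ofD(2-4)[OF p(1) aT] by blast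
      have "?f integrable_on T" using int integrable_on_subcbox T by blast
      then have "((\<lambda>z. ?f a - ?f z) has_integral measure lborel T * ?f a - integral T ?f) (cbox l m)"
        using has_integral_diff[OF has_integral_const[of "?f a" l m] integrable_integral] T(1) by simp
      moreover have "norm (?f a - ?f z) \<le> e'" if "z \<in> cbox l m" for z
      proof -
        have "T \<subseteq> ball a d" using p(2) aT by (auto simp: fine_def)
        then have "dist (a, y) (z, y) < d" using that T by (auto simp: dist_Pair_Pair)
        then have "dist (F (a, y)) (F (z, y)) < e'" using that T y by (intro d(2)) auto
        then show ?thesis by (simp add: dist_norm)
      qed
      ultimately show "\<bar>measure lborel T * ?f a - integral T ?f\<bar> \<le> e' * measure lborel T"
        using has_integral_bound[of e' "\<lambda>z. ?f a - ?f z" _ l m] e' T(1) by simp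
    qed
    also have "\<dots> = e' * measure lborel (cbox u v)"
      using additive_content_tagged_division[OF p(1)] by (simp add: case_prod_unfold flip: sum_distrib_left)
    also have "\<dots> \<le> e"
      using \<open>e > 0\<close> unfolding e'_def by (simp add: divide_simps add_nonneg_pos) 
    finally show ?thesis .
  qed
  then show ?thesis using d(1) by blast
qed

context frame
begin

section \<open>Mean value inequalities tested by harmonic functions\<close>

definition harmonic :: "(real^'n \<Rightarrow> real) \<Rightarrow> bool" where
  "harmonic h \<longleftrightarrow> (\<exists>G H. C2_on UNIV h G H \<and> (\<forall>y. (\<Sum>i\<in>I. \<xi> i \<bullet> (H y *v \<xi> i)) = 0))"

lemma harmonic_const: "harmonic (\<lambda>y. a)"
  unfolding harmonic_def using C2_on_const[of a] by fastforce

lemma harmonic_scale: "harmonic h \<Longrightarrow> harmonic (\<lambda>y. a * h y)"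
  unfolding harmonic_def
proof (elim exE conjE)
  fix G H assume "C2_on UNIV h G H" "\<forall>y. (\<Sum>i\<in>I. \<xi> i \<bullet> (H y *v \<xi> i)) = 0"
  then show "\<exists>G H. C2_on UNIV (\<lambda>y. a * h y) G H \<and> (\<forall>y. (\<Sum>i\<in>I. \<xi> i \<bullet> (H y *v \<xi> i)) = 0)"
    using C2_on_scale[of UNIV h G H a]
    by (intro exI[of _ "\<lambda>y. a *\<^sub>R G y"] exI[of _ "\<lambda>y. a *\<^sub>R H y"])
       (simp flip: scaleR_matrix_vector_assoc sum_distrib_left)
qed

lemma harmonic_add: "harmonic h \<Longrightarrow> harmonic h' \<Longrightarrow> harmonic (\<lambda>y. h y + h' y)"
  unfolding harmonic_def
proof (elim exE conjE)
  fix G H G' H' assume "C2_on UNIV h G H" "\<forall>y. (\<Sum>i\<in>I. \<xi> i \<bullet> (H y *v \<xi> i)) = 0"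
    "C2_on UNIV h' G' H'" "\<forall>y. (\<Sum>i\<in>I. \<xi> i \<bullet> (H' y *v \<xi> i)) = 0"
  then show "\<exists>G H. C2_on UNIV (\<lambda>y. h y + h' y) G H \<and> (\<forall>y. (\<Sum>i\<in>I. \<xi> i \<bullet> (H y *v \<xi> i)) = 0)"
    using C2_on_add[of UNIV h G H h' G' H']
    by (intro exI[of _ "\<lambda>y. G y + G' y"] exI[of _ "\<lambda>y. H y + H' y"])
       (simp add: matrix_vector_mult_add_rdistrib inner_add_right sum.distrib)
qed

lemma harmonic_diff: "harmonic h \<Longrightarrow> harmonic h' \<Longrightarrow> harmonic (\<lambda>y. h y - h' y)"
  using harmonic_add[OF _ harmonic_scale[of h' "-1"]] by simp

lemma harmonic_shift: "harmonic h \<Longrightarrow> harmonic (\<lambda>y. h (y + a))"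
  unfolding harmonic_def
proof (elim exE conjE)
  fix G H assume "C2_on UNIV h G H" "\<forall>y. (\<Sum>i\<in>I. \<xi> i \<bullet> (H y *v \<xi> i)) = 0"
  then show "\<exists>G H. C2_on UNIV (\<lambda>y. h (y + a)) G H \<and> (\<forall>y. (\<Sum>i\<in>I. \<xi> i \<bullet> (H y *v \<xi> i)) = 0)"
    using C2_on_shift[of UNIV h G H a]
    by (intro exI[of _ "\<lambda>y. G (y + a)"] exI[of _ "\<lambda>y. H (y + a)"]) (simp add: surj_diff_right)
qed

text \<open>For continuous W this says that the average of W over the sphere is at most W x + b: a
  harmonic function has its own average as central value, and the harmonic functions are dense on
  the sphere.\<close>

definition sphere_super :: "real \<Rightarrow> (real^'n \<Rightarrow> real) \<Rightarrow> real \<Rightarrow> bool" where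
  "sphere_super r W b \<longleftrightarrow> (\<forall>h. harmonic h \<and> (\<forall>y\<in>sphere_on r. h y \<le> W y) \<longrightarrow> h x \<le> W x + b)"

lemma trace_proj:
  "(\<Sum>i\<in>I. \<xi> i \<bullet> (proj_mat \<xi> I *v \<xi> i)) = card I" "(\<Sum>i\<in>I. \<xi> i \<bullet> (proj_mat \<xi> (-I) *v \<xi> i)) = 0"
proof -
  have "\<xi> i \<bullet> (proj_mat \<xi> J *v \<xi> i) = (if i \<in> J then 1 else 0)" for i J
    unfolding proj_mat_quad by (simp add: onb_inner[OF onb] if_distrib[of "\<lambda>a. a\<^sup>2"] cong: if_cong)
  then show "(\<Sum>i\<in>I. \<xi> i \<bullet> (proj_mat \<xi> I *v \<xi> i)) = card I" "(\<Sum>i\<in>I. \<xi> i \<bullet> (proj_mat \<xi> (-I) *v \<xi> i)) = 0"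
    by simp_all
qed

lemma C2_on_rho: "C2_on UNIV rho (\<lambda>y. 2 *\<^sub>R (proj_mat \<xi> I *v (y - x))) (\<lambda>y. 2 *\<^sub>R proj_mat \<xi> I)"
  using C2_on_proj[where \<xi>=\<xi> and I=I and x=x] by (simp add: rho_def[abs_def] coord_def)

text \<open>The squared distance to the plane. Its Hessian has trace zero along I, which makes it a
  free penalty.\<close>

definition sigma :: "real^'n \<Rightarrow> real" where "sigma y = (\<Sum>j\<in>-I. (coord j y)\<^sup>2)"

lemma C2_on_sigma: "C2_on UNIV sigma (\<lambda>y. 2 *\<^sub>R (proj_mat \<xi> (-I) *v (y - x))) (\<lambda>y. 2 *\<^sub>R proj_mat \<xi> (-I))"
  using C2_on_proj[where \<xi>=\<xi> and I="-I" and x=x] by (simp add: sigma_def[abs_def] coord_def)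

lemma sigma_nonneg: "sigma y \<ge> 0" unfolding sigma_def by (intro sum_nonneg) auto

lemma rho_center: "rho x = 0" "sigma x = 0" by (simp_all add: rho_def sigma_def coord_def)

lemma card_I: "real (card I) > 0" using I_ne by (simp add: card_gt_0_iff)

definition flat :: "real^'n \<Rightarrow> real^'n" where "flat y = y - (\<Sum>j\<in>-I. coord j y *\<^sub>R \<xi> j)"

lemma flat_coord: "coord i (flat y) = (if i \<in> I then coord i y else 0)"
proof -
  have "coord i (flat y) = coord i y - (\<Sum>j\<in>-I. coord j y * (\<xi> i \<bullet> \<xi> j))"
    by (simp add: coord_def flat_def inner_diff_right inner_sum_right)
  then show ?thesis by (simp add: onb_inner[OF onb] if_distrib[of "\<lambda>a. _ * a"] cong: if_cong)
qed

lemma flat_rho: "rho (flat y) = rho y" by (simp add: rho_def flat_coord)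

lemma flat_dist: "(dist y (flat y))\<^sup>2 = sigma y"
proof -
  have "y - flat y = (\<Sum>j\<in>-I. coord j y *\<^sub>R \<xi> j)" by (simp add: flat_def)
  then have "\<xi> i \<bullet> (y - flat y) = (if i \<in> I then 0 else coord i y)" for i
    by (simp add: inner_sum_right onb_inner[OF onb] if_distrib[of "\<lambda>a. _ * a"] cong: if_cong)
  then show ?thesis unfolding dist_norm onb_norm_expand[OF onb]
    by (simp add: sigma_def if_distrib[of "\<lambda>a. a\<^sup>2"] sum.If_cases Compl_eq_Diff_UNIV cong: if_cong) 
qed

lemma compact_disc_on: "0 \<le> r \<Longrightarrow> compact (disc_on r)"
proof -
  assume r: "0 \<le> r"
  have eq: "disc_on r = {y. rho y \<le> r\<^sup>2} \<inter> (\<Inter>j\<in>-I. {y. coord j y = 0})" by (auto simp: disc_on_def)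
  have "closed (disc_on r)" unfolding eq
    by (intro closed_Int closed_INT ballI closed_Collect_eq closed_Collect_le continuous_rho continuous_coord continuous_on_const)
  moreover have "disc_on r \<subseteq> cball x r" using disc_on_norm[OF _ r] by (auto simp: dist_norm norm_minus_commute)
  ultimately show ?thesis by (meson bounded_cball bounded_subset compact_eq_bounded_closed)
qed

lemma center_in_disc: "x \<in> disc_on r" by (simp add: disc_on_def rho_center coord_def)

text \<open>The function (rho - r^2) / (2 k) with k = card I has trace 1 along I and vanishes on the
  sphere. Adding B + \<delta> times it to h gives a function of trace B + \<delta>, which cannot
  touch V from below; its value at the centre produces the stated constant. Contact has to be
  localised in a thin tube around the disc, and the penalty - M sigma achieves this without changing
  the trace.\<close>

lemma viscosity_sphere_super:
  assumes V: "continuous_on UNIV V" and D: "open D" "disc_on r \<subseteq> D" and r: "r > 0"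
    and visc: "\<And>y \<phi> X. y \<in> D \<Longrightarrow> C2_near y \<phi> X \<Longrightarrow> (\<forall>\<^sub>F z in nhds y. V y - \<phi> y \<le> V z - \<phi> z) \<Longrightarrow>
       (\<Sum>i\<in>I. \<xi> i \<bullet> (X *v \<xi> i)) \<le> B"
  shows "sphere_super r V (r\<^sup>2 / (2 * real (card I)) * B)"
  unfolding sphere_super_def
proof (intro allI impI, elim conjE)
  fix h assume h: "harmonic h" and hV: "\<forall>y\<in>sphere_on r. h y \<le> V y"
  obtain Gh Hh where h2: "C2_on UNIV h Gh Hh" and h0: "\<And>y. (\<Sum>i\<in>I. \<xi> i \<bullet> (Hh y *v \<xi> i)) = 0"
    using h unfolding harmonic_def by blast
  let ?k = "real (card I)"
  have hc: "continuous_on S h" for S using C2_on_continuous[OF h2] continuous_on_subset by blast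
  have Vc: "continuous_on S V" for S using V continuous_on_subset by blast
  have sc: "continuous_on S sigma" for S using C2_on_continuous[OF C2_on_sigma] continuous_on_subset by blast
  have key: "h x \<le> V x + r\<^sup>2 / (2 * ?k) * (B + \<delta>) + \<delta>" if \<delta>: "\<delta> > 0" for \<delta>
  proof -
    obtain d0 where d0: "d0 > 0" "{y. infdist y (disc_on r) \<le> d0} \<subseteq> D"
      using compact_in_open_separated[of "disc_on r" D] compact_disc_on[of r] center_in_disc[of r] D r
      by (metis empty_iff less_imp_le)
    have "uniformly_continuous_on (cball x (r + 1)) (\<lambda>y. V y - h y)"
      by (intro compact_uniformly_continuous continuous_intros Vc hc compact_cball)
    then obtain d1 where d1: "d1 > 0" "\<And>y z. y \<in> cball x (r + 1) \<Longrightarrow> z \<in> cball x (r + 1) \<Longrightarrow> dist z y < d1 \<Longrightarrow>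
       dist (V z - h z) (V y - h y) < \<delta>"
      using \<delta> unfolding uniformly_continuous_on_def by metis
    define d where "d = min (min d0 (d1 / 2)) 1"
    have d: "d > 0" "d \<le> d0" "d < d1" "d \<le> 1" using d0(1) d1(1) by (auto simp: d_def)
    \<comment> \<open>The disc of radius r thickened by d in the directions normal to the plane. On
      its part rho = r^2, uniform continuity keeps h below V + \<delta>.\<close>
    define T where "T = {y. rho y \<le> r\<^sup>2 \<and> sigma y \<le> d\<^sup>2}"
    have fd: "dist y (flat y) \<le> d" if "sigma y \<le> d\<^sup>2" for y
      using flat_dist[of y] that d by (metis power2_le_imp_le less_imp_le)
    have fD: "flat y \<in> disc_on r" if "rho y \<le> r\<^sup>2" for y using that by (simp add: disc_on_def flat_rho flat_coord)
    have TD: "T \<subseteq> D"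
    proof
      fix y assume y: "y \<in> T"
      have "infdist y (disc_on r) \<le> dist y (flat y)" by (rule infdist_le) (use y fD in \<open>auto simp: T_def\<close>)
      then show "y \<in> D" using fd[of y] d(2) d0(2) y by (auto simp: T_def)
    qed
    have Tball: "T \<subseteq> cball x (r + 1)"
    proof
      fix y assume y: "y \<in> T"
      have "norm (flat y - x) \<le> r" using fD[of y] y disc_on_norm r by (auto simp: T_def)
      then show "y \<in> cball x (r + 1)" using fd[of y] y d(4) norm_triangle_ineq[of "y - flat y" "flat y - x"]
        by (auto simp: T_def dist_norm norm_minus_commute)
    qed
    have "closed T" unfolding T_def
      by (intro closed_Collect_conj closed_Collect_le continuous_rho sc continuous_on_const)
    then have cT: "compact T" using Tball by (meson bounded_cball bounded_subset compact_eq_bounded_closed)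
    have xT: "x \<in> T" using r d by (simp add: T_def rho_center)
    have lateral: "h y \<le> V y + \<delta>" if y: "y \<in> T" "rho y = r\<^sup>2" for y
    proof -
      have f: "flat y \<in> sphere_on r" using y(2) by (simp add: sphere_on_def flat_rho flat_coord)
      then have "norm (flat y - x) \<le> r" using sphere_subset_disc[of r] disc_on_norm[of "flat y" r] r by auto
      then have "flat y \<in> cball x (r + 1)" by (simp add: dist_norm norm_minus_commute)
      then have "dist (V y - h y) (V (flat y) - h (flat y)) < \<delta>"
        using d1(2)[of "flat y" y] subsetD[OF Tball y(1)] fd[of y] y d by (auto simp: T_def)
      then show ?thesis using hV f by (auto simp: dist_real_def dest!: bspec)
    qed
    let ?g = "\<lambda>y. h y + (B + \<delta>) / (2 * ?k) * (rho y - r\<^sup>2)"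
    have "continuous_on T (\<lambda>y. ?g y - V y)" by (intro continuous_intros hc Vc continuous_rho)
    then obtain ym where ym: "ym \<in> T" "\<And>y. y \<in> T \<Longrightarrow> ?g y - V y \<le> ?g ym - V ym"
      using continuous_attains_sup[OF cT] xT by blast
    \<comment> \<open>Large enough to push the penalised function below V on the wall sigma = d^2;
      the maximum with 0 makes M nonnegative.\<close>
    define M where "M = max 0 (?g ym - V ym) / d\<^sup>2"
    have "M * d\<^sup>2 = max 0 (?g ym - V ym)" using d(1) by (simp add: M_def)
    then have M: "M \<ge> 0" "\<And>y. y \<in> T \<Longrightarrow> ?g y - V y \<le> M * d\<^sup>2"
      using max.coboundedI2[OF ym(2)] by (auto simp only:) (simp add: M_def)
    define \<phi> where "\<phi> y = ?g y - M * sigma y" for y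
    have \<phi>2: "C2_on UNIV \<phi> (\<lambda>y. Gh y + ((B + \<delta>) / (2 * ?k)) *\<^sub>R (2 *\<^sub>R (proj_mat \<xi> I *v (y - x)) - 0) - M *\<^sub>R (2 *\<^sub>R (proj_mat \<xi> (-I) *v (y - x))))
       (\<lambda>y. Hh y + ((B + \<delta>) / (2 * ?k)) *\<^sub>R (2 *\<^sub>R proj_mat \<xi> I - 0) - M *\<^sub>R (2 *\<^sub>R proj_mat \<xi> (-I)))"
      unfolding \<phi>_def[abs_def]
      by (intro C2_on_diff C2_on_add C2_on_scale h2 C2_on_rho C2_on_const C2_on_sigma)
    have "continuous_on T (\<lambda>y. V y - \<phi> y)"
      by (intro continuous_intros Vc continuous_on_subset[OF C2_on_continuous[OF \<phi>2]]) auto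
    then obtain y0 where y0: "y0 \<in> T" "\<And>y. y \<in> T \<Longrightarrow> V y0 - \<phi> y0 \<le> V y - \<phi> y"
      using continuous_attains_inf[OF cT] xT by blast
    have "V y0 - \<phi> y0 \<ge> - \<delta>"
    proof (rule ccontr)
      assume neg: "\<not> V y0 - \<phi> y0 \<ge> - \<delta>"
      have 1: "rho y0 < r\<^sup>2"
      proof (rule ccontr)
        assume "\<not> rho y0 < r\<^sup>2"
        then have e: "rho y0 = r\<^sup>2" using y0(1) by (simp add: T_def)
        have "\<phi> y0 \<le> h y0" using e M(1) sigma_nonneg[of y0] by (simp add: \<phi>_def)
        then show False using lateral[OF y0(1) e] neg by simp
      qed
      have 2: "sigma y0 < d\<^sup>2"
      proof (rule ccontr)
        assume "\<not> sigma y0 < d\<^sup>2"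
        then have "sigma y0 = d\<^sup>2" using y0(1) by (simp add: T_def)
        then have "\<phi> y0 \<le> V y0" using M(2)[OF y0(1)] by (simp add: \<phi>_def)
        then show False using neg \<delta> by simp
      qed
      have "open {y. rho y < r\<^sup>2 \<and> sigma y < d\<^sup>2}"
        by (intro open_Collect_conj open_Collect_less continuous_rho sc continuous_on_const)
      then have "\<forall>\<^sub>F z in nhds y0. z \<in> {y. rho y < r\<^sup>2 \<and> sigma y < d\<^sup>2}"
        using 1 2 by (intro eventually_nhds_in_open) auto
      then have ev: "\<forall>\<^sub>F z in nhds y0. V y0 - \<phi> y0 \<le> V z - \<phi> z"
        by eventually_elim (rule y0(2), simp add: T_def)
      have v1: "(\<Sum>i\<in>I. \<xi> i \<bullet> ((Hh y0 + ((B + \<delta>) / (2 * ?k)) *\<^sub>R (2 *\<^sub>R proj_mat \<xi> I - 0) - M *\<^sub>R (2 *\<^sub>R proj_mat \<xi> (-I))) *v \<xi> i)) \<le> B"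
        by (rule visc[OF _ C2_on_near[OF \<phi>2] ev]) (use TD y0(1) in auto)
      have v2: "(\<Sum>i\<in>I. \<xi> i \<bullet> ((Hh y0 + b *\<^sub>R (2 *\<^sub>R proj_mat \<xi> I - 0) - M *\<^sub>R (2 *\<^sub>R proj_mat \<xi> (-I))) *v \<xi> i))
        = 2 * b * ?k" for b
      proof -
        have "\<xi> i \<bullet> ((Hh y0 + b *\<^sub>R (2 *\<^sub>R proj_mat \<xi> I - 0) - M *\<^sub>R (2 *\<^sub>R proj_mat \<xi> (-I))) *v \<xi> i)
          = \<xi> i \<bullet> (Hh y0 *v \<xi> i) + 2 * b * (\<xi> i \<bullet> (proj_mat \<xi> I *v \<xi> i)) - 2 * M * (\<xi> i \<bullet> (proj_mat \<xi> (-I) *v \<xi> i))" for i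
          by (simp add: matrix_vector_mult_add_rdistrib matrix_vector_mult_diff_rdistrib inner_add_right inner_diff_right
              flip: scaleR_matrix_vector_assoc)
        then show ?thesis
          by (simp add: sum.distrib sum_subtractf sum_distrib_left[symmetric] trace_proj h0)
      qed
      show False using v1[unfolded v2] card_I I_ne \<delta> by simp
    qed
    then have "\<phi> x - \<delta> \<le> V x" using y0(2)[OF xT] by simp
    moreover have "\<phi> x = h x - r\<^sup>2 / (2 * ?k) * (B + \<delta>)" by (simp add: \<phi>_def rho_center)
    ultimately show ?thesis by linarith
  qed
  show "h x \<le> V x + r\<^sup>2 / (2 * ?k) * B"
  proof (rule field_le_epsilon)
    fix e :: real assume e: "e > 0"
    \<comment> \<open>Collects the coefficients of \<delta>, so that \<delta> = e / a costs exactly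
      e.\<close>
    let ?a = "r\<^sup>2 / (2 * ?k) + 1"
    have a: "?a > 0" using card_I by (simp add: add_nonneg_pos)
    have "h x \<le> V x + r\<^sup>2 / (2 * ?k) * (B + e / ?a) + e / ?a" by (rule key) (use e a in simp)
    also have "\<dots> = V x + r\<^sup>2 / (2 * ?k) * B + ?a * (e / ?a)" by (simp only: algebra_simps)
    also have "?a * (e / ?a) = e" using a by simp
    finally show "h x \<le> V x + r\<^sup>2 / (2 * ?k) * B + e" .
  qed
qed

text \<open>The maximum principle for harmonic functions, obtained by regarding the zero function as
  a supersolution with B = 0.\<close>

lemma sphere_super_zero: "r > 0 \<Longrightarrow> sphere_super r (\<lambda>y. 0) 0"
proof -
  assume r: "r > 0"
  have "sphere_super r (\<lambda>y. 0) (r\<^sup>2 / (2 * real (card I)) * 0)"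
  proof (rule viscosity_sphere_super[of _ UNIV])
    fix y :: "real^'n" and \<phi> X assume C: "C2_near y \<phi> X" and ev: "\<forall>\<^sub>F z in nhds y. 0 - \<phi> y \<le> 0 - \<phi> z"
    obtain U G H where U: "y \<in> U" "C2_on U \<phi> G H" "X = H y" using C unfolding C2_near_iff by blast
    have "0 \<le> v \<bullet> ((-1 *\<^sub>R H y) *v v)" for v
      using C2_on_local_min[OF C2_on_scale[OF U(2), of "-1"] U(1)] ev by simp
    then have "\<xi> i \<bullet> (X *v \<xi> i) \<le> 0" for i
      unfolding U(3) by (metis inner_scaleR_right mult_minus1 neg_0_le_iff_le scaleR_matrix_vector_assoc)
    then show "(\<Sum>i\<in>I. \<xi> i \<bullet> (X *v \<xi> i)) \<le> 0" by (simp add: sum_nonpos)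
  qed (use r in auto)
  then show ?thesis by simp
qed

lemma sphere_super_scale:
  assumes "sphere_super r W b" "a \<ge> 0" "r > 0"
  shows "sphere_super r (\<lambda>y. a * W y) (a * b)"
proof (cases "a = 0")
  case True
  then show ?thesis using sphere_super_zero[OF assms(3)] by simp
next
  case False
  then have a: "a > 0" using assms(2) by simp
  show ?thesis unfolding sphere_super_def
  proof (intro allI impI, elim conjE)
    fix h assume h: "harmonic h" "\<forall>y\<in>sphere_on r. h y \<le> a * W y"
    have "(1 / a) * h x \<le> W x + b"
      using assms(1) harmonic_scale[OF h(1), of "1 / a"] h(2) a unfolding sphere_super_def
      by (auto simp: field_simps)
    then show "h x \<le> a * W x + a * b" using a by (simp add: field_simps)
  qed
qed

text \<open>The step where density is used: a function h below the sum has to be divided into a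
  harmonic function near W and a harmonic remainder that lies below W' up to an error.\<close>

lemma sphere_super_add:
  assumes "sphere_super r W b" "sphere_super r W' b'" "r > 0" and cont: "continuous_on (sphere_on r) W"
  shows "sphere_super r (\<lambda>y. W y + W' y) (b + b')"
  unfolding sphere_super_def
proof (intro allI impI, elim conjE)
  fix h assume h: "harmonic h" "\<forall>y\<in>sphere_on r. h y \<le> W y + W' y"
  show "h x \<le> W x + W' x + (b + b')"
  proof (rule field_le_epsilon)
    fix e :: real assume "e > 0"
    then obtain g G H where g: "C2_on UNIV g G H" "\<forall>y. (\<Sum>i\<in>I. \<xi> i \<bullet> (H y *v \<xi> i)) = 0" "\<forall>y\<in>sphere_on r. \<bar>W y - g y\<bar> < e / 2"
      using harmonic_approx[OF cont, of "e / 2"] assms(3) by auto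
    then have hg: "harmonic g" unfolding harmonic_def by blast
    have gh: "harmonic (\<lambda>y. g y - e / 2)" by (intro harmonic_diff hg harmonic_const)
    have gW: "\<bar>W y - g y\<bar> < e / 2" if "y \<in> sphere_on r" for y using g(3) that by blast
    have "g y - e / 2 \<le> W y" if "y \<in> sphere_on r" for y using gW[OF that] by linarith
    then have 1: "g x - e / 2 \<le> W x + b" using gh assms(1) unfolding sphere_super_def by blast
    have "harmonic (\<lambda>y. h y - g y - e / 2)" by (intro harmonic_diff hg h harmonic_const)
    moreover have "h y - g y - e / 2 \<le> W' y" if "y \<in> sphere_on r" for y
      using gW[OF that] bspec[OF h(2) that] by linarith
    ultimately have 2: "h x - g x - e / 2 \<le> W' x + b'" using assms(2) unfolding sphere_super_def by blast
    from 1 2 show "h x \<le> W x + W' x + (b + b') + e" by simp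
  qed
qed

lemma sphere_super_sum:
  assumes "finite J" "\<And>j. j \<in> J \<Longrightarrow> sphere_super r (W j) (b j)" "r > 0" "\<And>j. j \<in> J \<Longrightarrow> continuous_on (sphere_on r) (W j)"
  shows "sphere_super r (\<lambda>y. \<Sum>j\<in>J. W j y) (\<Sum>j\<in>J. b j)"
  using assms
proof (induction J rule: finite_induct)
  case empty
  then show ?case using sphere_super_zero by simp
next
  case (insert j J)
  then show ?case using sphere_super_add[of r "W j" "b j" "\<lambda>y. \<Sum>j\<in>J. W j y" "\<Sum>j\<in>J. b j"] by simp
qed

lemma sphere_super_limit:
  assumes "\<And>e. e > 0 \<Longrightarrow> \<exists>W' b'. sphere_super r W' b' \<and> (\<forall>y\<in>insert x (sphere_on r). \<bar>W y - W' y\<bar> \<le> e) \<and> b' \<le> b + e"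
  shows "sphere_super r W b"
  unfolding sphere_super_def
proof (intro allI impI, elim conjE)
  fix h assume h: "harmonic h" "\<forall>y\<in>sphere_on r. h y \<le> W y"
  show "h x \<le> W x + b"
  proof (rule field_le_epsilon)
    fix e :: real assume "e > 0"
    then obtain W' b' where W': "sphere_super r W' b'" "\<forall>y\<in>insert x (sphere_on r). \<bar>W y - W' y\<bar> \<le> e / 3" "b' \<le> b + e / 3"
      using assms[of "e / 3"] by auto
    have "h y - e / 3 \<le> W' y" if y: "y \<in> sphere_on r" for y
    proof -
      have "h y \<le> W y" using h(2) y by blast
      moreover have "\<bar>W y - W' y\<bar> \<le> e / 3" using W'(2) y by blast
      ultimately show ?thesis by linarith
    qed
    moreover have "harmonic (\<lambda>y. h y - e / 3)" by (intro harmonic_diff h harmonic_const)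
    ultimately have "h x - e / 3 \<le> W' x + b'" using W'(1) unfolding sphere_super_def by blast
    moreover have "\<bar>W x - W' x\<bar> \<le> e / 3" using W'(2) by blast
    ultimately show "h x \<le> W x + b + e" using W'(3) by linarith
  qed
qed

lemma sphere_super_translate:
  assumes "frame.sphere_super \<xi> I (x - a) r V b"
  shows "sphere_super r (\<lambda>y. V (y - a)) b"
proof -
  interpret T: frame \<xi> I "x - a" by unfold_locales (rule onb, rule I_ne)
  have s: "y + a \<in> sphere_on r" if "y \<in> T.sphere_on r" for y
  proof -
    have "T.coord i y = coord i (y + a)" for i by (simp add: T.coord_def coord_def algebra_simps)
    then show ?thesis using that by (simp add: sphere_on_def T.sphere_on_def rho_def T.rho_def)
  qed
  show ?thesis unfolding sphere_super_def
  proof (intro allI impI, elim conjE)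
    fix h assume h: "harmonic h" "\<forall>y\<in>sphere_on r. h y \<le> V (y - a)"
    have "T.harmonic (\<lambda>y. h (y + a))" using harmonic_shift[OF h(1), of a] by (simp add: harmonic_def T.harmonic_def)
    moreover have "h (y + a) \<le> V y" if "y \<in> T.sphere_on r" for y using h(2) s[OF that] by fastforce
    ultimately show "h x \<le> V (x - a) + b" using assms unfolding T.sphere_super_def by fastforce
  qed
qed

text \<open>Riemann sums are nonnegative combinations of translates of V, to which scaling,
  translation and additivity apply, and they converge uniformly on the sphere and at the centre.
  Where \<kappa> vanishes the translate carries no weight.\<close>

lemma sphere_super_convolution:
  assumes V: "continuous_on UNIV V" and \<kappa>: "continuous_on UNIV \<kappa>" "\<And>a. \<kappa> a \<ge> 0" "integral (cbox u v) \<kappa> = 1"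
    and r: "r > 0"
    and super: "\<And>a. a \<in> cbox u v \<Longrightarrow> \<kappa> a \<noteq> 0 \<Longrightarrow> frame.sphere_super \<xi> I (x - a) r V b"
  shows "sphere_super r (\<lambda>y. integral (cbox u v) (\<lambda>a. \<kappa> a * V (y - a))) b"
proof (rule sphere_super_limit)
  fix e :: real assume e: "e > 0"
  let ?K = "insert x (sphere_on r)"
  have K: "compact ?K" using compact_sphere_on[of r] r by (simp add: compact_insert)
  have cV: "continuous_on S (\<lambda>z. V (f z))" if "continuous_on S f" for S and f :: "'z::topological_space \<Rightarrow> real^'n"
    by (rule continuous_on_compose2[OF V that]) auto
  have coord\<kappa>: "continuous_on S (\<lambda>z. \<kappa> (f z))" if "continuous_on S f" for S and f :: "'z::topological_space \<Rightarrow> real^'n"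
    by (rule continuous_on_compose2[OF \<kappa>(1) that]) auto
  have "continuous_on (cbox u v \<times> ?K) (\<lambda>z. \<kappa> (fst z) * V (snd z - fst z))"
    by (intro continuous_intros coord\<kappa> cV)
  from uniform_riemann[OF K this e] obtain d1 where d1: "d1 > 0" "\<And>p y. p tagged_division_of cbox u v \<Longrightarrow> (\<lambda>x. ball x d1) fine p \<Longrightarrow> y \<in> ?K \<Longrightarrow>
      \<bar>(\<Sum>(a,T)\<in>p. measure lborel T * (\<kappa> a * V (y - a))) - integral (cbox u v) (\<lambda>a. \<kappa> a * V (y - a))\<bar> \<le> e"
    by (simp only: fst_conv snd_conv) blast
  \<comment> \<open>A second Riemann sum, for \<kappa> alone, shows that the weights add up to
    nearly 1, hence that the constant of the sum is at most b + e.\<close>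
  have c2: "continuous_on (cbox u v \<times> ?K) (\<lambda>z. \<kappa> (fst z))" by (intro continuous_intros coord\<kappa>)
  have "e / (\<bar>b\<bar> + 1) > 0" using e by simp
  from uniform_riemann[OF K c2 this] obtain d2 where d2': "d2 > 0" "\<And>p y. p tagged_division_of cbox u v \<Longrightarrow> (\<lambda>x. ball x d2) fine p \<Longrightarrow> y \<in> ?K \<Longrightarrow>
      \<bar>(\<Sum>(a,T)\<in>p. measure lborel T * \<kappa> a) - integral (cbox u v) \<kappa>\<bar> \<le> e / (\<bar>b\<bar> + 1)"
    by (simp only: fst_conv snd_conv) blast
  have d2: "d2 > 0" "\<And>p. p tagged_division_of cbox u v \<Longrightarrow> (\<lambda>x. ball x d2) fine p \<Longrightarrow>
      \<bar>(\<Sum>(a,T)\<in>p. measure lborel T * \<kappa> a) - 1\<bar> \<le> e / (\<bar>b\<bar> + 1)"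
    using d2'(1) d2'(2)[OF _ _ insertI1] \<kappa>(3) by simp_all
  define d where "d = min d1 d2"
  have "gauge (\<lambda>x::real^'n. ball x d)" using d1(1) d2(1) by (simp add: d_def gauge_def)
  then obtain p where p: "p tagged_division_of cbox u v" "(\<lambda>x. ball x d) fine p"
    using fine_division_exists by blast
  have p12: "(\<lambda>x. ball x d1) fine p" "(\<lambda>x. ball x d2) fine p"
    using p(2) unfolding fine_def d_def by fastforce+
  let ?W = "\<lambda>y. \<Sum>z\<in>p. measure lborel (snd z) * \<kappa> (fst z) * V (y - fst z)"
  let ?b = "\<Sum>z\<in>p. measure lborel (snd z) * \<kappa> (fst z) * b"
  have S: "sphere_super r ?W ?b"
  proof (rule sphere_super_sum)
    show "finite p" using p(1) by blast
    fix z assume z: "z \<in> p"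
    show "continuous_on (sphere_on r) (\<lambda>y. measure lborel (snd z) * \<kappa> (fst z) * V (y - fst z))"
      by (intro continuous_intros cV)
    have zc: "fst z \<in> cbox u v" using tagged_division_ofD(2,3)[OF p(1), of "fst z" "snd z"] z by auto
    show "sphere_super r (\<lambda>y. measure lborel (snd z) * \<kappa> (fst z) * V (y - fst z)) (measure lborel (snd z) * \<kappa> (fst z) * b)"
    proof (cases "\<kappa> (fst z) = 0")
      case True
      then show ?thesis using sphere_super_zero[OF r] by simp
    next
      case False
      then show ?thesis
        using \<kappa>(2) by (intro sphere_super_scale sphere_super_translate super zc r) auto
    qed
  qed (rule r)
  have "\<bar>integral (cbox u v) (\<lambda>a. \<kappa> a * V (y - a)) - ?W y\<bar> \<le> e" if "y \<in> ?K" for y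
    using d1(2)[OF p(1) p12(1) that] by (simp add: case_prod_unfold mult.assoc abs_minus_commute)
  moreover have "?b \<le> b + e"
  proof -
    let ?s = "\<Sum>(a,T)\<in>p. measure lborel T * \<kappa> a"
    have "?b = ?s * b" by (simp add: case_prod_unfold sum_distrib_right)
    also have "\<dots> = b + (?s - 1) * b" by (simp add: algebra_simps)
    also have "(?s - 1) * b \<le> \<bar>?s - 1\<bar> * \<bar>b\<bar>" using abs_ge_self[of "(?s - 1) * b"] by (simp only: abs_mult)
    also have "\<dots> \<le> e / (\<bar>b\<bar> + 1) * (\<bar>b\<bar> + 1)"
      using d2(2)[OF p(1) p12(2)] e by (intro mult_mono) auto
    finally show ?thesis by simp
  qed
  ultimately show "\<exists>W' b'. sphere_super r W' b' \<and> (\<forall>y\<in>?K. \<bar>integral (cbox u v) (\<lambda>a. \<kappa> a * V (y - a)) - W' y\<bar> \<le> e) \<and> b' \<le> b + e"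
    using S by blast
qed

text \<open>The way back from small spheres to the Hessian. With S the trace of the Hessian along I,
  the Taylor polynomial minus S / (2 k) times (rho - r^2) is harmonic. Lowered by the Taylor error
  it lies below W on the sphere, and its central value gives S / (2 k) - e' \<le> B / (2 k).\<close>

lemma sphere_super_C2:
  assumes W: "C2_on U W G H" "x \<in> U" and "r0 > 0"
    and super: "\<And>r. 0 < r \<Longrightarrow> r < r0 \<Longrightarrow> sphere_super r W (r\<^sup>2 / (2 * real (card I)) * B)"
  shows "(\<Sum>i\<in>I. \<xi> i \<bullet> (H x *v \<xi> i)) \<le> B"
proof (rule field_le_epsilon)
  fix e :: real assume e: "e > 0"
  let ?k = "real (card I)"
  define e' where "e' = e / (2 * ?k)"
  have e': "e' > 0" using e card_I by (simp add: e'_def)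
  obtain d where d: "d > 0" "\<And>y. dist y x < d \<Longrightarrow>
    \<bar>W y - (W x + G x \<bullet> (y - x) + (y - x) \<bullet> (H x *v (y - x)) / 2)\<bar> \<le> e' * (norm (y - x))\<^sup>2"
    using C2_on_taylor[OF W e'] by blast
  define r where "r = min d r0 / 2"
  have r: "0 < r" "r < r0" "r < d" using d(1) assms(3) by (auto simp: r_def)
  define S where "S = (\<Sum>i\<in>I. \<xi> i \<bullet> (H x *v \<xi> i))"
  define h where "h y = (W x - e' * r\<^sup>2 + G x \<bullet> (y - x) + (1/2) * ((y - x) \<bullet> (H x *v (y - x)))) - (S / (2 * ?k)) * (rho y - r\<^sup>2)" for y
  have q1: "C2_on UNIV h (\<lambda>y. (0 + G x + (1/2) *\<^sub>R (2 *\<^sub>R (H x *v (y - x)))) - (S / (2 * ?k)) *\<^sub>R (2 *\<^sub>R (proj_mat \<xi> I *v (y - x)) - 0))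
     (\<lambda>y. (0 + 0 + (1/2) *\<^sub>R (2 *\<^sub>R H x)) - (S / (2 * ?k)) *\<^sub>R (2 *\<^sub>R proj_mat \<xi> I - 0))"
    unfolding h_def[abs_def]
    by (intro C2_on_diff C2_on_add C2_on_scale C2_on_const C2_on_linear C2_on_quadratic C2_on_rho C2_on_symmetric[OF W])
  have q2: "(\<Sum>i\<in>I. \<xi> i \<bullet> (((0 + 0 + (1/2) *\<^sub>R (2 *\<^sub>R H x)) - t *\<^sub>R (2 *\<^sub>R proj_mat \<xi> I - 0)) *v \<xi> i))
      = S - t * (2 * ?k)" for t
    unfolding S_def trace_proj(1)[symmetric]
    by (simp add: matrix_vector_mult_diff_rdistrib inner_diff_right sum_subtractf sum_distrib_left mult.assoc flip: scaleR_matrix_vector_assoc)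
  have "harmonic h" unfolding harmonic_def
    by (intro exI conjI, rule q1, rule allI, rule trans[OF q2]) (use card_I I_ne in simp)
  moreover have "h y \<le> W y" if y: "y \<in> sphere_on r" for y
  proof -
    have ry: "rho y = r\<^sup>2" using y by (simp add: sphere_on_def)
    have "(norm (y - x))\<^sup>2 = r\<^sup>2" using norm_split[of y] y by (simp add: sphere_on_def)
    then have n: "norm (y - x) = r" using r by (simp add: power2_eq_iff_nonneg)
    then show ?thesis using d(2)[of y] r ry by (simp add: h_def dist_norm abs_le_iff)
  qed
  ultimately have "h x \<le> W x + r\<^sup>2 / (2 * ?k) * B" using super[OF r(1,2)] unfolding sphere_super_def by blast
  then have le: "r\<^sup>2 * (S / (2 * ?k) - e') \<le> r\<^sup>2 * (B / (2 * ?k))" by (simp add: h_def rho_center algebra_simps)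
  then have "S / (2 * ?k) - e' \<le> B / (2 * ?k)" by (rule mult_left_le_imp_le) (use r(1) in simp)
  then have "S / (2 * ?k) \<le> (B + e) / (2 * ?k)" by (simp only: e'_def add_divide_distrib)
  then have "S \<le> B + e" using card_I by (simp only: divide_le_cancel)
  then show "(\<Sum>i\<in>I. \<xi> i \<bullet> (H x *v \<xi> i)) \<le> B + e" by (simp only: S_def)
qed

end

section \<open>Mollification\<close>

lemma max_square_deriv: "((\<lambda>s::real. (max 0 s)\<^sup>2) has_real_derivative 2 * max 0 s) (at s)"
proof -
  consider "s > 0" | "s < 0" | "s = 0" by linarith
  then show ?thesis
  proof cases
    case 1
    have "((\<lambda>s::real. s\<^sup>2) has_real_derivative 2 * max 0 s) (at s)"
      using 1 by (auto intro!: derivative_eq_intros)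
    then show ?thesis
      by (rule has_field_derivative_transform_within_open[of _ _ _ "{0<..}"]) (use 1 in auto)
  next
    case 2
    have "((\<lambda>s::real. 0) has_real_derivative 2 * max 0 s) (at s)"
      using 2 by (auto intro!: derivative_eq_intros)
    then show ?thesis
      by (rule has_field_derivative_transform_within_open[of _ _ _ "{..<0}"]) (use 2 in auto)
  next
    case 3
    have "((\<lambda>h. (max 0 h)\<^sup>2 / h) \<longlongrightarrow> 0) (at (0::real))"
    proof (rule Lim_null_comparison)
      show "\<forall>\<^sub>F h in at (0::real). norm ((max 0 h)\<^sup>2 / h) \<le> \<bar>h\<bar>"
        by (rule always_eventually) (auto simp: max_def power2_eq_square)
      show "((\<lambda>h::real. \<bar>h\<bar>) \<longlongrightarrow> 0) (at 0)" by (auto intro!: tendsto_eq_intros)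
    qed
    then show ?thesis using 3 by (simp add: has_field_derivative_iff)
  qed
qed

lemma max_cube_deriv: "((\<lambda>s::real. (max 0 s)^3) has_real_derivative 3 * (max 0 s)\<^sup>2) (at s)"
proof -
  have eq: "(max 0 s)^3 = s * (max 0 s)\<^sup>2" for s :: real
    by (auto simp: max_def power3_eq_cube power2_eq_square)
  have "((\<lambda>s::real. s * (max 0 s)\<^sup>2) has_real_derivative 1 * (max 0 s)\<^sup>2 + 2 * max 0 s * s) (at s)"
    by (rule DERIV_mult[OF DERIV_ident max_square_deriv])
  moreover have "1 * (max 0 s)\<^sup>2 + 2 * max 0 s * s = 3 * (max 0 s)\<^sup>2" by (auto simp: max_def power2_eq_square)
  ultimately show ?thesis unfolding eq by (simp only:)
qed

text \<open>The cube makes the function twice continuously differentiable across the sphere of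
  radius \<rho>, which is the regularity that mollification has to provide.\<close>

definition bump :: "real \<Rightarrow> real^'n \<Rightarrow> real" where
  "bump \<rho> a = (max 0 (\<rho>\<^sup>2 - a \<bullet> a))^3"

lemma bump_C2:
  "C2_on UNIV (bump \<rho> :: real^'n \<Rightarrow> real) (\<lambda>a. (- 6 * (max 0 (\<rho>\<^sup>2 - a \<bullet> a))\<^sup>2) *\<^sub>R a)
     (\<lambda>a. (24 * max 0 (\<rho>\<^sup>2 - a \<bullet> a)) *\<^sub>R (\<chi> i j. a $ i * a $ j) - (6 * (max 0 (\<rho>\<^sup>2 - a \<bullet> a))\<^sup>2) *\<^sub>R mat 1)"
proof -
  have s: "((\<lambda>a :: real^'n. \<rho>\<^sup>2 - a \<bullet> a) has_derivative (\<lambda>h. - 2 * (a \<bullet> h))) (at a)" for a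
    by (auto intro!: derivative_eq_intros simp: inner_commute)
  have 1: "((\<lambda>a :: real^'n. (max 0 (\<rho>\<^sup>2 - a \<bullet> a))^3) has_derivative (\<lambda>h. 3 * (max 0 (\<rho>\<^sup>2 - a \<bullet> a))\<^sup>2 * (- 2 * (a \<bullet> h)))) (at a)" for a
    by (rule has_derivative_compose[OF s has_field_derivative_imp_has_derivative[OF max_cube_deriv]])
  have 2: "((\<lambda>a :: real^'n. (max 0 (\<rho>\<^sup>2 - a \<bullet> a))\<^sup>2) has_derivative (\<lambda>h. 2 * max 0 (\<rho>\<^sup>2 - a \<bullet> a) * (- 2 * (a \<bullet> h)))) (at a)" for a
    by (rule has_derivative_compose[OF s has_field_derivative_imp_has_derivative[OF max_square_deriv]])
  have o: "(\<chi> i j. a $ i * a $ j) *v h = (a \<bullet> h) *\<^sub>R a" for a h :: "real^'n"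
    by (simp add: vec_eq_iff matrix_vector_mult_def inner_vec_def sum_distrib_left mult_ac)
  have "((\<lambda>a. (- 6 * (max 0 (\<rho>\<^sup>2 - a \<bullet> a))\<^sup>2) *\<^sub>R a) has_derivative
      (\<lambda>h. (- 6 * (max 0 (\<rho>\<^sup>2 - a \<bullet> a))\<^sup>2) *\<^sub>R h + (- 6 * (2 * max 0 (\<rho>\<^sup>2 - a \<bullet> a) * (- 2 * (a \<bullet> h)))) *\<^sub>R a)) (at a)" for a :: "real^'n"
    by (rule has_derivative_scaleR[OF has_derivative_mult_right[OF 2] has_derivative_ident])
  then have G: "((\<lambda>a. (- 6 * (max 0 (\<rho>\<^sup>2 - a \<bullet> a))\<^sup>2) *\<^sub>R a) has_derivative
      (\<lambda>h. ((24 * max 0 (\<rho>\<^sup>2 - a \<bullet> a)) *\<^sub>R (\<chi> i j. a $ i * a $ j) - (6 * (max 0 (\<rho>\<^sup>2 - a \<bullet> a))\<^sup>2) *\<^sub>R mat 1) *v h)) (at a)" for a :: "real^'n"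
    by (simp add: matrix_vector_mult_diff_rdistrib o algebra_simps flip: scaleR_matrix_vector_assoc)
  show ?thesis
    unfolding C2_on_def bump_def[abs_def]
  proof (intro conjI ballI)
    show "((\<lambda>a. (max 0 (\<rho>\<^sup>2 - a \<bullet> a))^3) has_derivative (\<lambda>h. ((- 6 * (max 0 (\<rho>\<^sup>2 - a \<bullet> a))\<^sup>2) *\<^sub>R a) \<bullet> h)) (at a)" for a :: "real^'n"
      using 1[of a] by (simp add: mult_ac)
    show "continuous_on UNIV (\<lambda>a :: real^'n. (24 * max 0 (\<rho>\<^sup>2 - a \<bullet> a)) *\<^sub>R (\<chi> i j. a $ i * a $ j) - (6 * (max 0 (\<rho>\<^sup>2 - a \<bullet> a))\<^sup>2) *\<^sub>R mat 1)"
      by (intro continuous_intros)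
  qed (use G in auto)
qed

text \<open>V is merely continuous, so the variable is placed in the kernel and the derivative falls
  on q; over a fixed box this is differentiation under the integral.\<close>

lemma conv_deriv:
  fixes q V :: "real^'n \<Rightarrow> real"
  assumes q: "\<And>a. (q has_derivative (\<lambda>h. g a \<bullet> h)) (at a)" and g: "continuous_on UNIV g" and V: "continuous_on UNIV V"
  shows "((\<lambda>y. integral (cbox l u) (\<lambda>t. V t * q (y - t))) has_derivative
          (\<lambda>h. integral (cbox l u) (\<lambda>t. V t *\<^sub>R g (y - t)) \<bullet> h)) (at y)"
proof -
  have qc: "continuous_on UNIV q" using q by (meson continuous_at_imp_continuous_on has_derivative_continuous)
  have cq: "continuous_on S (\<lambda>z. q (f z))" if "continuous_on S f" for S and f :: "'z::topological_space \<Rightarrow> real^'n"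
    by (rule continuous_on_compose2[OF qc that]) auto
  have cg: "continuous_on S (\<lambda>z. g (f z))" if "continuous_on S f" for S and f :: "'z::topological_space \<Rightarrow> real^'n"
    by (rule continuous_on_compose2[OF g that]) auto
  have cV: "continuous_on S (\<lambda>z. V (f z))" if "continuous_on S f" for S and f :: "'z::topological_space \<Rightarrow> real^'n"
    by (rule continuous_on_compose2[OF V that]) auto
  have "((\<lambda>y. integral (cbox l u) (\<lambda>t. V t * q (y - t))) has_derivative
      integral (cbox l u) (\<lambda>t. blinfun_inner_right (V t *\<^sub>R g (y - t)))) (at y within UNIV)"
  proof (rule leibniz_rule)
    fix y t :: "real^'n"
    have "((\<lambda>y. y - t) has_derivative (\<lambda>h. h)) (at y)" by (auto intro!: derivative_eq_intros)
    from has_derivative_mult_right[OF has_derivative_compose[OF this q], of "V t"]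
    show "((\<lambda>y. V t * q (y - t)) has_derivative blinfun_apply (blinfun_inner_right (V t *\<^sub>R g (y - t)))) (at y)"
      by (rule has_derivative_eq_rhs) (simp add: fun_eq_iff)
  next
    fix y show "(\<lambda>t. V t * q (y - t)) integrable_on cbox l u"
      by (intro integrable_continuous continuous_intros cV cq)
  next
    have "continuous_on (UNIV \<times> cbox l u) (\<lambda>z. blinfun_inner_right (V (snd z) *\<^sub>R g (fst z - snd z)))"
      by (intro bounded_linear.continuous_on[OF bounded_linear_blinfun_inner_right] continuous_intros cV cg)
    then show "continuous_on (UNIV \<times> cbox l u) (\<lambda>(y, t). blinfun_inner_right (V t *\<^sub>R g (y - t)))"
      by (simp add: case_prod_unfold)
  qed auto
  moreover have "integral (cbox l u) (\<lambda>t. blinfun_inner_right (V t *\<^sub>R g (y - t))) = blinfun_inner_right (integral (cbox l u) (\<lambda>t. V t *\<^sub>R g (y - t)))"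
    using integral_linear[OF _ bounded_linear_blinfun_inner_right, of "\<lambda>t. V t *\<^sub>R g (y - t)" "cbox l u"]
    by (simp add: o_def integrable_continuous continuous_intros cV cg)
  ultimately show ?thesis by simp
qed

text \<open>Each component of the gradient is again a convolution, to which
  \<open>conv_deriv\<close> applies; symmetry of the Hessian of the kernel moves the test vector to
  the other side.\<close>

lemma conv_C2:
  fixes q V :: "real^'n \<Rightarrow> real"
  assumes q: "C2_on UNIV q g H" and V: "continuous_on UNIV V"
  shows "C2_on UNIV (\<lambda>y. integral (cbox l u) (\<lambda>t. V t * q (y - t))) (\<lambda>y. integral (cbox l u) (\<lambda>t. V t *\<^sub>R g (y - t)))
     (\<lambda>y. integral (cbox l u) (\<lambda>t. V t *\<^sub>R H (y - t)))"
proof -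
  have gc: "continuous_on UNIV g"
    using C2_onD(3)[OF q] by (meson continuous_at_imp_continuous_on has_derivative_continuous)
  have Hc: "continuous_on UNIV H" by (rule C2_onD(4)[OF q])
  have cV: "continuous_on S (\<lambda>z. V (f z))" if "continuous_on S f" for S and f :: "'z::topological_space \<Rightarrow> real^'n"
    by (rule continuous_on_compose2[OF V that]) auto
  have cg: "continuous_on S (\<lambda>z. g (f z))" if "continuous_on S f" for S and f :: "'z::topological_space \<Rightarrow> real^'n"
    by (rule continuous_on_compose2[OF gc that]) auto
  have cH: "continuous_on S (\<lambda>z. H (f z))" if "continuous_on S f" for S and f :: "'z::topological_space \<Rightarrow> real^'n"
    by (rule continuous_on_compose2[OF Hc that]) auto
  have iH: "(\<lambda>t. V t *\<^sub>R H (y - t)) integrable_on cbox l u" for y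
    by (intro integrable_continuous continuous_intros cV cH)
  have ig: "(\<lambda>t. V t *\<^sub>R g (y - t)) integrable_on cbox l u" for y
    by (intro integrable_continuous continuous_intros cV cg)
  have iHv: "(\<lambda>t. V t *\<^sub>R (H (y - t) *v i)) integrable_on cbox l u" for y i
    by (intro integrable_continuous continuous_intros cV cH)
  have sym: "(H a *v i) \<bullet> h = (H a *v h) \<bullet> i" for a i h
    using symmetric_inner[OF C2_on_symmetric[OF q], of a h i] by (simp add: inner_commute)
  have G: "((\<lambda>y. integral (cbox l u) (\<lambda>t. V t *\<^sub>R g (y - t))) has_derivative
      (\<lambda>h. integral (cbox l u) (\<lambda>t. V t *\<^sub>R H (y - t)) *v h)) (at y)" for y
  proof (subst has_derivative_componentwise_within, rule ballI)
    fix i :: "real^'n"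
    have gi: "((\<lambda>a. g a \<bullet> i) has_derivative (\<lambda>h. (H a *v i) \<bullet> h)) (at a)" for a
      using has_derivative_inner_left[OF C2_onD(3)[OF q], of a i] by (simp add: sym)
    have "continuous_on UNIV (\<lambda>a. H a *v i)" by (intro continuous_intros Hc)
    from conv_deriv[OF gi this V, of l u y]
    have "((\<lambda>y. integral (cbox l u) (\<lambda>t. V t * (g (y - t) \<bullet> i))) has_derivative
      (\<lambda>h. integral (cbox l u) (\<lambda>t. V t *\<^sub>R (H (y - t) *v i)) \<bullet> h)) (at y)" .
    moreover have "integral (cbox l u) (\<lambda>t. V t * (g (y - t) \<bullet> i)) = integral (cbox l u) (\<lambda>t. V t *\<^sub>R g (y - t)) \<bullet> i" for y
      using integral_component_eq[OF ig, of y i] by simp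
    moreover have "integral (cbox l u) (\<lambda>t. V t *\<^sub>R (H (y - t) *v i)) \<bullet> h = (integral (cbox l u) (\<lambda>t. V t *\<^sub>R H (y - t)) *v h) \<bullet> i" for h
    proof -
      have bl: "bounded_linear (\<lambda>A :: real^'n^'n. (A *v h) \<bullet> i)"
        by (intro bounded_linear_compose[OF bounded_linear_inner_left]
            bounded_bilinear.bounded_linear_left[OF bounded_bilinear_matrix_vector])
      have "integral (cbox l u) (\<lambda>t. V t *\<^sub>R (H (y - t) *v i)) \<bullet> h = integral (cbox l u) (\<lambda>t. (V t *\<^sub>R (H (y - t) *v i)) \<bullet> h)"
        using integral_component_eq[OF iHv, of y i h] by simp
      also have "\<dots> = integral (cbox l u) (\<lambda>t. ((V t *\<^sub>R H (y - t)) *v h) \<bullet> i)"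
        by (simp add: sym[of _ i h] flip: scaleR_matrix_vector_assoc)
      also have "\<dots> = (integral (cbox l u) (\<lambda>t. V t *\<^sub>R H (y - t)) *v h) \<bullet> i"
        using integral_linear[OF iH bl, of y] by (simp add: o_def)
      finally show ?thesis .
    qed
    ultimately show "((\<lambda>y. integral (cbox l u) (\<lambda>t. V t *\<^sub>R g (y - t)) \<bullet> i) has_derivative
        (\<lambda>h. (integral (cbox l u) (\<lambda>t. V t *\<^sub>R H (y - t)) *v h) \<bullet> i)) (at y)" by simp
  qed
  have "continuous_on (UNIV \<times> cbox l u) (\<lambda>z. V (snd z) *\<^sub>R H (fst z - snd z))"
    by (intro continuous_intros cV cH)
  then have "continuous_on UNIV (\<lambda>y. integral (cbox l u) (\<lambda>t. V t *\<^sub>R H (y - t)))"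
    by (intro integral_continuous_on_param) (simp add: case_prod_unfold)
  moreover have "((\<lambda>y. integral (cbox l u) (\<lambda>t. V t * q (y - t))) has_derivative
          (\<lambda>h. integral (cbox l u) (\<lambda>t. V t *\<^sub>R g (y - t)) \<bullet> h)) (at y)" for y
    by (rule conv_deriv[OF _ gc V]) (use C2_onD(2)[OF q] in auto)
  ultimately show ?thesis unfolding C2_on_def using G by simp
qed

text \<open>Two forms of one convolution: the left one is an average of translates of V and inherits
  sphere inequalities, the right one has the variable in the smooth kernel and can be
  differentiated.\<close>

lemma conv_shift:
  fixes \<kappa> V :: "real^'n \<Rightarrow> real"
  assumes \<kappa>: "continuous_on UNIV \<kappa>" and V: "continuous_on UNIV V"
    and supp: "\<And>a. \<kappa> a \<noteq> 0 \<Longrightarrow> a \<in> cbox u v \<and> y - a \<in> cbox l m"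
  shows "integral (cbox u v) (\<lambda>a. \<kappa> a * V (y - a)) = integral (cbox l m) (\<lambda>t. V t * \<kappa> (y - t))"
proof -
  have cV: "continuous_on S (\<lambda>z. V (f z))" if "continuous_on S f" for S and f :: "'z::topological_space \<Rightarrow> real^'n"
    by (rule continuous_on_compose2[OF V that]) auto
  have c\<kappa>: "continuous_on S (\<lambda>z. \<kappa> (f z))" if "continuous_on S f" for S and f :: "'z::topological_space \<Rightarrow> real^'n"
    by (rule continuous_on_compose2[OF \<kappa> that]) auto
  have "((\<lambda>a. \<kappa> a * V (y - a)) has_integral integral (cbox u v) (\<lambda>a. \<kappa> a * V (y - a))) (cbox u v)"
    by (intro integrable_integral integrable_continuous continuous_intros cV c\<kappa>)
  from has_integral_affinity[OF this, of "-1" y]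
  have "((\<lambda>t. V t * \<kappa> (y - t)) has_integral integral (cbox u v) (\<lambda>a. \<kappa> a * V (y - a))) ((\<lambda>t. y - t) ` cbox u v)"
    by (simp add: mult.commute)
  then have 1: "((\<lambda>t. V t * \<kappa> (y - t)) has_integral integral (cbox u v) (\<lambda>a. \<kappa> a * V (y - a))) UNIV"
    by (rule has_integral_on_superset) (use supp in \<open>force simp: image_iff\<close>)+
  have "((\<lambda>t. V t * \<kappa> (y - t)) has_integral integral (cbox l m) (\<lambda>t. V t * \<kappa> (y - t))) (cbox l m)"
    by (intro integrable_integral integrable_continuous continuous_intros cV c\<kappa>)
  then have "((\<lambda>t. V t * \<kappa> (y - t)) has_integral integral (cbox l m) (\<lambda>t. V t * \<kappa> (y - t))) UNIV"
    by (rule has_integral_on_superset) (use supp[of "y - _"] in force)+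
  with 1 show ?thesis by (rule has_integral_unique)
qed

lemma mollifier_exists:
  assumes "\<rho> > 0"
  shows "\<exists>(\<kappa> :: real^'n \<Rightarrow> real) u v g H. C2_on UNIV \<kappa> g H \<and> (\<forall>a. \<kappa> a \<ge> 0) \<and> (\<forall>a. \<kappa> a \<noteq> 0 \<longrightarrow> norm a < \<rho> \<and> a \<in> cbox u v)
     \<and> integral (cbox u v) \<kappa> = 1"
proof -
  let ?b = "bump \<rho> :: real^'n \<Rightarrow> real"
  obtain u v :: "real^'n" where uv: "ball 0 \<rho> \<subseteq> cbox u v" using bounded_ball bounded_subset_cbox_symmetric by metis
  have supp: "norm a < \<rho>" if "?b a \<noteq> 0" for a
  proof -
    have "a \<bullet> a < \<rho>\<^sup>2" using that by (auto simp: bump_def max_def split: if_splits)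
    then show ?thesis using assms by (simp add: power_less_imp_less_base flip: power2_norm_eq_inner)
  qed
  have bc: "continuous_on S ?b" for S using C2_on_continuous[OF bump_C2] continuous_on_subset by blast
  have nn: "?b a \<ge> 0" for a by (simp add: bump_def)
  let ?Z = "integral (cbox u v) ?b"
  have hi: "(?b has_integral ?Z) (cbox u v)" by (intro integrable_integral integrable_continuous bc)
  have "?Z \<ge> 0" by (rule integral_nonneg) (use hi nn in auto)
  moreover have "?Z \<noteq> 0"
  proof
    assume "?Z = 0"
    moreover have "0 \<in> cbox u v" using uv assms by auto
    moreover have "box u v \<noteq> {}"
    proof -
      have "ball 0 \<rho> \<subseteq> box u v" using uv by (metis interior_cbox interior_maximal open_ball)
      then show ?thesis using assms by force
    qed
    ultimately have "?b 0 = 0" using hi by (intro has_integral_0_cbox_imp_0[of u v ?b 0] bc nn) auto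
    then show False using assms by (simp add: bump_def)
  qed
  ultimately have Z: "?Z > 0" by simp
  show ?thesis
  proof (intro exI conjI)
    show "C2_on UNIV (\<lambda>a. (1 / ?Z) * ?b a) (\<lambda>a. (1 / ?Z) *\<^sub>R ((- 6 * (max 0 (\<rho>\<^sup>2 - a \<bullet> a))\<^sup>2) *\<^sub>R a))
     (\<lambda>a. (1 / ?Z) *\<^sub>R ((24 * max 0 (\<rho>\<^sup>2 - a \<bullet> a)) *\<^sub>R (\<chi> i j. a $ i * a $ j) - (6 * (max 0 (\<rho>\<^sup>2 - a \<bullet> a))\<^sup>2) *\<^sub>R mat 1))"
      by (rule C2_on_scale[OF bump_C2])
    show "\<forall>a. 0 \<le> (1 / ?Z) * ?b a" using Z nn by simp
    show "\<forall>a. (1 / ?Z) * ?b a \<noteq> 0 \<longrightarrow> norm a < \<rho> \<and> a \<in> cbox u v"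
    proof (intro allI impI)
      fix a assume "(1 / ?Z) * ?b a \<noteq> 0"
      then have "norm a < \<rho>" by (intro supp) auto
      then show "norm a < \<rho> \<and> a \<in> cbox u v" using uv by (auto simp: subset_iff)
    qed
    show "integral (cbox u v) (\<lambda>a. (1 / ?Z) * ?b a) = 1" using Z by simp
  qed
qed

lemma conv_close:
  fixes \<kappa> V :: "real^'n \<Rightarrow> real"
  assumes \<kappa>: "continuous_on UNIV \<kappa>" "\<And>a. \<kappa> a \<ge> 0" "integral (cbox u v) \<kappa> = 1" and V: "continuous_on UNIV V"
    and close: "\<And>a. \<kappa> a \<noteq> 0 \<Longrightarrow> \<bar>V (y - a) - V y\<bar> \<le> e"
  shows "\<bar>integral (cbox u v) (\<lambda>a. \<kappa> a * V (y - a)) - V y\<bar> \<le> e"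
proof -
  have cV: "continuous_on S (\<lambda>z. V (f z))" if "continuous_on S f" for S and f :: "'z::topological_space \<Rightarrow> real^'n"
    by (rule continuous_on_compose2[OF V that]) auto
  have c\<kappa>: "continuous_on S \<kappa>" for S using \<kappa>(1) continuous_on_subset by blast
  have i1: "(\<lambda>a. \<kappa> a * V (y - a)) integrable_on cbox u v" by (intro integrable_continuous continuous_intros cV c\<kappa>)
  have i2: "(\<lambda>a. \<kappa> a * c) integrable_on cbox u v" for c by (intro integrable_continuous continuous_intros c\<kappa>)
  have c: "integral (cbox u v) (\<lambda>a. \<kappa> a * c) = c" for c using \<kappa>(3) by simp
  have le: "\<kappa> a * V (y - a) \<le> \<kappa> a * (V y + e)" "\<kappa> a * (V y - e) \<le> \<kappa> a * V (y - a)" for a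
  proof -
    have "\<kappa> a = 0 \<or> V (y - a) \<le> V y + e \<and> V y - e \<le> V (y - a)" using close[of a] by (auto simp: abs_le_iff)
    then show "\<kappa> a * V (y - a) \<le> \<kappa> a * (V y + e)" "\<kappa> a * (V y - e) \<le> \<kappa> a * V (y - a)"
      using \<kappa>(2) by (auto intro: mult_left_mono)
  qed
  have "integral (cbox u v) (\<lambda>a. \<kappa> a * V (y - a)) \<le> V y + e"
    using integral_le[OF i1 i2 le(1)] unfolding c .
  moreover have "V y - e \<le> integral (cbox u v) (\<lambda>a. \<kappa> a * V (y - a))"
    using integral_le[OF i2 i1 le(2)] unfolding c .
  ultimately show ?thesis by (simp add: abs_le_iff)
qed

section \<open>Comparison principle\<close>

lemma C2_on_cong:
  assumes "C2_on U \<phi> G H" and eq: "\<And>y. y \<in> U \<Longrightarrow> \<psi> y = \<phi> y"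
  shows "C2_on U \<psi> G H"
proof -
  have "(\<psi> has_derivative (\<lambda>h. G x \<bullet> h)) (at x)" if "x \<in> U" for x
    by (rule has_derivative_transform_within_open[OF C2_onD(2)[OF assms(1) that] C2_onD(1)[OF assms(1)] that])
       (simp add: eq)
  then show ?thesis using assms(1) unfolding C2_on_def by blast
qed

text \<open>At y a frame that attains \<open>Pplus k (H y)\<close> is fixed. Along this frame V
  satisfies the sphere inequality around every y - a in the support of the mollifier, with the
  common constant f y + \<eta>, by Ky Fan and the uniform continuity of f. The convolution inherits
  it for all small radii, and \<open>sphere_super_C2\<close> reads off the trace at y.\<close>

lemma mollified_supersolution:
  fixes V f :: "real^'n \<Rightarrow> real"
  assumes k: "1 \<le> k" "k \<le> CARD('n)" and V: "continuous_on UNIV V" and D: "open D" and K: "compact K" "K \<subseteq> D"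
    and f: "continuous_on D f" and \<eta>: "\<eta> > 0"
    and visc: "\<And>y \<phi> X. y \<in> D \<Longrightarrow> C2_near y \<phi> X \<Longrightarrow> (\<forall>\<^sub>F z in nhds y. V y - \<phi> y \<le> V z - \<phi> z) \<Longrightarrow> Pplus k X \<le> f y"
  shows "\<exists>W U G H. C2_on U W G H \<and> K \<subseteq> U \<and> (\<forall>y\<in>K. \<bar>W y - V y\<bar> \<le> \<eta> \<and> Pplus k (H y) \<le> f y + \<eta>)"
proof (cases "K = {}")
  case True
  then show ?thesis using C2_on_const[of 0] by blast
next
  case False
  obtain d0 where d0: "d0 > 0" "{y. infdist y K \<le> d0} \<subseteq> D"
    using compact_in_open_separated[OF False K(1) D K(2)] by blast
  define K2 where "K2 = {y. infdist y K \<le> d0}"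
  have "compact K2" unfolding K2_def by (rule compact_infdist_le[OF False K(1)]) (rule d0(1))
  moreover have "K2 \<subseteq> D" using d0(2) by (simp add: K2_def)
  ultimately have uf: "uniformly_continuous_on K2 f" and uV: "uniformly_continuous_on K2 V"
    using compact_uniformly_continuous continuous_on_subset[OF f] continuous_on_subset[OF V] by blast+
  obtain d1 where d1: "d1 > 0" "\<And>y z. y \<in> K2 \<Longrightarrow> z \<in> K2 \<Longrightarrow> dist z y < d1 \<Longrightarrow> dist (f z) (f y) < \<eta>"
    using uf \<eta> unfolding uniformly_continuous_on_def by blast
  obtain d2 where d2: "d2 > 0" "\<And>y z. y \<in> K2 \<Longrightarrow> z \<in> K2 \<Longrightarrow> dist z y < d2 \<Longrightarrow> dist (V z) (V y) < \<eta>"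
    using uV \<eta> unfolding uniformly_continuous_on_def by blast
  \<comment> \<open>Discs of radius r < \<rho> around y - a with |a| < \<rho> stay within 2 \<rho>
    of y; hence the halving.\<close>
  define \<rho> where "\<rho> = min (min d0 d1) d2 / 2"
  have \<rho>: "\<rho> > 0" "2 * \<rho> \<le> d0" "2 * \<rho> \<le> d1" "2 * \<rho> \<le> d2" using d0 d1 d2 by (auto simp: \<rho>_def)
  have near: "z \<in> K2" if "y \<in> K" "dist z y < 2 * \<rho>" for y z
    using infdist_le2[OF that(1), of z d0] that \<rho> by (simp add: K2_def)
  obtain \<kappa> :: "real^'n \<Rightarrow> real" and u v g Hk where \<kappa>: "C2_on UNIV \<kappa> g Hk" "\<And>a. \<kappa> a \<ge> 0"
      "\<And>a. \<kappa> a \<noteq> 0 \<Longrightarrow> norm a < \<rho> \<and> a \<in> cbox u v" "integral (cbox u v) \<kappa> = 1"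
    using mollifier_exists[OF \<rho>(1)] by blast
  have c\<kappa>: "continuous_on UNIV \<kappa>" by (rule C2_on_continuous[OF \<kappa>(1)])
  define W where "W y = integral (cbox u v) (\<lambda>a. \<kappa> a * V (y - a))" for y
  obtain R where R: "K \<subseteq> ball 0 R" using K(1) compact_imp_bounded bounded_subset_ballD by blast
  \<comment> \<open>One box that contains y - a for all y in the ball of radius R and all a in the
    support, so that the smooth form of the convolution is the same for all these y.\<close>
  obtain l m :: "real^'n" where lm: "ball 0 (R + \<rho>) \<subseteq> cbox l m" using bounded_ball bounded_subset_cbox_symmetric by metis
  have "C2_on UNIV (\<lambda>y. integral (cbox l m) (\<lambda>t. V t * \<kappa> (y - t))) (\<lambda>y. integral (cbox l m) (\<lambda>t. V t *\<^sub>R g (y - t)))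
     (\<lambda>y. integral (cbox l m) (\<lambda>t. V t *\<^sub>R Hk (y - t)))"
    by (rule conv_C2[OF \<kappa>(1) V])
  then have "C2_on (ball 0 R) (\<lambda>y. integral (cbox l m) (\<lambda>t. V t * \<kappa> (y - t))) (\<lambda>y. integral (cbox l m) (\<lambda>t. V t *\<^sub>R g (y - t)))
     (\<lambda>y. integral (cbox l m) (\<lambda>t. V t *\<^sub>R Hk (y - t)))"
    by (rule C2_on_subset) auto
  moreover have "W y = integral (cbox l m) (\<lambda>t. V t * \<kappa> (y - t))" if "y \<in> ball 0 R" for y
    unfolding W_def
  proof (rule conv_shift[OF c\<kappa> V])
    fix a assume "\<kappa> a \<noteq> 0"
    then have a: "norm a < \<rho>" "a \<in> cbox u v" using \<kappa>(3) by auto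
    then have "norm (y - a) < R + \<rho>" using that norm_triangle_ineq4[of y a] by auto
    then show "a \<in> cbox u v \<and> y - a \<in> cbox l m" using a lm by (auto simp: subset_iff)
  qed
  ultimately obtain G H where W2: "C2_on (ball 0 R) W G H" using C2_on_cong by blast
  have "\<bar>W y - V y\<bar> \<le> \<eta>" if y: "y \<in> K" for y
    unfolding W_def
  proof (rule conv_close[OF c\<kappa> \<kappa>(2) \<kappa>(4) V])
    fix a assume "\<kappa> a \<noteq> 0"
    then have "norm a < \<rho>" using \<kappa>(3) by blast
    then have "dist (y - a) y < 2 * \<rho>" using \<rho>(1) by (simp add: dist_norm)
    then have "dist (V (y - a)) (V y) < \<eta>" using near[OF y, of "y - a"] near[OF y, of y] \<rho> by (intro d2(2)) auto
    then show "\<bar>V (y - a) - V y\<bar> \<le> \<eta>" by (simp add: dist_real_def)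
  qed
  moreover have "Pplus k (H y) \<le> f y + \<eta>" if y: "y \<in> K" for y
  proof -
    have yR: "y \<in> ball 0 R" using R y by blast
    obtain \<xi> I where I: "onb \<xi>" "card I = k" "Pplus k (H y) = (\<Sum>i\<in>I. \<xi> i \<bullet> (H y *v \<xi> i))"
      using Pplus_attained[OF C2_on_symmetric[OF W2 yR] k] by blast
    have Ine: "I \<noteq> {}" using I(2) k by auto
    interpret frame \<xi> I y by unfold_locales (fact I(1), fact Ine)
    have "(\<Sum>i\<in>I. \<xi> i \<bullet> (H y *v \<xi> i)) \<le> f y + \<eta>"
    proof (rule sphere_super_C2[OF W2 yR \<rho>(1)])
      fix r assume r: "0 < r" "r < \<rho>"
      show "sphere_super r W (r\<^sup>2 / (2 * real (card I)) * (f y + \<eta>))"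
        unfolding W_def[abs_def]
      proof (rule sphere_super_convolution[OF V c\<kappa> \<kappa>(2) \<kappa>(4) r(1)])
        fix a assume "\<kappa> a \<noteq> 0"
        then have a: "norm a < \<rho>" using \<kappa>(3) by blast
        interpret T: frame \<xi> I "y - a" by unfold_locales (fact I(1), fact Ine)
        show "T.sphere_super r V (r\<^sup>2 / (2 * real (card I)) * (f y + \<eta>))"
        proof (rule T.viscosity_sphere_super[OF V _ _ r(1)])
          show "open (ball y (2 * \<rho>))" by simp
          show "T.disc_on r \<subseteq> ball y (2 * \<rho>)"
          proof
            fix z assume "z \<in> T.disc_on r"
            then have "norm (z - (y - a)) \<le> r" using T.disc_on_norm r by auto
            then have "norm (y - z) < 2 * \<rho>" using a r norm_triangle_ineq4[of a "z - (y - a)"] by (simp add: algebra_simps)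
            then show "z \<in> ball y (2 * \<rho>)" by (simp add: dist_norm)
          qed
          fix z \<phi> X assume z: "z \<in> ball y (2 * \<rho>)" "C2_near z \<phi> X" "\<forall>\<^sub>F w in nhds z. V z - \<phi> z \<le> V w - \<phi> w"
          have zK: "z \<in> K2" using near[OF y, of z] z(1) by (simp add: dist_commute)
          have "(\<Sum>i\<in>I. \<xi> i \<bullet> (X *v \<xi> i)) \<le> Pplus k X"
            by (rule Pplus_ge[OF C2_near_symmetric[OF z(2)] k I(1,2)])
          also have "\<dots> \<le> f z" using zK \<open>K2 \<subseteq> D\<close> by (intro visc[OF _ z(2,3)]) auto
          also have "\<dots> \<le> f y + \<eta>"
          proof -
            have "dist (f z) (f y) < \<eta>" using zK near[OF y, of y] z(1) \<rho> by (intro d1(2)) (auto simp: dist_commute)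
            then show ?thesis by (simp add: dist_real_def)
          qed
          finally show "(\<Sum>i\<in>I. \<xi> i \<bullet> (X *v \<xi> i)) \<le> f y + \<eta>" .
        qed
      qed
    qed
    then show ?thesis using I(3) by simp
  qed
  ultimately show ?thesis using W2 R by blast
qed

section \<open>Semicontinuous functions and their extrema\<close>

lemma usc_on_iff_lsc_on: "usc_on S u \<longleftrightarrow> lsc_on S (\<lambda>x. - u x)"
proof
  assume u: "usc_on S u"
  show "lsc_on S (\<lambda>x. - u x)" unfolding lsc_on_def
  proof (intro ballI allI impI)
    fix x c assume "x \<in> S" "c < - u x"
    then have "\<forall>\<^sub>F y in at x within S. u y < - c" using u unfolding usc_on_def by simp
    then show "\<forall>\<^sub>F y in at x within S. c < - u y" by eventually_elim simp
  qed
next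
  assume u: "lsc_on S (\<lambda>x. - u x)"
  show "usc_on S u" unfolding usc_on_def
  proof (intro ballI allI impI)
    fix x c assume "x \<in> S" "c > u x"
    then have "- c < - u x" by simp
    then have "\<forall>\<^sub>F y in at x within S. - c < - u y" using u \<open>x \<in> S\<close> unfolding lsc_on_def by blast
    then show "\<forall>\<^sub>F y in at x within S. u y < c" by eventually_elim simp
  qed
qed

lemma lsc_on_ball:
  fixes S :: "'a::metric_space set"
  assumes "lsc_on S g" "x \<in> S" "c < g x"
  shows "\<exists>d>0. \<forall>y\<in>S. dist y x < d \<longrightarrow> c < g y"
proof -
  have "\<forall>\<^sub>F y in at x within S. c < g y" using assms by (auto simp: lsc_on_def)
  then obtain d where "d > 0" "\<And>y. y \<in> S \<Longrightarrow> y \<noteq> x \<Longrightarrow> dist y x < d \<Longrightarrow> c < g y"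
    unfolding eventually_at by auto
  then show ?thesis using assms(3) by (metis)
qed

lemma usc_on_ball:
  fixes S :: "'a::metric_space set"
  assumes "usc_on S g" "x \<in> S" "g x < c"
  shows "\<exists>d>0. \<forall>y\<in>S. dist y x < d \<longrightarrow> g y < c"
  using lsc_on_ball[of S "\<lambda>x. - g x" x "- c"] assms by (simp add: usc_on_iff_lsc_on)

lemma usc_onI:
  fixes S :: "'a::metric_space set"
  assumes "\<And>x c. x \<in> S \<Longrightarrow> g x < c \<Longrightarrow> \<exists>d>0. \<forall>y\<in>S. dist y x < d \<longrightarrow> g y < c"
  shows "usc_on S g"
  unfolding usc_on_def eventually_at using assms by blast

lemma continuous_on_imp_lsc_on:
  fixes g :: "'a::metric_space \<Rightarrow> real"
  assumes "continuous_on S g" shows "lsc_on S g"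
  using assms unfolding lsc_on_def continuous_on_def by (auto intro: order_tendstoD)

lemma continuous_on_imp_usc_on:
  fixes g :: "'a::metric_space \<Rightarrow> real"
  assumes "continuous_on S g" shows "usc_on S g"
  using assms unfolding usc_on_def continuous_on_def by (auto intro: order_tendstoD)

lemma lsc_on_add_continuous:
  fixes g :: "'a::metric_space \<Rightarrow> real"
  assumes "lsc_on S g" "continuous_on S h"
  shows "lsc_on S (\<lambda>x. g x + h x)"
  unfolding lsc_on_def
proof (intro ballI allI impI)
  fix x c assume x: "x \<in> S" "c < g x + h x"
  define e where "e = (g x + h x - c) / 2"
  have e: "e > 0" using x by (simp add: e_def)
  have "\<forall>\<^sub>F y in at x within S. g x - e < g y" using assms(1) x e by (auto simp: lsc_on_def)
  moreover have "\<forall>\<^sub>F y in at x within S. h x - e < h y"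
    using assms(2) x e unfolding continuous_on_def by (intro order_tendstoD(1)) auto
  ultimately show "\<forall>\<^sub>F y in at x within S. c < g y + h y"
    by eventually_elim (auto simp: e_def field_simps)
qed

lemma usc_on_add_continuous:
  fixes g :: "'a::metric_space \<Rightarrow> real"
  assumes "usc_on S g" "continuous_on S h"
  shows "usc_on S (\<lambda>x. g x + h x)"
  using lsc_on_add_continuous[of S "\<lambda>x. - g x" "\<lambda>x. - h x"] assms
  by (simp add: usc_on_iff_lsc_on continuous_on_minus)

lemma lsc_on_subset: "lsc_on S g \<Longrightarrow> T \<subseteq> S \<Longrightarrow> lsc_on T g"
  unfolding lsc_on_def using at_le[of T S] filter_leD by blast

lemma usc_on_subset: "usc_on S g \<Longrightarrow> T \<subseteq> S \<Longrightarrow> usc_on T g"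
  using lsc_on_subset unfolding usc_on_iff_lsc_on by blast

text \<open>If no point were minimal, every x would have a z x of smaller value, and g would exceed
  g (z x) near x. In a finite subcover the x with the least g (z x) is contradicted at the point z
  x.\<close>

lemma lsc_on_attains_inf:
  fixes S :: "'a::metric_space set"
  assumes "compact S" "S \<noteq> {}" "lsc_on S g"
  shows "\<exists>x\<in>S. \<forall>y\<in>S. g x \<le> g y"
proof (rule ccontr)
  assume "\<not> ?thesis"
  then have "\<forall>x\<in>S. \<exists>y\<in>S. g y < g x" by (meson not_le)
  then obtain z where z: "\<And>x. x \<in> S \<Longrightarrow> z x \<in> S \<and> g (z x) < g x" by metis
  have "\<forall>x\<in>S. \<exists>d>0. \<forall>y\<in>S. dist y x < d \<longrightarrow> g (z x) < g y"
    using lsc_on_ball[OF assms(3)] z by blast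
  then obtain d where d: "\<And>x. x \<in> S \<Longrightarrow> d x > 0" "\<And>x y. x \<in> S \<Longrightarrow> y \<in> S \<Longrightarrow> dist y x < d x \<Longrightarrow> g (z x) < g y"
    by metis
  have "S \<subseteq> (\<Union>x\<in>S. ball x (d x))" using d(1) by force
  then obtain C where C: "C \<subseteq> S" "finite C" "S \<subseteq> (\<Union>x\<in>C. ball x (d x))"
    using compactE_image[OF assms(1), of S "\<lambda>x. ball x (d x)"] by auto
  have "C \<noteq> {}" using C(3) assms(2) by auto
  obtain x where x: "x \<in> C" "\<And>y. y \<in> C \<Longrightarrow> g (z x) \<le> g (z y)"
    using ex_min_if_finite[of "(\<lambda>x. g (z x)) ` C"] C(2) \<open>C \<noteq> {}\<close> by (auto simp: not_less) 
  have "z x \<in> S" using x C(1) z by blast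
  then obtain y where y: "y \<in> C" "dist (z x) y < d y" using C(3) by (force simp: dist_commute)
  have "g (z y) < g (z x)" using y C(1) \<open>z x \<in> S\<close> by (intro d(2)) auto
  then show False using x(2)[OF y(1)] by simp
qed

lemma usc_on_attains_sup:
  fixes S :: "'a::metric_space set"
  assumes "compact S" "S \<noteq> {}" "usc_on S g"
  shows "\<exists>x\<in>S. \<forall>y\<in>S. g y \<le> g x"
  using lsc_on_attains_inf[of S "\<lambda>x. - g x"] assms by (simp add: usc_on_iff_lsc_on)

section \<open>Inf-convolution\<close>

definition inf_conv :: "real \<Rightarrow> 'a set \<Rightarrow> ('a::euclidean_space \<Rightarrow> real) \<Rightarrow> 'a \<Rightarrow> real" where
  "inf_conv \<alpha> S v x = (INF y\<in>S. v y + \<alpha> * (norm (x - y))\<^sup>2)"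

context
  fixes S :: "'a::euclidean_space set" and v :: "'a \<Rightarrow> real" and \<alpha> :: real
  assumes S: "compact S" "S \<noteq> {}" and v: "lsc_on S v" and \<alpha>: "\<alpha> > 0"
begin

lemma inf_conv_attained:
  "\<exists>y\<in>S. inf_conv \<alpha> S v x = v y + \<alpha> * (norm (x - y))\<^sup>2"
  and inf_conv_le: "y \<in> S \<Longrightarrow> inf_conv \<alpha> S v x \<le> v y + \<alpha> * (norm (x - y))\<^sup>2"
proof -
  have "lsc_on S (\<lambda>y. v y + \<alpha> * (norm (x - y))\<^sup>2)"
    by (intro lsc_on_add_continuous v continuous_intros)
  then obtain y where y: "y \<in> S" "\<And>z. z \<in> S \<Longrightarrow> v y + \<alpha> * (norm (x - y))\<^sup>2 \<le> v z + \<alpha> * (norm (x - z))\<^sup>2"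
    using lsc_on_attains_inf[OF S] by blast
  have "inf_conv \<alpha> S v x = v y + \<alpha> * (norm (x - y))\<^sup>2"
    unfolding inf_conv_def by (rule cInf_eq_minimum) (use y in auto)
  then show "\<exists>y\<in>S. inf_conv \<alpha> S v x = v y + \<alpha> * (norm (x - y))\<^sup>2"
    and "y \<in> S \<Longrightarrow> inf_conv \<alpha> S v x \<le> v y + \<alpha> * (norm (x - y))\<^sup>2" for y
    using y by auto
qed

text \<open>Using the minimiser for x as a competitor at z gives a bound that is linear in the
  distance on bounded sets.\<close>

lemma inf_conv_continuous: "continuous_on UNIV (inf_conv \<alpha> S v)"
proof -
  obtain R where R: "\<And>y. y \<in> S \<Longrightarrow> norm y \<le> R" using compact_imp_bounded[OF S(1)] bounded_iff by metis
  have R0: "R \<ge> 0" using R S(2) norm_ge_zero order_trans by blast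
  let ?V = "inf_conv \<alpha> S v"
  have le: "?V z \<le> ?V x + \<alpha> * (dist z x * (dist z x + 2 * (norm x + R)))" for x z :: 'a
  proof -
    obtain y where y: "y \<in> S" "?V x = v y + \<alpha> * (norm (x - y))\<^sup>2" using inf_conv_attained by blast
    have "(norm (z - y))\<^sup>2 \<le> (norm (z - x) + norm (x - y))\<^sup>2"
      using norm_triangle_ineq[of "z - x" "x - y"] by (intro power_mono) auto
    also have "\<dots> = (norm (x - y))\<^sup>2 + norm (z - x) * (norm (z - x) + 2 * norm (x - y))"
      by (simp add: power2_eq_square algebra_simps)
    also have "\<dots> \<le> (norm (x - y))\<^sup>2 + dist z x * (dist z x + 2 * (norm x + R))"
      using norm_triangle_ineq4[of x y] R[OF y(1)] unfolding dist_norm by (intro add_left_mono mult_left_mono) auto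
    finally have "\<alpha> * (norm (z - y))\<^sup>2 \<le> \<alpha> * ((norm (x - y))\<^sup>2 + dist z x * (dist z x + 2 * (norm x + R)))"
      using \<alpha> by simp
    then show ?thesis using inf_conv_le[OF y(1), of z] y(2) by (simp add: distrib_left)
  qed
  show ?thesis unfolding continuous_on_iff
  proof (intro ballI allI impI)
    fix x :: 'a and e :: real assume e: "e > 0"
    let ?C = "\<alpha> * (1 + 2 * (norm x + 1 + R))"
    have C: "?C > 0" using \<alpha> R0 by (simp add: add_pos_nonneg)
    have "dist (?V z) (?V x) < e" if z: "dist z x < min 1 (e / ?C)" for z
    proof -
      have n: "norm z \<le> norm x + 1" using z norm_triangle_ineq2[of z x] by (simp add: dist_norm)
      have "\<alpha> * (dist z x * (dist z x + 2 * (norm w + R))) \<le> dist z x * ?C" if "norm w \<le> norm x + 1" for w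
      proof -
        have "dist z x * (dist z x + 2 * (norm w + R)) \<le> dist z x * (1 + 2 * (norm x + 1 + R))"
          using z that by (intro mult_left_mono) auto
        then have "\<alpha> * (dist z x * (dist z x + 2 * (norm w + R))) \<le> \<alpha> * (dist z x * (1 + 2 * (norm x + 1 + R)))" using \<alpha> by simp
        then show ?thesis by (simp add: mult_ac)
      qed
      note b = this
      have "?V z \<le> ?V x + dist z x * ?C" using le[of z x] b[of x] by simp
      moreover have "?V x \<le> ?V z + dist z x * ?C" using le[of x z] b[OF n] by (simp add: dist_commute)
      moreover have "dist z x * ?C < e" using z C by (simp add: field_simps)
      ultimately show ?thesis by (simp add: dist_real_def)
    qed
    then show "\<exists>d>0. \<forall>z\<in>UNIV. dist z x < d \<longrightarrow> dist (?V z) (?V x) < e"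
      using e C by (intro exI[of _ "min 1 (e / ?C)"]) auto
  qed
qed

end

section \<open>The comparison argument\<close>

lemma C2_near_shift:
  assumes "C2_near x \<phi> X" shows "C2_near (x - a) (\<lambda>y. \<phi> (y + a)) X"
proof -
  obtain U G H where "x \<in> U" "C2_on U \<phi> G H" "H x = X" using assms unfolding C2_near_iff by blast
  then show ?thesis using C2_on_near[OF C2_on_shift[of U \<phi> G H a], of "x - a"] by simp
qed

text \<open>Suppose u exceeds v by 2 m at an interior point. A quadratic makes u strict,
  inf-convolution makes v continuous at the price of moving points by less than \<delta>, and
  mollification makes it C^2. The maximum of the difference stays away from the boundary, so the
  smooth function minus the quadratic is a test function for u, and the gain 2 k \<epsilon> beats
  the error 2 \<eta>.\<close>

lemma comparison:
  fixes u v f :: "real^'n \<Rightarrow> real"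
  assumes k: "1 \<le> k" "k \<le> CARD('n)" and \<Omega>: "open \<Omega>" "bounded \<Omega>" and f: "continuous_on \<Omega> f"
    and usc: "usc_on (closure \<Omega>) u" and lsc: "lsc_on (closure \<Omega>) v"
    and sub: "viscosity_subsolution k f \<Omega> u" and super: "viscosity_supersolution k f \<Omega> v"
    and bd: "\<And>x. x \<in> frontier \<Omega> \<Longrightarrow> u x \<le> v x"
    and M: "\<And>x. x \<in> closure \<Omega> \<Longrightarrow> \<bar>v x\<bar> \<le> M"
    and x1: "x1 \<in> \<Omega>"
  shows "u x1 \<le> v x1"
proof (rule ccontr)
  assume "\<not> u x1 \<le> v x1"
  then have gt: "u x1 - v x1 > 0" by simp
  let ?S = "closure \<Omega>" and ?F = "frontier \<Omega>"
  have S: "compact ?S" using \<Omega>(2) by (simp add: compact_closure)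
  have \<Omega>S: "\<Omega> \<subseteq> ?S" by (rule closure_subset)
  have Sne: "?S \<noteq> {}" using x1 \<Omega>S by auto
  have F: "compact ?F" using \<Omega>(2) by (rule compact_frontier_bounded)
  have Fne: "?F \<noteq> {}" using x1 \<Omega>(2) frontier_not_empty[of \<Omega>] not_bounded_UNIV by force
  have SF: "?S = \<Omega> \<union> ?F" using \<Omega>(1) by (simp add: closure_Un_frontier)
  have FS: "?F \<subseteq> ?S" using SF by blast
  obtain R where R: "\<And>x. x \<in> ?S \<Longrightarrow> norm x \<le> R" using compact_imp_bounded[OF S] bounded_iff by metis
  \<comment> \<open>On the closure the perturbation lies between - \<epsilon> R^2 and 0: it costs at
    most half of the gap at x1 and does not raise boundary values. The summand 1 covers R =
    0.\<close>
  define \<epsilon> where "\<epsilon> = (u x1 - v x1) / (2 * (R\<^sup>2 + 1))"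
  have R1: "R\<^sup>2 + 1 > 0" by (simp add: add_nonneg_pos)
  have \<epsilon>: "\<epsilon> > 0" unfolding \<epsilon>_def using gt R1 by simp
  define m where "m = (u x1 - v x1) / 2"
  have m: "m > 0" using gt by (simp add: m_def)
  define w where "w x = u x + \<epsilon> * ((norm x)\<^sup>2 - R\<^sup>2)" for x
  have wu: "w x \<le> u x" if "x \<in> ?S" for x
  proof -
    have "(norm x)\<^sup>2 \<le> R\<^sup>2" using R[OF that] by (intro power_mono) auto
    then show ?thesis using \<epsilon> by (simp add: w_def mult_nonneg_nonpos)
  qed
  have wx1: "w x1 - v x1 \<ge> m"
  proof -
    have "\<epsilon> * (R\<^sup>2 - (norm x1)\<^sup>2) \<le> \<epsilon> * (R\<^sup>2 + 1)" using \<epsilon> by (intro mult_left_mono) (auto intro: order_trans[of _ 0])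
    also have "\<dots> = m" using R1 unfolding \<epsilon>_def m_def by (simp only: times_divide_eq_left mult_divide_mult_cancel_right)
    finally have "\<epsilon> * (R\<^sup>2 - (norm x1)\<^sup>2) \<le> m" .
    moreover have "w x1 - v x1 = 2 * m - \<epsilon> * (R\<^sup>2 - (norm x1)\<^sup>2)" by (simp add: w_def m_def right_diff_distrib diff_divide_distrib)
    ultimately show ?thesis by linarith
  qed
  have wusc: "usc_on ?S w" unfolding w_def[abs_def] by (intro usc_on_add_continuous usc continuous_intros)
  \<comment> \<open>Two points x and y occur because the inf-convolution compares w at x with v at a
    nearby minimiser y. Compactness of the frontier makes the distance uniform, as a Lebesgue number
    e.\<close>
  have "\<forall>z\<in>?F. \<exists>d>0. \<forall>x\<in>?S. \<forall>y\<in>?S. dist x z < d \<longrightarrow> dist y z < d \<longrightarrow> w x - v y < m / 2"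
  proof
    fix z assume z: "z \<in> ?F"
    then have zS: "z \<in> ?S" using FS by blast
    obtain d1 where d1: "d1 > 0" "\<And>x. x \<in> ?S \<Longrightarrow> dist x z < d1 \<Longrightarrow> w x < w z + m / 4"
      using usc_on_ball[OF wusc zS, of "w z + m / 4"] m by auto
    obtain d2 where d2: "d2 > 0" "\<And>x. x \<in> ?S \<Longrightarrow> dist x z < d2 \<Longrightarrow> v z - m / 4 < v x"
      using lsc_on_ball[OF lsc zS, of "v z - m / 4"] m by auto
    have "w x - v y < m / 2" if "x \<in> ?S" "y \<in> ?S" "dist x z < min d1 d2" "dist y z < min d1 d2" for x y
      using d1(2)[of x] d2(2)[of y] that wu[OF zS] bd[OF z] by simp
    then show "\<exists>d>0. \<forall>x\<in>?S. \<forall>y\<in>?S. dist x z < d \<longrightarrow> dist y z < d \<longrightarrow> w x - v y < m / 2"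
      using d1(1) d2(1) by (intro exI[of _ "min d1 d2"]) auto
  qed
  from bchoice[OF this] obtain d where
    d0: "\<forall>z\<in>?F. d z > 0 \<and> (\<forall>x\<in>?S. \<forall>y\<in>?S. dist x z < d z \<longrightarrow> dist y z < d z \<longrightarrow> w x - v y < m / 2)" ..
  have d: "d z > 0" "x \<in> ?S \<Longrightarrow> y \<in> ?S \<Longrightarrow> dist x z < d z \<Longrightarrow> dist y z < d z \<Longrightarrow> w x - v y < m / 2"
    if "z \<in> ?F" for x y z using d0 that by simp_all
  obtain e where e: "e > 0" "\<And>z. z \<in> ?F \<Longrightarrow> \<exists>G\<in>(\<lambda>z. ball z (d z)) ` ?F. ball z e \<subseteq> G"
  proof (rule Heine_Borel_lemma[OF F, of "(\<lambda>z. ball z (d z)) ` ?F"])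
    show "?F \<subseteq> \<Union> ((\<lambda>z. ball z (d z)) ` ?F)"
    proof
      fix z assume "z \<in> ?F"
      then show "z \<in> \<Union> ((\<lambda>z. ball z (d z)) ` ?F)" using d(1)[of z] by (intro UN_I[of z]) auto
    qed
  qed auto
  have boundary: "w x - v y < m / 2" if "x \<in> ?S" "y \<in> ?S" "infdist x ?F < e / 2" "dist x y < e / 2" for x y
  proof -
    obtain z where z: "z \<in> ?F" "infdist x ?F = dist x z"
      using infdist_attains_inf[OF compact_imp_closed[OF F] Fne, of x] by blast
    obtain z' where z': "z' \<in> ?F" "ball z e \<subseteq> ball z' (d z')" using e(2)[OF z(1)] by blast
    have "x \<in> ball z e" using that z e(1) by (simp add: dist_commute)
    moreover have "y \<in> ball z e" using that z dist_triangle[of z y x] by (simp add: dist_commute)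
    ultimately show ?thesis using d(2)[OF z'(1) that(1,2)] z'(2) by (auto simp: subset_iff dist_commute)
  qed
  \<comment> \<open>Four distances from the frontier are used: the maximum lies beyond e/2, W is
    controlled beyond e/4, V is a supersolution for f + \<eta> beyond e/8, and the corresponding
    minimisers stay beyond e/16.\<close>
  define K where "K t = {x \<in> ?S. t \<le> infdist x ?F}" for t
  have cinf: "continuous_on A (\<lambda>x. infdist x ?F)" for A by (intro continuous_on_infdist continuous_on_id)
  have cK: "compact (K t)" for t
  proof -
    have "K t = ?S \<inter> {x. t \<le> infdist x ?F}" by (auto simp: K_def)
    moreover have "closed {x. t \<le> infdist x ?F}" by (intro closed_Collect_le cinf continuous_on_const)
    ultimately show ?thesis using S by (simp add: compact_Int_closed)
  qed
  have K\<Omega>: "K t \<subseteq> \<Omega>" if "t > 0" for t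
  proof
    fix x assume x: "x \<in> K t"
    then have "x \<notin> ?F" using that by (auto simp: K_def)
    then show "x \<in> \<Omega>" using x SF by (auto simp: K_def)
  qed
  define D where "D = {x \<in> \<Omega>. e / 8 < infdist x ?F}"
  have oD: "open D"
  proof -
    have "D = \<Omega> \<inter> {x. e / 8 < infdist x ?F}" by (auto simp: D_def)
    moreover have "open {x. e / 8 < infdist x ?F}" by (intro open_Collect_less cinf continuous_on_const)
    ultimately show ?thesis using \<Omega>(1) by auto
  qed
  \<comment> \<open>The bound k \<epsilon> / 2 keeps the total error 2 \<eta> below the gain 2 k
    \<epsilon>; the bound m / 8 ensures that w - V is at least m / 2 at a maximum point of w -
    W.\<close>
  define \<eta> where "\<eta> = min (k * \<epsilon> / 2) (m / 8)"
  have \<eta>: "\<eta> > 0" "\<eta> \<le> k * \<epsilon> / 2" "\<eta> \<le> m / 8" using k \<epsilon> m by (auto simp: \<eta>_def)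
  have "uniformly_continuous_on (K (e / 16)) f"
    by (intro compact_uniformly_continuous cK continuous_on_subset[OF f] K\<Omega>) (use e in simp)
  then obtain df where df: "df > 0" "\<And>x y. x \<in> K (e / 16) \<Longrightarrow> y \<in> K (e / 16) \<Longrightarrow> dist y x < df \<Longrightarrow> dist (f y) (f x) < \<eta>"
    using \<eta>(1) unfolding uniformly_continuous_on_def by blast
  define \<delta> where "\<delta> = min (e / 16) df"
  have \<delta>: "\<delta> > 0" "\<delta> \<le> e / 16" "\<delta> \<le> df" using e df by (auto simp: \<delta>_def)
  have M0: "M \<ge> 0" using M Sne by (meson abs_ge_zero all_not_in_conv order_trans)
  \<comment> \<open>The penalty at a minimiser y is at most v x - v y, hence at most 2 M; with 2 M +
    1 in the numerator the distance is strictly below \<delta>, also for M = 0.\<close>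
  define \<alpha> where "\<alpha> = (2 * M + 1) / \<delta>\<^sup>2"
  have \<alpha>: "\<alpha> > 0" using M0 \<delta> by (simp add: \<alpha>_def)
  define V where "V = inf_conv \<alpha> ?S v"
  note V_att = inf_conv_attained[OF S Sne lsc \<alpha>, folded V_def]
  note V_le = inf_conv_le[OF S Sne lsc \<alpha>, folded V_def]
  have cV: "continuous_on UNIV V" unfolding V_def by (rule inf_conv_continuous[OF S Sne lsc \<alpha>])
  have Vv: "V x \<le> v x" if "x \<in> ?S" for x using V_le[OF that, of x] by simp
  have close: "dist x y < \<delta>" if x: "x \<in> ?S" and y: "y \<in> ?S" "V x = v y + \<alpha> * (norm (x - y))\<^sup>2" for x y
  proof -
    have "\<alpha> * (norm (x - y))\<^sup>2 \<le> v x - v y" using Vv[OF x] y(2) by simp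
    also have "\<dots> \<le> 2 * M" using M[OF x] M[OF y(1)] by (auto simp: abs_le_iff)
    also have "\<dots> < \<alpha> * \<delta>\<^sup>2" using \<delta>(1) by (simp add: \<alpha>_def)
    finally have "(norm (x - y))\<^sup>2 < \<delta>\<^sup>2" using \<alpha> by simp
    then show ?thesis using \<delta>(1) by (simp add: dist_norm power_less_imp_less_base)
  qed
  have visc: "Pplus k X \<le> f x + \<eta>"
    if x: "x \<in> D" and \<phi>: "C2_near x \<phi> X" and ev: "\<forall>\<^sub>F z in nhds x. V x - \<phi> x \<le> V z - \<phi> z" for x \<phi> X
  proof -
    have xS: "x \<in> ?S" using x \<Omega>S by (auto simp: D_def)
    obtain y where y: "y \<in> ?S" "V x = v y + \<alpha> * (norm (x - y))\<^sup>2" using V_att by blast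
    have xy: "dist x y < \<delta>" by (rule close[OF xS y])
    have "infdist x ?F \<le> infdist y ?F + dist x y" by (rule infdist_triangle)
    then have yK: "y \<in> K (e / 16)" using x xy \<delta>(2) y(1) by (simp add: D_def K_def)
    have xK: "x \<in> K (e / 16)" using x xS e by (simp add: D_def K_def)
    have y\<Omega>: "y \<in> \<Omega>" using K\<Omega>[of "e / 16"] yK e by auto
    \<comment> \<open>Freezing the shift x - y turns a test function for V at x into one for v at
      the minimiser y: the penalty becomes a constant, with equality at y.\<close>
    let ?a = "x - y"
    have "\<forall>\<^sub>F z in nhds y. V x - \<phi> x \<le> V (z + ?a) - \<phi> (z + ?a)"
    proof -
      have "((\<lambda>z. z + ?a) \<longlongrightarrow> x) (nhds y)" by (auto intro!: tendsto_eq_intros filterlim_ident)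
      then show ?thesis by (rule eventually_compose_filterlim[OF ev])
    qed
    moreover have "\<forall>\<^sub>F z in nhds y. z \<in> \<Omega>" using y\<Omega> \<Omega>(1) by (rule eventually_nhds_in_open[rotated])
    ultimately have "\<forall>\<^sub>F z in nhds y. v z - \<phi> (z + ?a) \<ge> v y - \<phi> (y + ?a)"
    proof eventually_elim
      case (elim z)
      have "V (z + ?a) \<le> v z + \<alpha> * (norm ?a)\<^sup>2" using V_le[of z "z + ?a"] elim \<Omega>S by auto
      then show ?case using elim y(2) by simp
    qed
    moreover have "C2_near y (\<lambda>z. \<phi> (z + ?a)) X" using C2_near_shift[OF \<phi>, of ?a] by simp
    ultimately have "Pplus k X \<le> f y" using super y\<Omega> unfolding viscosity_supersolution_def by blast
    moreover have "dist (f y) (f x) < \<eta>" using df(2)[OF xK yK] xy \<delta>(3) by (simp add: dist_commute)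
    ultimately show ?thesis by (simp add: dist_real_def)
  qed
  have e4: "e / 4 > 0" using e by simp
  have KD: "K (e / 4) \<subseteq> D" using K\<Omega>[OF e4] e by (auto simp: D_def K_def)
  have cD: "continuous_on D (\<lambda>x. f x + \<eta>)"
    by (intro continuous_intros continuous_on_subset[OF f]) (auto simp: D_def)
  have "\<exists>W U G H. C2_on U W G H \<and> K (e / 4) \<subseteq> U \<and>
      (\<forall>y\<in>K (e / 4). \<bar>W y - V y\<bar> \<le> \<eta> \<and> Pplus k (H y) \<le> (f y + \<eta>) + \<eta>)"
    by (rule mollified_supersolution[OF k cV oD cK KD cD \<eta>(1)]) (rule visc)
  then obtain W U G H where W: "C2_on U W G H" "K (e / 4) \<subseteq> U"
    "\<And>y. y \<in> K (e / 4) \<Longrightarrow> \<bar>W y - V y\<bar> \<le> \<eta> \<and> Pplus k (H y) \<le> f y + \<eta> + \<eta>"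
    by blast
  have inK: "x \<in> K (e / 2)" if x: "x \<in> ?S" "w x - V x \<ge> m / 2" for x
  proof (rule ccontr)
    assume "x \<notin> K (e / 2)"
    then have 1: "infdist x ?F < e / 2" using x by (simp add: K_def)
    obtain y where y: "y \<in> ?S" "V x = v y + \<alpha> * (norm (x - y))\<^sup>2" using V_att by blast
    have "dist x y < e / 2" using close[OF x(1) y] \<delta>(2) e by simp
    from boundary[OF x(1) y(1) 1 this] have "w x - v y < m / 2" .
    moreover have "v y \<le> V x" using y(2) \<alpha> by simp
    ultimately show False using x(2) by simp
  qed
  have KK: "K (e / 2) \<subseteq> K (e / 4)" using e by (auto simp: K_def)
  have x1S: "x1 \<in> ?S" using x1 \<Omega>S by blast
  have wV: "w x1 - V x1 \<ge> m" using wx1 Vv[OF x1S] by simp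
  have x1K: "x1 \<in> K (e / 4)" using inK[OF x1S] wV m KK by auto
  have uK: "usc_on (K (e / 4)) (\<lambda>x. w x + - W x)"
    by (intro usc_on_add_continuous usc_on_subset[OF wusc] continuous_intros continuous_on_subset[OF C2_on_continuous[OF W(1)]] W(2))
       (auto simp: K_def)
  then obtain x where x: "x \<in> K (e / 4)" "\<And>y. y \<in> K (e / 4) \<Longrightarrow> w y + - W y \<le> w x + - W x"
    using usc_on_attains_sup[OF cK _ uK] x1K by blast
  have "w x - V x \<ge> m / 2" using x(2)[OF x1K] wV W(3)[OF x1K] W(3)[OF x(1)] \<eta>(3) m by (auto simp: abs_le_iff)
  then have xK: "x \<in> K (e / 2)" using inK x(1) by (auto simp: K_def)
  have x\<Omega>: "x \<in> \<Omega>" using K\<Omega>[of "e / 2"] xK e by auto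
  have xU: "x \<in> U" using x(1) W(2) by blast
  have \<phi>2: "C2_on U (\<lambda>y. W y - \<epsilon> * (norm (y - 0))\<^sup>2) (\<lambda>y. G y - \<epsilon> *\<^sub>R (2 *\<^sub>R (y - 0))) (\<lambda>y. H y - \<epsilon> *\<^sub>R (2 *\<^sub>R mat 1))"
    by (intro C2_on_diff W(1) C2_on_scale C2_on_subset[OF C2_on_dist] C2_onD(1)[OF W(1)]) auto
  have "open {y \<in> \<Omega>. e / 4 < infdist y ?F}"
  proof -
    have "{y \<in> \<Omega>. e / 4 < infdist y ?F} = \<Omega> \<inter> {x. e / 4 < infdist x ?F}" by auto
    moreover have "open {x. e / 4 < infdist x ?F}" by (intro open_Collect_less cinf continuous_on_const)
    ultimately show ?thesis using \<Omega>(1) by auto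
  qed
  moreover have "x \<in> {y \<in> \<Omega>. e / 4 < infdist y ?F}" using x\<Omega> xK e by (auto simp: K_def)
  ultimately have "\<forall>\<^sub>F y in nhds x. y \<in> {y \<in> \<Omega>. e / 4 < infdist y ?F}" by (rule eventually_nhds_in_open)
  then have "\<forall>\<^sub>F y in nhds x. u y - (W y - \<epsilon> * (norm (y - 0))\<^sup>2) \<le> u x - (W x - \<epsilon> * (norm (x - 0))\<^sup>2)"
  proof eventually_elim
    case (elim y)
    then have "y \<in> K (e / 4)" using \<Omega>S by (auto simp: K_def)
    from x(2)[OF this] show ?case by (simp add: w_def algebra_simps)
  qed
  then have "f x \<le> Pplus k (H x - \<epsilon> *\<^sub>R (2 *\<^sub>R mat 1))"
    using sub x\<Omega> C2_on_near[OF \<phi>2 xU] unfolding viscosity_subsolution_def by blast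
  also have "\<dots> = Pplus k (H x) - 2 * k * \<epsilon>"
    using Pplus_add_id[OF C2_on_symmetric[OF W(1) xU] k, of "- 2 * \<epsilon>"] by (simp add: mult_ac)
  also have "\<dots> < f x"
  proof -
    have "k * \<epsilon> > 0" using k \<epsilon> by simp
    then show ?thesis using W(3)[OF x(1)] \<eta>(2) by (simp add: mult_ac)
  qed
  finally show False by simp
qed

section \<open>Perron's method\<close>

lemma isCont_eventually_gt:
  fixes g :: "'a::t2_space \<Rightarrow> real"
  assumes "isCont g x" "c < g x" shows "\<forall>\<^sub>F z in nhds x. c < g z"
  using assms order_tendstoD(1)[of g "g x" "nhds x" c] by (simp add: isCont_def tendsto_nhds_iff)

lemma isCont_eventually_lt:
  fixes g :: "'a::t2_space \<Rightarrow> real"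
  assumes "isCont g x" "g x < c" shows "\<forall>\<^sub>F z in nhds x. g z < c"
  using assms order_tendstoD(2)[of g "g x" "nhds x" c] by (simp add: isCont_def tendsto_nhds_iff)

text \<open>The smallest upper semicontinuous majorant, as an infimum of local upper bounds. Lower
  envelopes are obtained by changing the sign twice.\<close>

definition usc_env :: "'a::metric_space set \<Rightarrow> ('a \<Rightarrow> real) \<Rightarrow> 'a \<Rightarrow> real" where
  "usc_env S g x = Inf {c. \<exists>d>0. \<forall>y\<in>S. dist y x < d \<longrightarrow> g y \<le> c}"

context
  fixes S :: "'a::metric_space set" and g :: "'a \<Rightarrow> real" and M :: real
  assumes bd: "\<And>x. x \<in> S \<Longrightarrow> \<bar>g x\<bar> \<le> M"
begin

lemma usc_env_bdd: "x \<in> S \<Longrightarrow> bdd_below {c. \<exists>d>0. \<forall>y\<in>S. dist y x < d \<longrightarrow> g y \<le> c}"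
  by (rule bdd_belowI[of _ "g x"]) auto

lemma usc_env_ne: "{c. \<exists>d>0. \<forall>y\<in>S. dist y x < d \<longrightarrow> g y \<le> c} \<noteq> {}"
proof -
  have "\<forall>y\<in>S. dist y x < 1 \<longrightarrow> g y \<le> M" using bd by (auto simp: abs_le_iff)
  then show ?thesis using zero_less_one by blast
qed

lemma usc_env_ge: "x \<in> S \<Longrightarrow> g x \<le> usc_env S g x"
  unfolding usc_env_def by (rule cInf_greatest[OF usc_env_ne]) auto

lemma usc_env_le: "x \<in> S \<Longrightarrow> d > 0 \<Longrightarrow> (\<And>y. y \<in> S \<Longrightarrow> dist y x < d \<Longrightarrow> g y \<le> c) \<Longrightarrow> usc_env S g x \<le> c"
  unfolding usc_env_def by (rule cInf_lower[OF _ usc_env_bdd]) auto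

lemma usc_env_approx:
  assumes "x \<in> S" "d > 0" "c < usc_env S g x"
  shows "\<exists>y\<in>S. dist y x < d \<and> c < g y"
  using usc_env_le[OF assms(1,2), of c] assms(3) by force

lemma usc_env_less:
  assumes "usc_env S g x < c"
  shows "\<exists>d>0. \<exists>c'<c. \<forall>y\<in>S. dist y x < d \<longrightarrow> g y \<le> c'"
  using cInf_lessD[OF usc_env_ne assms[unfolded usc_env_def]] by auto

lemma usc_env_bounded: "x \<in> S \<Longrightarrow> \<bar>usc_env S g x\<bar> \<le> M"
  using usc_env_le[of x 1 M] usc_env_ge[of x] bd by (fastforce simp: abs_le_iff)

lemma usc_env_usc: "usc_on S (usc_env S g)"
proof (rule usc_onI)
  fix x c assume "x \<in> S" "usc_env S g x < c"
  then obtain d c' where d: "d > 0" "c' < c" "\<And>y. y \<in> S \<Longrightarrow> dist y x < d \<Longrightarrow> g y \<le> c'"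
    using usc_env_less by blast
  have "usc_env S g y < c" if y: "y \<in> S" "dist y x < d" for y
  proof -
    have "usc_env S g y \<le> c'"
    proof (rule usc_env_le[OF y(1), of "d - dist y x"])
      fix z assume "z \<in> S" "dist z y < d - dist y x"
      then show "g z \<le> c'" using dist_triangle[of z x y] by (intro d(3)) auto
    qed (use y in simp)
    then show ?thesis using d(2) by simp
  qed
  then show "\<exists>d>0. \<forall>y\<in>S. dist y x < d \<longrightarrow> usc_env S g y < c" using d(1) by blast
qed

lemma usc_env_le_usc:
  assumes "usc_on S \<psi>" "\<And>x. x \<in> S \<Longrightarrow> g x \<le> \<psi> x" "x \<in> S"
  shows "usc_env S g x \<le> \<psi> x"
proof (rule field_le_epsilon)
  fix e :: real assume "e > 0"
  then obtain d where d: "d > 0" "\<And>y. y \<in> S \<Longrightarrow> dist y x < d \<Longrightarrow> \<psi> y < \<psi> x + e"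
    using usc_on_ball[OF assms(1,3), of "\<psi> x + e"] by auto
  show "usc_env S g x \<le> \<psi> x + e"
    by (rule usc_env_le[OF assms(3) d(1)]) (use d(2) assms(2) in \<open>fastforce intro: order_trans less_imp_le\<close>)
qed

end

text \<open>Gathers in one ball the facts that the next proof uses. The choice of \<delta> lets the
  added Hessian consume half of the gap at x0, and continuity keeps the other half positive
  nearby.\<close>

lemma Pplus_perturbed_near:
  fixes \<phi> f :: "real^'n \<Rightarrow> real"
  assumes k: "1 \<le> k" "k \<le> CARD('n)" and \<Omega>: "open \<Omega>" and f: "continuous_on \<Omega> f"
    and x0: "x0 \<in> \<Omega>" "x0 \<in> U" and C: "C2_on U \<phi> G H" and lt: "Pplus k (H x0) < f x0" and ev: "\<forall>\<^sub>F y in nhds x0. Q y"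
  shows "\<exists>s \<delta>. s > 0 \<and> \<delta> > 0 \<and> (\<forall>z\<in>cball x0 s. z \<in> \<Omega> \<and> z \<in> U \<and> Q z \<and> Pplus k (H z + \<delta> *\<^sub>R (2 *\<^sub>R mat 1)) < f z)"
proof -
  define \<delta> where "\<delta> = (f x0 - Pplus k (H x0)) / (4 * k)"
  have \<delta>: "\<delta> > 0" using lt k by (simp add: \<delta>_def)
  let ?g = "\<lambda>z. f z - (Pplus k (H z) + k * (2 * \<delta>))"
  have U: "open U" by (rule C2_onD(1)[OF C])
  have "continuous_on (\<Omega> \<inter> U) ?g"
    by (intro continuous_intros continuous_on_subset[OF f] continuous_on_subset[OF C2_on_Pplus_continuous[OF C k]]) auto
  moreover have "open (\<Omega> \<inter> U)" "x0 \<in> \<Omega> \<inter> U" using \<Omega> U x0 by auto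
  ultimately have "isCont ?g x0" by (simp add: continuous_on_eq_continuous_at)
  moreover have "?g x0 > 0"
  proof -
    have "k * (2 * \<delta>) = (f x0 - Pplus k (H x0)) / 2" using k by (simp add: \<delta>_def)
    then show ?thesis using lt by simp
  qed
  ultimately have "\<forall>\<^sub>F z in nhds x0. 0 < ?g z" by (rule isCont_eventually_gt)
  moreover have "\<forall>\<^sub>F z in nhds x0. z \<in> \<Omega> \<inter> U" using \<open>open (\<Omega> \<inter> U)\<close> \<open>x0 \<in> \<Omega> \<inter> U\<close> by (rule eventually_nhds_in_open)
  ultimately have "\<forall>\<^sub>F z in nhds x0. z \<in> \<Omega> \<and> z \<in> U \<and> Q z \<and> Pplus k (H z + \<delta> *\<^sub>R (2 *\<^sub>R mat 1)) < f z"
    using ev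
  proof eventually_elim
    case (elim z)
    have "Pplus k (H z + (2 * \<delta>) *\<^sub>R mat 1) = Pplus k (H z) + k * (2 * \<delta>)"
      by (rule Pplus_add_id[OF C2_on_symmetric[OF C] k]) (use elim in blast)
    then show ?case using elim by (simp add: mult.commute)
  qed
  then obtain d where d: "d > 0" "\<And>z. dist z x0 < d \<Longrightarrow> z \<in> \<Omega> \<and> z \<in> U \<and> Q z \<and> Pplus k (H z + \<delta> *\<^sub>R (2 *\<^sub>R mat 1)) < f z"
    unfolding eventually_nhds_metric by blast
  show ?thesis using d \<delta> by (intro exI[of _ "d / 2"] exI[of _ \<delta>]) (auto simp: dist_commute)
qed

text \<open>The envelope at x0 need not be approached at x0 itself, so a member w of the family is
  taken that almost attains it at a nearby y. Adding \<delta> |y - x0|^2 makes the contact strict;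
  this drives the maximum of w minus the test function into the open ball and gives a genuine test
  for w.\<close>

lemma subsolution_sup_env:
  fixes f :: "real^'n \<Rightarrow> real"
  assumes k: "1 \<le> k" "k \<le> CARD('n)" and \<Omega>: "open \<Omega>" "\<Omega> \<subseteq> S" and f: "continuous_on \<Omega> f"
    and F: "\<And>w. w \<in> F \<Longrightarrow> usc_on S w \<and> viscosity_subsolution k f \<Omega> w" and F_le: "\<And>w x. w \<in> F \<Longrightarrow> x \<in> S \<Longrightarrow> w x \<le> U x"
    and F_approx: "\<And>x c. x \<in> S \<Longrightarrow> c < U x \<Longrightarrow> \<exists>w\<in>F. c < w x" and bd: "\<And>x. x \<in> S \<Longrightarrow> \<bar>U x\<bar> \<le> M"
  shows "viscosity_subsolution k f \<Omega> (usc_env S U)"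
  unfolding viscosity_subsolution_def
proof (intro conjI ballI allI impI)
  show "usc_on \<Omega> (usc_env S U)" using usc_env_usc[of S U M] bd \<Omega>(2) usc_on_subset by blast
  fix x0 \<phi> X
  assume x0: "x0 \<in> \<Omega>" and "C2_near x0 \<phi> X \<and> (\<forall>\<^sub>F y in nhds x0. usc_env S U y - \<phi> y \<le> usc_env S U x0 - \<phi> x0)"
  then have \<phi>: "C2_near x0 \<phi> X" and ev: "\<forall>\<^sub>F y in nhds x0. usc_env S U y - \<phi> y \<le> usc_env S U x0 - \<phi> x0" by auto
  obtain V G H where V: "x0 \<in> V" "C2_on V \<phi> G H" "H x0 = X" using \<phi> unfolding C2_near_iff by blast
  let ?E = "usc_env S U"
  show "f x0 \<le> Pplus k X"
  proof (rule ccontr)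
    assume "\<not> f x0 \<le> Pplus k X"
    then have "Pplus k (H x0) < f x0" using V(3) by simp
    then obtain s \<delta> where s: "s > 0" "\<delta> > 0"
      and B: "\<And>z. z \<in> cball x0 s \<Longrightarrow> z \<in> \<Omega> \<and> z \<in> V \<and> ?E z - \<phi> z \<le> ?E x0 - \<phi> x0 \<and> Pplus k (H z + \<delta> *\<^sub>R (2 *\<^sub>R mat 1)) < f z"
      using Pplus_perturbed_near[OF k \<Omega>(1) f x0 V(1,2) _ ev] by blast
    define \<phi>' where "\<phi>' y = \<phi> y + \<delta> * (norm (y - x0))\<^sup>2" for y
    have \<phi>'2: "C2_on V \<phi>' (\<lambda>y. G y + \<delta> *\<^sub>R (2 *\<^sub>R (y - x0))) (\<lambda>y. H y + \<delta> *\<^sub>R (2 *\<^sub>R mat 1))"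
      unfolding \<phi>'_def[abs_def]
      by (intro C2_on_add V(2) C2_on_scale C2_on_subset[OF C2_on_dist] C2_onD(1)[OF V(2)]) auto
    \<comment> \<open>The losses from w y and from the continuity of \<phi>' are at most \<tau>
      each, and 2 \<tau> is half of the penalty \<delta> s^2 on the sphere of radius s.\<close>
    define \<tau> where "\<tau> = \<delta> * s\<^sup>2 / 4"
    have \<tau>: "\<tau> > 0" using s by (simp add: \<tau>_def)
    have "isCont \<phi>' x0" using C2_on_continuous[OF \<phi>'2] C2_onD(1)[OF \<phi>'2] V(1) by (simp add: continuous_on_eq_continuous_at)
    then obtain d where d: "d > 0" "\<And>y. dist y x0 < d \<Longrightarrow> dist (\<phi>' y) (\<phi>' x0) < \<tau>"
      using \<tau> unfolding continuous_at_eps_delta by blast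
    have x0S: "x0 \<in> S" using x0 \<Omega>(2) by blast
    obtain y where y: "y \<in> S" "dist y x0 < min d s" "?E x0 - \<tau> < U y"
      using usc_env_approx[of S U M x0 "min d s" "?E x0 - \<tau>"] bd x0S d(1) s \<tau> by auto
    obtain w where w: "w \<in> F" "?E x0 - \<tau> < w y" using F_approx[OF y(1,3)] by blast
    have cS: "cball x0 s \<subseteq> S" using B \<Omega>(2) by blast
    have "usc_on (cball x0 s) (\<lambda>z. w z + - \<phi>' z)"
      using F[OF w(1)] cS B
      by (intro usc_on_add_continuous continuous_intros continuous_on_subset[OF C2_on_continuous[OF \<phi>'2]]) (auto intro: usc_on_subset)
    then obtain z where z: "z \<in> cball x0 s" "\<And>z'. z' \<in> cball x0 s \<Longrightarrow> w z' + - \<phi>' z' \<le> w z + - \<phi>' z"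
      using usc_on_attains_sup[of "cball x0 s" "\<lambda>z. w z + - \<phi>' z"] s(1) by auto
    have "dist (\<phi>' y) (\<phi>' x0) < \<tau>" using y d by auto
    then have "w z - \<phi>' z > ?E x0 - \<phi> x0 - 2 * \<tau>"
      using z(2)[of y] y w by (auto simp: dist_real_def \<phi>'_def[of x0] dist_commute)
    moreover have "w z - \<phi>' z \<le> ?E x0 - \<phi> x0 - \<delta> * (norm (z - x0))\<^sup>2"
    proof -
      have zS: "z \<in> S" using z cS by auto
      have "w z \<le> ?E z" using F_le[OF w(1) zS] usc_env_ge[of S U M z] bd zS by auto
      then show ?thesis using B[OF z(1)] by (simp add: \<phi>'_def)
    qed
    ultimately have "\<delta> * (norm (z - x0))\<^sup>2 < \<delta> * (s\<^sup>2 / 2)" by (simp add: \<tau>_def)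
    then have "(norm (z - x0))\<^sup>2 < s\<^sup>2 / 2" using s by simp
    also have "\<dots> \<le> s\<^sup>2" by simp
    finally have "norm (z - x0) < s" using s by (simp add: power_less_imp_less_base)
    then have "z \<in> ball x0 s" by (simp add: dist_norm norm_minus_commute)
    then have "\<forall>\<^sub>F y in nhds z. y \<in> ball x0 s" by (intro eventually_nhds_in_open) auto
    then have "\<forall>\<^sub>F y in nhds z. w y - \<phi>' y \<le> w z - \<phi>' z"
      by eventually_elim (use z(2) in fastforce)
    then have "f z \<le> Pplus k (H z + \<delta> *\<^sub>R (2 *\<^sub>R mat 1))"
      using F[OF w(1)] C2_on_near[OF \<phi>'2, of z] B[OF z(1)] unfolding viscosity_subsolution_def by blast
    then show False using B[OF z(1)] by simp
  qed
qed

lemma viscosity_supersolution_cong: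
  assumes "viscosity_supersolution k f \<Omega> L" "open \<Omega>" and eq: "\<And>x. x \<in> \<Omega> \<Longrightarrow> u x = L x"
  shows "viscosity_supersolution k f \<Omega> u"
  unfolding viscosity_supersolution_def
proof (intro conjI ballI allI impI)
  show "lsc_on \<Omega> u" unfolding lsc_on_def
  proof (intro ballI allI impI)
    fix x c assume x: "x \<in> \<Omega>" "c < u x"
    have "\<forall>\<^sub>F y in at x within \<Omega>. c < L y" using assms(1) x eq by (auto simp: viscosity_supersolution_def lsc_on_def)
    moreover have "\<forall>\<^sub>F y in at x within \<Omega>. y \<in> \<Omega>" by (simp add: eventually_at_filter)
    ultimately show "\<forall>\<^sub>F y in at x within \<Omega>. c < u y" by eventually_elim (simp add: eq)
  qed
  fix x \<phi> X assume x: "x \<in> \<Omega>" and a: "C2_near x \<phi> X \<and> (\<forall>\<^sub>F y in nhds x. u x - \<phi> x \<le> u y - \<phi> y)"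
  have "\<forall>\<^sub>F y in nhds x. y \<in> \<Omega>" using x assms(2) by (rule eventually_nhds_in_open[rotated])
  then have "\<forall>\<^sub>F y in nhds x. L x - \<phi> x \<le> L y - \<phi> y"
    using a[THEN conjunct2] by eventually_elim (simp add: eq x)
  then show "Pplus k X \<le> f x" using assms(1) x a unfolding viscosity_supersolution_def by blast
qed

definition dirichlet_subsolutions :: "nat \<Rightarrow> (real^'n \<Rightarrow> real) \<Rightarrow> (real^'n) set \<Rightarrow> (real^'n \<Rightarrow> real) set" where
  "dirichlet_subsolutions k f \<Omega> = {w. usc_on (closure \<Omega>) w \<and> viscosity_subsolution k f \<Omega> w \<and> (\<forall>x\<in>frontier \<Omega>. w x \<le> 0)}"

text \<open>The bump argument. If the lower envelope L failed the test at x0, the test function,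
  bent down by a quadratic and lifted by \<tau>, would be a classical strict subsolution near x0
  that exceeds L at x0 and lies below u away from x0. Its maximum with u is again an admissible
  subsolution, so maximality keeps u above L x0 + \<tau> / 2 near x0, which contradicts the
  definition of L.\<close>

lemma maximal_subsolution_env_supersolution:
  fixes f :: "real^'n \<Rightarrow> real"
  assumes k: "1 \<le> k" "k \<le> CARD('n)" and \<Omega>: "open \<Omega>" and f: "continuous_on \<Omega> f"
    and u: "u \<in> dirichlet_subsolutions k f \<Omega>" and u_max: "\<And>w x. w \<in> dirichlet_subsolutions k f \<Omega> \<Longrightarrow> x \<in> closure \<Omega> \<Longrightarrow> w x \<le> u x"
    and bd: "\<And>x. x \<in> closure \<Omega> \<Longrightarrow> \<bar>u x\<bar> \<le> M"
  shows "viscosity_supersolution k f \<Omega> (\<lambda>x. - usc_env (closure \<Omega>) (\<lambda>x. - u x) x)"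
  unfolding viscosity_supersolution_def
proof (intro conjI ballI allI impI)
  let ?S = "closure \<Omega>"
  let ?g = "\<lambda>x. - u x"
  define L where "L x = - usc_env ?S ?g x" for x
  have bd': "\<bar>?g x\<bar> \<le> M" if "x \<in> ?S" for x using bd[OF that] by simp
  have \<Omega>S: "\<Omega> \<subseteq> ?S" by (rule closure_subset)
  have Lu: "L x \<le> u x" if "x \<in> ?S" for x using usc_env_ge[of ?S ?g M x] bd' that by (simp add: L_def)
  have "usc_on ?S (usc_env ?S ?g)" using usc_env_usc[of ?S ?g M] bd' by simp
  then show "lsc_on \<Omega> (\<lambda>x. - usc_env ?S ?g x)" using lsc_on_subset \<Omega>S by (auto simp: usc_on_iff_lsc_on)
  fix x0 \<phi> X
  assume x0: "x0 \<in> \<Omega>" and "C2_near x0 \<phi> X \<and> (\<forall>\<^sub>F y in nhds x0. - usc_env ?S ?g x0 - \<phi> x0 \<le> - usc_env ?S ?g y - \<phi> y)"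
  then have \<phi>: "C2_near x0 \<phi> X" and ev: "\<forall>\<^sub>F y in nhds x0. L x0 - \<phi> x0 \<le> L y - \<phi> y" by (auto simp: L_def)
  obtain V G H where V: "x0 \<in> V" "C2_on V \<phi> G H" "H x0 = X" using \<phi> unfolding C2_near_iff by blast
  show "Pplus k X \<le> f x0"
  proof (rule ccontr)
    assume gt: "\<not> Pplus k X \<le> f x0"
    define \<delta> where "\<delta> = (Pplus k X - f x0) / (4 * k)"
    have \<delta>: "\<delta> > 0" using gt k by (simp add: \<delta>_def)
    define \<psi> where "\<psi> y = \<phi> y - \<delta> * (norm (y - x0))\<^sup>2" for y
    define H' where "H' y = H y - \<delta> *\<^sub>R (2 *\<^sub>R mat 1)" for y
    have \<psi>2: "C2_on V \<psi> (\<lambda>y. G y - \<delta> *\<^sub>R (2 *\<^sub>R (y - x0))) H'"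
      unfolding \<psi>_def[abs_def] H'_def[abs_def]
      by (intro C2_on_diff V(2) C2_on_scale C2_on_subset[OF C2_on_dist] C2_onD(1)[OF V(2)]) auto
    have PH: "Pplus k (H' x0) > f x0"
    proof -
      have "Pplus k (H' x0) = Pplus k X - 2 * k * \<delta>"
        using Pplus_add_id[OF C2_on_symmetric[OF V(2,1)] k, of "- 2 * \<delta>"] by (simp add: H'_def V(3) mult_ac)
      moreover have "2 * k * \<delta> = (Pplus k X - f x0) / 2" using k by (simp add: \<delta>_def)
      ultimately show ?thesis using gt by simp
    qed
    have "continuous_on (\<Omega> \<inter> V) (\<lambda>z. Pplus k (H' z) - f z)"
      by (intro continuous_intros continuous_on_subset[OF f] continuous_on_subset[OF C2_on_Pplus_continuous[OF \<psi>2 k]]) auto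
    moreover have oV: "open (\<Omega> \<inter> V)" "x0 \<in> \<Omega> \<inter> V" using \<Omega> C2_onD(1)[OF V(2)] x0 V(1) by auto
    ultimately have "isCont (\<lambda>z. Pplus k (H' z) - f z) x0" by (simp add: continuous_on_eq_continuous_at)
    then have "\<forall>\<^sub>F z in nhds x0. 0 < Pplus k (H' z) - f z"
      by (rule isCont_eventually_gt) (use PH in simp)
    moreover have "\<forall>\<^sub>F z in nhds x0. z \<in> \<Omega> \<inter> V" using oV by (rule eventually_nhds_in_open)
    ultimately have "\<forall>\<^sub>F z in nhds x0. z \<in> \<Omega> \<and> z \<in> V \<and> Pplus k (H' z) > f z \<and> L x0 - \<phi> x0 \<le> L z - \<phi> z"
      using ev by eventually_elim auto
    then obtain s where s: "s > 0" and B: "\<And>z. dist z x0 < s \<Longrightarrow> z \<in> \<Omega> \<and> z \<in> V \<and> Pplus k (H' z) > f z \<and> L x0 - \<phi> x0 \<le> L z - \<phi> z"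
      unfolding eventually_nhds_metric by blast
    \<comment> \<open>This is \<delta> (s / 2)^2: outside the ball of radius s / 2 the quadratic
      drop exceeds the lift, so the glued function agrees with u on a whole annulus and stays upper
      semicontinuous.\<close>
    define \<tau> where "\<tau> = \<delta> * s\<^sup>2 / 4"
    have \<tau>: "\<tau> > 0" using \<delta> s by (simp add: \<tau>_def)
    define h where "h y = \<psi> y + (L x0 - \<phi> x0 + \<tau>)" for y
    have h2: "C2_on V h (\<lambda>y. (G y - \<delta> *\<^sub>R (2 *\<^sub>R (y - x0))) + 0) (\<lambda>y. H' y + 0)"
      unfolding h_def[abs_def] by (intro C2_on_add \<psi>2 C2_on_subset[OF C2_on_const] C2_onD(1)[OF V(2)]) auto
    have h_out: "h z < u z" if z: "dist z x0 < s" "s / 2 < dist z x0" for z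
    proof -
      have "(s / 2)\<^sup>2 < (norm (z - x0))\<^sup>2" using z(2) s by (intro power_strict_mono) (auto simp: dist_norm)
      then have "\<delta> * (s / 2)\<^sup>2 < \<delta> * (norm (z - x0))\<^sup>2" using \<delta> by simp
      moreover have "\<delta> * (s / 2)\<^sup>2 = \<tau>" by (simp add: \<tau>_def power2_eq_square)
      ultimately have "\<tau> < \<delta> * (norm (z - x0))\<^sup>2" by simp
      moreover have "z \<in> ?S" using B[OF z(1)] \<Omega>S by blast
      ultimately show ?thesis using B[OF z(1)] Lu[of z] by (simp add: h_def \<psi>_def)
    qed
    define w where "w z = (if dist z x0 < s then max (u z) (h z) else u z)" for z
    have uw: "u z \<le> w z" for z by (simp add: w_def)
    have w_out: "w z = u z" if "s / 2 < dist z x0" for z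
      using h_out[OF _ that] by (auto simp: w_def max_def)
    have u_usc: "usc_on ?S u" and u_sub: "viscosity_subsolution k f \<Omega> u" and u_fr: "\<And>x. x \<in> frontier \<Omega> \<Longrightarrow> u x \<le> 0"
      using u by (auto simp: dirichlet_subsolutions_def)
    have hc: "isCont h z" if "dist z x0 < s" for z
      using C2_on_continuous[OF h2] C2_onD(1)[OF h2] B[OF that] by (simp add: continuous_on_eq_continuous_at)
    have "w \<in> dirichlet_subsolutions k f \<Omega>"
      unfolding dirichlet_subsolutions_def mem_Collect_eq
    proof (intro conjI ballI)
      fix x assume x: "x \<in> frontier \<Omega>"
      then have "x \<notin> \<Omega>" using \<Omega> by (simp add: frontier_def interior_open)
      then have "\<not> dist x x0 < s" using B by blast
      then show "w x \<le> 0" using u_fr[OF x] by (simp add: w_def)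
    next
      show usc: "usc_on ?S w"
      proof (rule usc_onI)
        fix x c assume x: "x \<in> ?S" "w x < c"
        obtain d1 where d1: "d1 > 0" "\<And>y. y \<in> ?S \<Longrightarrow> dist y x < d1 \<Longrightarrow> u y < c"
          using usc_on_ball[OF u_usc x(1), of c] x(2) uw[of x] by auto
        show "\<exists>d>0. \<forall>y\<in>?S. dist y x < d \<longrightarrow> w y < c"
        proof (cases "dist x x0 < s")
          case True
          then have "h x < c" using x(2) by (simp add: w_def)
          then have "\<forall>\<^sub>F y in nhds x. h y < c"
            using hc[OF True] by (intro isCont_eventually_lt)
          then obtain d2 where d2: "d2 > 0" "\<And>y. dist y x < d2 \<Longrightarrow> h y < c" unfolding eventually_nhds_metric by blast
          have "w y < c" if "y \<in> ?S" "dist y x < min d1 d2" for y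
            using d1(2)[of y] d2(2)[of y] that by (simp add: w_def)
          then show ?thesis using d1(1) d2(1) by (intro exI[of _ "min d1 d2"]) auto
        next
          case False
          have "w y < c" if y: "y \<in> ?S" "dist y x < min d1 (s / 2)" for y
          proof -
            have "s / 2 < dist y x0" using False y dist_triangle[of x x0 y] by (simp add: dist_commute)
            then show ?thesis using w_out[of y] d1(2)[of y] y by simp
          qed
          then show ?thesis using d1(1) s by (intro exI[of _ "min d1 (s / 2)"]) auto
        qed
      qed
      show "viscosity_subsolution k f \<Omega> w"
        unfolding viscosity_subsolution_def
      proof (intro conjI ballI allI impI)
        show "usc_on \<Omega> w" using usc usc_on_subset \<Omega>S by blast
        fix z \<theta> Y assume z: "z \<in> \<Omega>" and "C2_near z \<theta> Y \<and> (\<forall>\<^sub>F y in nhds z. w y - \<theta> y \<le> w z - \<theta> z)"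
        then have \<theta>: "C2_near z \<theta> Y" and ev: "\<forall>\<^sub>F y in nhds z. w y - \<theta> y \<le> w z - \<theta> z" by auto
        show "f z \<le> Pplus k Y"
        \<comment> \<open>Where w agrees with u, a test function for w also tests u. Elsewhere w is
          the smooth function h, and the second order condition applies to \<theta> - h.\<close>
        proof (cases "w z = u z")
          case True
          have "\<forall>\<^sub>F y in nhds z. u y - \<theta> y \<le> u z - \<theta> z"
            using ev
          proof eventually_elim
            case (elim y)
            then show ?case using uw[of y] True by simp
          qed
          then show ?thesis using u_sub z \<theta> unfolding viscosity_subsolution_def by blast
        next
          case False
          then have dz: "dist z x0 < s" and wz: "w z = h z" by (auto simp: w_def max_def split: if_splits)
          obtain U' G' H'' where \<theta>2: "z \<in> U'" "C2_on U' \<theta> G' H''" "H'' z = Y" using \<theta> unfolding C2_near_iff by blast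
          have o: "open (U' \<inter> V)" and zin: "z \<in> U' \<inter> V" using C2_onD(1)[OF \<theta>2(2)] C2_onD(1)[OF h2] \<theta>2(1) B[OF dz] by auto
          have D: "C2_on (U' \<inter> V) (\<lambda>y. \<theta> y - h y) (\<lambda>y. G' y - ((G y - \<delta> *\<^sub>R (2 *\<^sub>R (y - x0))) + 0)) (\<lambda>y. H'' y - (H' y + 0))"
            by (intro C2_on_diff C2_on_subset[OF \<theta>2(2) o] C2_on_subset[OF h2 o]) auto
          have "\<forall>\<^sub>F y in nhds z. y \<in> ball x0 s" using dz by (intro eventually_nhds_in_open) (auto simp: dist_commute)
          then have "\<forall>\<^sub>F y in nhds z. \<theta> z - h z \<le> \<theta> y - h y"
            using ev
          proof eventually_elim
            case (elim y)
            then have "h y \<le> w y" by (simp add: w_def dist_commute)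
            then show ?case using elim wz by simp
          qed
          then have "0 \<le> v \<bullet> ((H'' z - (H' z + 0)) *v v)" for v by (rule C2_on_local_min[OF D zin])
          then have "v \<bullet> (H' z *v v) \<le> v \<bullet> (Y *v v)" for v
            by (simp add: \<theta>2(3) matrix_vector_mult_diff_rdistrib inner_diff_right)
          then have "Pplus k (H' z) \<le> Pplus k Y"
            using C2_on_symmetric[OF \<psi>2, of z] zin C2_near_symmetric[OF \<theta>] by (intro Pplus_mono k) auto
          then show ?thesis using B[OF dz] by simp
        qed
      qed
    qed
    then have wu: "w x \<le> u x" if "x \<in> ?S" for x using u_max that by blast
    have "h x0 = L x0 + \<tau>" by (simp add: h_def \<psi>_def)
    then have "\<forall>\<^sub>F y in nhds x0. L x0 + \<tau> / 2 < h y"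
      using hc[of x0] s \<tau> by (intro isCont_eventually_gt) auto
    then obtain d where d: "d > 0" "\<And>y. dist y x0 < d \<Longrightarrow> L x0 + \<tau> / 2 < h y" unfolding eventually_nhds_metric by blast
    have "usc_env ?S ?g x0 \<le> - L x0 - \<tau> / 2"
    proof (rule usc_env_le[of ?S ?g M])
      show "x0 \<in> ?S" using x0 \<Omega>S by blast
      show "min d s > 0" using d(1) s by simp
      fix y assume y: "y \<in> ?S" "dist y x0 < min d s"
      have "h y \<le> w y" using y by (simp add: w_def)
      then show "- u y \<le> - L x0 - \<tau> / 2" using wu[OF y(1)] d(2)[of y] y(2) by simp
    qed (use bd' in auto)
    then show False using \<tau> by (simp add: L_def)
  qed
qed

text \<open>The barriers bound the family and force the boundary value 0 on the supremum from both
  sides. The envelope u can then be compared with its own lower envelope L, and u = L is continuity.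
  The upper barriers are exact only up to e because the quadratic bound at an exposed point has such
  a defect.\<close>

lemma perron:
  fixes f :: "real^'n \<Rightarrow> real"
  assumes k: "1 \<le> k" "k \<le> CARD('n)" and \<Omega>: "open \<Omega>" "bounded \<Omega>" "\<Omega> \<noteq> {}" and f: "continuous_on \<Omega> f"
    and lower: "\<And>z. z \<in> frontier \<Omega> \<Longrightarrow> \<exists>b. continuous_on (closure \<Omega>) b \<and> b \<in> dirichlet_subsolutions k f \<Omega> \<and> b z = 0"
    and upper: "\<And>z e. z \<in> frontier \<Omega> \<Longrightarrow> e > 0 \<Longrightarrow> \<exists>\<psi>. continuous_on (closure \<Omega>) \<psi> \<and> \<psi> z \<le> e \<and>
        (\<forall>w\<in>dirichlet_subsolutions k f \<Omega>. \<forall>x\<in>closure \<Omega>. w x \<le> \<psi> x)"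
  shows "\<exists>u. dirichlet_solution k f \<Omega> u"
proof -
  let ?S = "closure \<Omega>" and ?F = "dirichlet_subsolutions k f \<Omega>"
  have S: "compact ?S" using \<Omega>(2) by (simp add: compact_closure)
  have \<Omega>S: "\<Omega> \<subseteq> ?S" by (rule closure_subset)
  have SF: "?S = \<Omega> \<union> frontier \<Omega>" using \<Omega>(1) by (simp add: closure_Un_frontier)
  obtain z0 where z0: "z0 \<in> frontier \<Omega>" using \<Omega>(2,3) frontier_not_empty[of \<Omega>] not_bounded_UNIV by force
  obtain b0 where b0: "continuous_on ?S b0" "b0 \<in> ?F" using lower[OF z0] by blast
  obtain \<psi>0 where \<psi>0: "continuous_on ?S \<psi>0" "\<And>w x. w \<in> ?F \<Longrightarrow> x \<in> ?S \<Longrightarrow> w x \<le> \<psi>0 x" using upper[OF z0 zero_less_one] by blast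
  obtain M1 where M1: "\<And>x. x \<in> ?S \<Longrightarrow> \<bar>b0 x\<bar> \<le> M1"
    using compact_imp_bounded[OF compact_continuous_image[OF b0(1) S]] unfolding bounded_iff by auto
  obtain M2 where M2: "\<And>x. x \<in> ?S \<Longrightarrow> \<bar>\<psi>0 x\<bar> \<le> M2"
    using compact_imp_bounded[OF compact_continuous_image[OF \<psi>0(1) S]] unfolding bounded_iff by auto
  define M where "M = max M1 M2"
  define U where "U x = (SUP w\<in>?F. w x)" for x
  have bdd: "bdd_above ((\<lambda>w. w x) ` ?F)" if "x \<in> ?S" for x by (rule bdd_aboveI2[of _ _ "\<psi>0 x"]) (rule \<psi>0(2)[OF _ that])
  have wU: "w x \<le> U x" if "w \<in> ?F" "x \<in> ?S" for w x unfolding U_def by (rule cSUP_upper[OF that(1) bdd[OF that(2)]])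
  have U_le: "U x \<le> c" if "\<And>w. w \<in> ?F \<Longrightarrow> w x \<le> c" for x c unfolding U_def by (rule cSUP_least) (use b0(2) that in auto)
  have U_approx: "\<exists>w\<in>?F. c < w x" if "x \<in> ?S" "c < U x" for x c using U_le[of x c] that(2) by force
  have bdU: "\<bar>U x\<bar> \<le> M" if x: "x \<in> ?S" for x
  proof -
    have "U x \<le> \<psi>0 x" using \<psi>0(2) x by (intro U_le) auto
    then show ?thesis using wU[OF b0(2) x] M1[OF x] M2[OF x] by (auto simp: M_def abs_le_iff)
  qed
  define u where "u = usc_env ?S U"
  have Uu: "U x \<le> u x" if "x \<in> ?S" for x unfolding u_def using usc_env_ge[of ?S U M] bdU that by simp
  have u_le: "u x \<le> \<psi> x" if "continuous_on ?S \<psi>" "\<And>w x. w \<in> ?F \<Longrightarrow> x \<in> ?S \<Longrightarrow> w x \<le> \<psi> x" "x \<in> ?S" for \<psi> x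
    unfolding u_def
    by (rule usc_env_le_usc[of ?S U M]) (use bdU continuous_on_imp_usc_on[OF that(1)] that(2,3) in \<open>auto intro: U_le\<close>)
  have u_fr: "u x \<le> 0" if x: "x \<in> frontier \<Omega>" for x
  proof (rule field_le_epsilon)
    fix e :: real assume "e > 0"
    then obtain \<psi> where \<psi>: "continuous_on ?S \<psi>" "\<psi> x \<le> e" "\<And>w x. w \<in> ?F \<Longrightarrow> x \<in> ?S \<Longrightarrow> w x \<le> \<psi> x" using upper[OF x] by blast
    have "u x \<le> \<psi> x" by (rule u_le[OF \<psi>(1)]) (use \<psi>(3) x SF in auto)
    then show "u x \<le> 0 + e" using \<psi>(2) by simp
  qed
  have bdu: "\<bar>u x\<bar> \<le> M" if "x \<in> ?S" for x unfolding u_def by (rule usc_env_bounded[of ?S U M]) (use bdU that in auto)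
  have u_usc: "usc_on ?S u" unfolding u_def using usc_env_usc[of ?S U M] bdU by simp
  have u_sub: "viscosity_subsolution k f \<Omega> u"
    unfolding u_def
    by (rule subsolution_sup_env[OF k \<Omega>(1) \<Omega>S f, of ?F])
       (use wU U_approx bdU in \<open>auto simp: dirichlet_subsolutions_def\<close>)
  have uF: "u \<in> ?F" using u_usc u_sub u_fr by (simp add: dirichlet_subsolutions_def)
  have u_max: "w x \<le> u x" if "w \<in> ?F" "x \<in> ?S" for w x using wU[OF that] Uu[OF that(2)] by simp
  define L where "L x = - usc_env ?S (\<lambda>x. - u x) x" for x
  have bdg: "\<bar>- u x\<bar> \<le> M" if "x \<in> ?S" for x using bdu[OF that] by simp
  have L_super: "viscosity_supersolution k f \<Omega> L"
    unfolding L_def[abs_def] by (rule maximal_subsolution_env_supersolution[OF k \<Omega>(1) f uF]) (use u_max bdu in auto)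
  have Lu: "L x \<le> u x" if "x \<in> ?S" for x using usc_env_ge[of ?S "\<lambda>x. - u x" M x] bdg that by (simp add: L_def)
  have L_lsc: "lsc_on ?S L" using usc_env_usc[of ?S "\<lambda>x. - u x" M] bdg by (simp add: L_def[abs_def] usc_on_iff_lsc_on)
  have L_fr: "0 \<le> L x" if x: "x \<in> frontier \<Omega>" for x
  proof -
    obtain b where b: "continuous_on ?S b" "b \<in> ?F" "b x = 0" using lower[OF x] by blast
    have "usc_on ?S (\<lambda>x. - b x)" by (intro continuous_on_imp_usc_on continuous_intros b)
    then have "usc_env ?S (\<lambda>x. - u x) x \<le> - b x"
      using bdg u_max[OF b(2)] x SF by (intro usc_env_le_usc[of ?S "\<lambda>x. - u x" M]) auto
    then show ?thesis using b(3) by (simp add: L_def)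
  qed
  have LM: "\<bar>L x\<bar> \<le> M" if "x \<in> ?S" for x
    using usc_env_bounded[of ?S "\<lambda>x. - u x" M x] bdg that by (simp add: L_def)
  have "u x \<le> L x" if "x \<in> \<Omega>" for x
  proof (rule comparison[OF k \<Omega>(1,2) f u_usc L_lsc u_sub L_super _ LM that])
    fix x assume "x \<in> frontier \<Omega>"
    then show "u x \<le> L x" using u_fr L_fr by (meson order_trans)
  qed
  moreover have "u x \<le> L x" if "x \<in> frontier \<Omega>" for x using u_fr[OF that] L_fr[OF that] by simp
  ultimately have eq: "u x = L x" if "x \<in> ?S" for x using that SF Lu[OF that] by force
  have cont: "continuous_on ?S u"
    unfolding continuous_on_def
  proof
    fix x assume x: "x \<in> ?S"
    show "(u \<longlongrightarrow> u x) (at x within ?S)"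
    proof (rule order_tendstoI)
      fix c assume "c < u x"
      then have "\<forall>\<^sub>F y in at x within ?S. c < L y" using L_lsc x eq[OF x] by (auto simp: lsc_on_def)
      moreover have "\<forall>\<^sub>F y in at x within ?S. y \<in> ?S" by (simp add: eventually_at_filter)
      ultimately show "\<forall>\<^sub>F y in at x within ?S. c < u y" by eventually_elim (simp add: eq)
    next
      fix c assume "u x < c"
      then show "\<forall>\<^sub>F y in at x within ?S. u y < c" using u_usc x by (auto simp: usc_on_def)
    qed
  qed
  have u_super: "viscosity_supersolution k f \<Omega> u"
    by (rule viscosity_supersolution_cong[OF L_super \<Omega>(1)]) (use eq \<Omega>S in auto)
  have "u x = 0" if x: "x \<in> frontier \<Omega>" for x using u_fr[OF x] L_fr[OF x] eq[of x] x SF by auto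
  then have "dirichlet_solution k f \<Omega> u"
    unfolding dirichlet_solution_def viscosity_solution_def
    using cont u_sub u_super continuous_on_subset[OF cont \<Omega>S] by blast
  then show ?thesis by blast
qed

section \<open>Barriers and cylinders\<close>

text \<open>The trace of the projection over any k orthonormal vectors is at least 1: the
  complementary coordinates number k - 1 and can absorb at most k - 1 of the total k.\<close>

lemma Pplus_neg_proj_le:
  fixes \<xi> :: "'n::finite \<Rightarrow> real^'n"
  assumes k: "1 \<le> k" "k \<le> CARD('n)" and \<xi>: "onb \<xi>" and J: "card J = CARD('n) - k + 1" and m: "m \<ge> 0"
  shows "Pplus k ((- m) *\<^sub>R proj_mat \<xi> J) \<le> - m"
proof -
  have sym: "transpose ((- m) *\<^sub>R proj_mat \<xi> J) = (- m) *\<^sub>R proj_mat \<xi> J"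
    using proj_mat_sym[of \<xi> J] by (simp add: transpose_def vec_eq_iff)
  obtain \<eta> I where I: "onb \<eta>" "card I = k" "Pplus k ((- m) *\<^sub>R proj_mat \<xi> J) = (\<Sum>i\<in>I. \<eta> i \<bullet> (((- m) *\<^sub>R proj_mat \<xi> J) *v \<eta> i))"
    using Pplus_attained[OF sym k] by blast
  have q: "\<eta> i \<bullet> (((- m) *\<^sub>R proj_mat \<xi> J) *v \<eta> i) = - m * (\<Sum>j\<in>J. (\<xi> j \<bullet> \<eta> i)\<^sup>2)" for i
  proof -
    have "\<eta> i \<bullet> (((- m) *\<^sub>R proj_mat \<xi> J) *v \<eta> i) = - m * (\<eta> i \<bullet> (proj_mat \<xi> J *v \<eta> i))"
      by (simp only: inner_scaleR_right flip: scaleR_matrix_vector_assoc)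
    then show ?thesis by (simp only: proj_mat_quad)
  qed
  have split: "(\<Sum>j\<in>J. (\<xi> j \<bullet> \<eta> i)\<^sup>2) = 1 - (\<Sum>j\<in>-J. (\<xi> j \<bullet> \<eta> i)\<^sup>2)" for i
  proof -
    have "1 = (\<Sum>j\<in>UNIV. (\<xi> j \<bullet> \<eta> i)\<^sup>2)" using onb_norm_expand[OF \<xi>, of "\<eta> i"] onb_norm[OF I(1), of i] by simp
    also have "\<dots> = (\<Sum>j\<in>J. (\<xi> j \<bullet> \<eta> i)\<^sup>2) + (\<Sum>j\<in>-J. (\<xi> j \<bullet> \<eta> i)\<^sup>2)"
      using sum.union_disjoint[of J "-J" "\<lambda>j. (\<xi> j \<bullet> \<eta> i)\<^sup>2"] by simp
    finally show ?thesis by simp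
  qed
  have "(\<Sum>i\<in>I. \<Sum>j\<in>-J. (\<xi> j \<bullet> \<eta> i)\<^sup>2) \<le> (\<Sum>i\<in>UNIV. \<Sum>j\<in>-J. (\<xi> j \<bullet> \<eta> i)\<^sup>2)"
    by (intro sum_mono2 sum_nonneg) auto
  also have "\<dots> = (\<Sum>j\<in>-J. \<Sum>i\<in>UNIV. (\<eta> i \<bullet> \<xi> j)\<^sup>2)" by (subst sum.swap) (simp add: inner_commute)
  also have "\<dots> = (\<Sum>j\<in>-J. (norm (\<xi> j))\<^sup>2)" by (simp only: onb_norm_expand[OF I(1)])
  also have "\<dots> = real (card (- J))" by (simp add: onb_norm[OF \<xi>])
  also have "card (- J) = k - 1" using J k by (simp add: Compl_eq_Diff_UNIV card_Diff_subset)
  finally have "(\<Sum>i\<in>I. \<Sum>j\<in>J. (\<xi> j \<bullet> \<eta> i)\<^sup>2) \<ge> 1"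
    using I(2) k by (simp add: split sum_subtractf of_nat_diff)
  then have "m * 1 \<le> m * (\<Sum>i\<in>I. \<Sum>j\<in>J. (\<xi> j \<bullet> \<eta> i)\<^sup>2)" using m by (rule mult_left_mono)
  moreover have "Pplus k ((- m) *\<^sub>R proj_mat \<xi> J) = - (m * (\<Sum>i\<in>I. \<Sum>j\<in>J. (\<xi> j \<bullet> \<eta> i)\<^sup>2))"
    unfolding I(3) q by (simp add: sum_negf sum_distrib_left)
  ultimately show ?thesis by simp
qed

text \<open>Away from y0 the linear function has a positive minimum on the compact set, and a large
  multiple of it dominates the squared distance. The constant a leaves room for sets that are
  flatter than a parabola at y0.\<close>

lemma exposed_quadratic_bound:
  fixes K :: "'a::euclidean_space set"
  assumes K: "compact K" and pos: "\<And>w. w \<in> K \<Longrightarrow> w \<noteq> y0 \<Longrightarrow> 0 < n \<bullet> (w - y0)" and a: "a > 0"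
  shows "\<exists>c\<ge>0. \<forall>w\<in>K. (norm (w - y0))\<^sup>2 \<le> a + c * (n \<bullet> (w - y0))"
proof -
  let ?K' = "K \<inter> {w. a \<le> (norm (w - y0))\<^sup>2}"
  have cK': "compact ?K'" by (intro compact_Int_closed K closed_Collect_le continuous_intros)
  obtain B where B: "\<And>w. w \<in> K \<Longrightarrow> (norm (w - y0))\<^sup>2 \<le> B"
  proof -
    have "bounded ((\<lambda>w. (norm (w - y0))\<^sup>2) ` K)"
      by (intro compact_imp_bounded compact_continuous_image continuous_intros K)
    then show ?thesis using that unfolding bounded_iff by fastforce
  qed
  show ?thesis
  proof (cases "?K' = {}")
    case True
    then show ?thesis by (intro exI[of _ 0]) (auto simp: not_le less_imp_le disjoint_iff)
  next
    case False
    have "continuous_on ?K' (\<lambda>w. n \<bullet> (w - y0))" by (intro continuous_intros)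
    then obtain w0 where w0: "w0 \<in> ?K'" "\<And>w. w \<in> ?K' \<Longrightarrow> n \<bullet> (w0 - y0) \<le> n \<bullet> (w - y0)"
      using continuous_attains_inf[OF cK' False] by blast
    let ?s = "n \<bullet> (w0 - y0)"
    have s: "?s > 0" using w0(1) a by (intro pos) auto
    have B0: "B \<ge> 0" using B w0(1) by (meson IntD1 order_trans zero_le_power2)
    have "(norm (w - y0))\<^sup>2 \<le> a + B / ?s * (n \<bullet> (w - y0))" if w: "w \<in> K" for w
    proof (cases "a \<le> (norm (w - y0))\<^sup>2")
      case True
      then have "?s \<le> n \<bullet> (w - y0)" using w w0(2) by blast
      then have "B / ?s * ?s \<le> B / ?s * (n \<bullet> (w - y0))" using B0 s by (intro mult_left_mono) auto
      then show ?thesis using B[OF w] s a by simp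
    next
      case False
      have "0 \<le> n \<bullet> (w - y0)" using pos[OF w] by (cases "w = y0") auto
      then have "0 \<le> B / ?s * (n \<bullet> (w - y0))" using B0 s by simp
      then show ?thesis using False by linarith
    qed
    then show ?thesis using B0 s by (intro exI[of _ "B / ?s"]) auto
  qed
qed

text \<open>C is the intersection of the balls |w - y0|^2 \<le> a + (c + 1) s w over all (a, c) for
  which K satisfies the sharper bound with c. Letting a tend to 0 exposes y0. Every ball contributes
  the same convexity gain t (1 - t) |x - y|^2, so the intersection is strictly convex although the
  radii are unbounded. Passing from c to c + 1 leaves the slack s w that puts K, apart from y0, into
  the interior.\<close>

lemma strictly_convex_enclosure:
  fixes K :: "'a::euclidean_space set"
  assumes K: "compact K" and pos: "\<And>w. w \<in> K \<Longrightarrow> w \<noteq> y0 \<Longrightarrow> 0 < n \<bullet> (w - y0)" and w1: "w1 \<in> K" "w1 \<noteq> y0"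
  shows "\<exists>\<omega>. strictly_convex_domain \<omega> \<and> bounded \<omega> \<and> K - {y0} \<subseteq> \<omega> \<and> y0 \<notin> \<omega>"
proof -
  define s where "s w = n \<bullet> (w - y0)" for w
  define P where "P a c \<longleftrightarrow> a > 0 \<and> c \<ge> 0 \<and> (\<forall>w\<in>K. (norm (w - y0))\<^sup>2 \<le> a + c * s w)" for a c
  define C where "C = {w. \<forall>a c. P a c \<longrightarrow> (norm (w - y0))\<^sup>2 \<le> a + (c + 1) * s w}"
  have sK: "s w \<ge> 0" if "w \<in> K" for w using pos[OF that] by (cases "w = y0") (auto simp: s_def)
  have ex: "\<exists>c. P a c" if "a > 0" for a
    using exposed_quadratic_bound[OF K pos that] that unfolding P_def s_def by blast
  have P_mono: "P a c'" if "P a c" "c \<le> c'" for a c c'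
  proof -
    have "c * s w \<le> c' * s w" if "w \<in> K" for w using sK[OF that] \<open>c \<le> c'\<close> by (rule mult_right_mono[rotated])
    then show ?thesis using that unfolding P_def by (meson add_left_mono order_trans)
  qed
  have n0: "n \<noteq> 0" using pos[OF w1] by auto
  have cs: "continuous_on A s" for A unfolding s_def[abs_def] by (intro continuous_intros)
  have C_s: "s w \<ge> 0" if w: "w \<in> C" for w
  proof (rule ccontr)
    assume neg: "\<not> s w \<ge> 0"
    obtain c where c: "P 1 c" using ex[of 1] by auto
    \<comment> \<open>The admissible c may be increased at will; for negative s w this one makes the
      right-hand side negative.\<close>
    let ?c = "max c (1 / - s w)"
    have "P 1 ?c" using P_mono[OF c] by simp
    then have "(norm (w - y0))\<^sup>2 \<le> 1 + (?c + 1) * s w" using w by (auto simp: C_def)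
    also have "(?c + 1) * s w \<le> (1 / - s w + 1) * s w" using neg by (intro mult_right_mono_neg) auto
    also have "\<dots> = - 1 + s w" using neg by (simp add: field_simps)
    finally show False using neg by (simp add: power2_eq_square) (smt (verit) zero_le_square)
  qed
  have C_s0: "s w > 0" if w: "w \<in> C" "w \<noteq> y0" for w
  proof (rule ccontr)
    assume "\<not> s w > 0"
    then have s0: "s w = 0" using C_s[OF w(1)] by simp
    have "(norm (w - y0))\<^sup>2 \<le> 0 + a" if "a > 0" for a
      using ex[OF that] w(1) s0 by (auto simp: C_def)
    then have "(norm (w - y0))\<^sup>2 \<le> 0" by (rule field_le_epsilon)
    then show False using w(2) by simp
  qed
  \<comment> \<open>A slack \<tau> independent of a and c suffices although c is unbounded: scaling
    the inequality at z by \<theta> = min 1 (s w / s z) absorbs the change of s, and what remains is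
    an open condition free of a and c.\<close>
  have int: "z \<in> interior C" if z: "s z > 0" "\<tau> > 0" "\<And>a c. P a c \<Longrightarrow> (norm (z - y0))\<^sup>2 + \<tau> \<le> a + (c + 1) * s z" for z \<tau>
  proof -
    let ?\<theta> = "\<lambda>w. min 1 (s w / s z)" and ?Z = "(norm (z - y0))\<^sup>2 + \<tau>"
    let ?N = "{w. (norm (w - y0))\<^sup>2 < ?\<theta> w * ?Z}"
    have "open ?N" by (intro open_Collect_less continuous_intros cs) (use z in auto)
    moreover have "z \<in> ?N" using z by simp
    moreover have "?N \<subseteq> C"
    proof
      fix w assume w: "w \<in> ?N"
      have Z: "?Z > 0" using z(2) by (simp add: add_nonneg_pos)
      have "0 < ?\<theta> w * ?Z" using w by (auto intro: order.strict_trans1[of _ "(norm (w - y0))\<^sup>2"])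
      then have \<theta>: "?\<theta> w > 0" using Z zero_less_mult_pos2 by blast
      have \<theta>s: "?\<theta> w * s z \<le> s w" using z(1) by (simp add: min_def field_simps)
      show "w \<in> C" unfolding C_def
      proof (clarify)
        fix a c assume p: "P a c"
        then have ac: "a > 0" "c \<ge> 0" by (auto simp: P_def)
        have "(norm (w - y0))\<^sup>2 \<le> ?\<theta> w * ?Z" using w by simp
        also have "\<dots> \<le> ?\<theta> w * (a + (c + 1) * s z)" using z(3)[OF p] \<theta> by (intro mult_left_mono) auto
        also have "\<dots> = ?\<theta> w * a + (c + 1) * (?\<theta> w * s z)" by (simp only: distrib_left mult.left_commute)
        also have "\<dots> \<le> 1 * a + (c + 1) * s w" using ac \<theta>s by (intro add_mono mult_right_mono mult_left_mono) auto
        finally show "(norm (w - y0))\<^sup>2 \<le> a + (c + 1) * s w" by simp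
      qed
    qed
    ultimately show ?thesis by (rule interiorI)
  qed
  let ?\<omega> = "interior C"
  have closedC: "closed C"
  proof -
    have "C = (\<Inter>p\<in>{p. P (fst p) (snd p)}. {w. (norm (w - y0))\<^sup>2 \<le> fst p + (snd p + 1) * s w})" by (auto simp: C_def)
    moreover have "closed {w. (norm (w - y0))\<^sup>2 \<le> a + (c + 1) * s w}" for a c
      by (intro closed_Collect_le continuous_intros cs)
    ultimately show ?thesis by auto
  qed
  have strict: "(1 - t) *\<^sub>R x + t *\<^sub>R y \<in> ?\<omega>" if xy: "x \<in> C" "y \<in> C" "x \<noteq> y" "0 < t" "t < 1" for x y t
  proof -
    let ?z = "(1 - t) *\<^sub>R x + t *\<^sub>R y" and ?\<tau> = "t * (1 - t) * (norm (x - y))\<^sup>2"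
    have zy: "?z - y0 = (1 - t) *\<^sub>R (x - y0) + t *\<^sub>R (y - y0)" by (simp add: algebra_simps)
    have sz: "s ?z = (1 - t) * s x + t * s y" unfolding s_def zy by (simp add: inner_add_right)
    have "s x > 0 \<or> s y > 0" using xy C_s0 by metis
    then have s_pos: "s ?z > 0" unfolding sz using C_s[OF xy(1)] C_s[OF xy(2)] xy(4,5)
      by (auto intro: add_pos_nonneg add_nonneg_pos)
    have id: "(norm (?z - y0))\<^sup>2 + ?\<tau> = (1 - t) * (norm (x - y0))\<^sup>2 + t * (norm (y - y0))\<^sup>2"
    proof -
      have xy': "x - y = (x - y0) - (y - y0)" by simp
      show ?thesis unfolding zy xy' power2_norm_eq_inner
        by (simp add: inner_add_left inner_add_right inner_diff_left inner_diff_right inner_commute) (simp add: algebra_simps)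
    qed
    have "(norm (?z - y0))\<^sup>2 + ?\<tau> \<le> a + (c + 1) * s ?z" if p: "P a c" for a c
    proof -
      have "(norm (x - y0))\<^sup>2 \<le> a + (c + 1) * s x" "(norm (y - y0))\<^sup>2 \<le> a + (c + 1) * s y" using xy(1,2) p by (auto simp: C_def)
      then have "(1 - t) * (norm (x - y0))\<^sup>2 + t * (norm (y - y0))\<^sup>2 \<le> (1 - t) * (a + (c + 1) * s x) + t * (a + (c + 1) * s y)"
        using xy(4,5) by (intro add_mono mult_left_mono) auto
      also have "\<dots> = a + (c + 1) * s ?z" unfolding sz by (simp add: algebra_simps)
      finally show ?thesis unfolding id .
    qed
    then show ?thesis using xy s_pos by (intro int[of ?z ?\<tau>]) auto
  qed
  have "K - {y0} \<subseteq> ?\<omega>"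
  proof
    fix w assume w: "w \<in> K - {y0}"
    then have "s w > 0" using pos by (simp add: s_def)
    then show "w \<in> ?\<omega>" using w by (intro int[of w "s w"]) (auto simp: P_def algebra_simps)
  qed
  moreover have "y0 \<notin> ?\<omega>"
  proof
    assume "y0 \<in> ?\<omega>"
    then obtain e where e: "e > 0" "ball y0 e \<subseteq> C" unfolding mem_interior by blast
    let ?w = "y0 - (e / (2 * norm n)) *\<^sub>R n"
    have "?w \<in> ball y0 e" using e n0 by (simp add: dist_norm)
    then have "s ?w \<ge> 0" using e(2) C_s by blast
    moreover have "s ?w = - (e / (2 * norm n)) * (n \<bullet> n)" by (simp add: s_def)
    moreover have "e / (2 * norm n) * (n \<bullet> n) > 0" using e n0 by (simp add: divide_pos_pos)
    ultimately show False by simp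
  qed
  moreover have "bounded ?\<omega>"
  proof -
    obtain c where c: "P 1 c" using ex[of 1] by auto
    let ?B = "(c + 1) * norm n"
    have B: "?B \<ge> 0" using c by (simp add: P_def)
    have "norm (w - y0) \<le> 1 + ?B" if w: "w \<in> C" for w
    proof (rule ccontr)
      let ?d = "norm (w - y0)"
      assume "\<not> ?d \<le> 1 + ?B"
      then have d: "1 + ?B < ?d" by simp
      have "?d\<^sup>2 \<le> 1 + (c + 1) * s w" using w c by (auto simp: C_def)
      also have "(c + 1) * s w \<le> (c + 1) * (norm n * ?d)"
        using c unfolding s_def by (intro mult_left_mono norm_cauchy_schwarz) (auto simp: P_def)
      also have "1 + (c + 1) * (norm n * ?d) = 1 + ?B * ?d" by simp
      also have "\<dots> < ?d + ?B * ?d" using d B by simp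
      also have "\<dots> = (1 + ?B) * ?d" by (simp add: algebra_simps)
      also have "\<dots> \<le> ?d * ?d" using d by (intro mult_right_mono) auto
      finally show False by (simp add: power2_eq_square)
    qed
    then have "C \<subseteq> cball y0 (1 + ?B)" by (auto simp: dist_norm norm_minus_commute)
    then show ?thesis using interior_subset by (meson bounded_cball bounded_subset)
  qed
  moreover have "strictly_convex_domain ?\<omega>"
  proof -
    have "convex ?\<omega>" unfolding convex_alt
    proof (intro ballI allI impI)
      fix x y and t :: real assume xy: "x \<in> ?\<omega>" "y \<in> ?\<omega>" "0 \<le> t \<and> t \<le> 1"
      have "x \<in> C" "y \<in> C" using xy interior_subset by blast+
      then show "(1 - t) *\<^sub>R x + t *\<^sub>R y \<in> ?\<omega>"
        using strict[of x y t] xy by (cases "x = y \<or> t = 0 \<or> t = 1") (auto simp: scaleR_left_diff_distrib)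
    qed
    moreover have "?\<omega> \<noteq> {}" using \<open>K - {y0} \<subseteq> ?\<omega>\<close> w1 by blast
    moreover have "closure ?\<omega> \<subseteq> C" using closedC interior_subset closure_minimal by blast
    ultimately show ?thesis unfolding strictly_convex_domain_def is_domain_def
      using strict convex_connected by (meson open_interior subsetD)
  qed
  ultimately show ?thesis by blast
qed

section \<open>Cylinders and quadratic bounds at boundary points\<close>

lemma strictly_convex_domain_convex: "strictly_convex_domain \<omega> \<Longrightarrow> convex \<omega>"
  unfolding convex_alt strictly_convex_domain_def
proof (intro ballI allI impI)
  fix x y and t :: real
  assume a: "is_domain \<omega> \<and> (\<forall>x\<in>closure \<omega>. \<forall>y\<in>closure \<omega>. \<forall>t. x \<noteq> y \<and> 0 < t \<and> t < 1 \<longrightarrow> (1 - t) *\<^sub>R x + t *\<^sub>R y \<in> \<omega>)"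
    and xy: "x \<in> \<omega>" "y \<in> \<omega>" "0 \<le> t \<and> t \<le> 1"
  have "x \<in> closure \<omega>" "y \<in> closure \<omega>" using xy closure_subset by blast+
  then show "(1 - t) *\<^sub>R x + t *\<^sub>R y \<in> \<omega>"
    using a xy by (cases "x = y \<or> t = 0 \<or> t = 1") (auto simp: scaleR_left_diff_distrib)
qed

text \<open>\<open>Q *v cylinder e \<omega>\<close> is the preimage of \<open>\<omega>\<close> under \<open>col_proj \<xi> e\<close>, where \<open>\<xi>\<close> are the columns of \<open>Q\<close>.\<close>

definition col_proj :: "('n::finite \<Rightarrow> real^'n) \<Rightarrow> ('j::finite \<Rightarrow> 'n) \<Rightarrow> real^'n \<Rightarrow> real^'j" where
  "col_proj \<xi> e y = (\<chi> i. \<xi> (e i) \<bullet> y)"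

lemma linear_col_proj: "linear (col_proj \<xi> e)"
  by (rule linearI) (simp_all add: col_proj_def vec_eq_iff inner_add_right)

lemma continuous_col_proj: "continuous_on S (col_proj \<xi> e)"
  by (rule linear_continuous_on) (simp add: linear_col_proj linear_conv_bounded_linear[symmetric])

lemma norm_col_proj:
  assumes "inj e"
  shows "(norm (col_proj \<xi> e y))\<^sup>2 = (\<Sum>j\<in>range e. (\<xi> j \<bullet> y)\<^sup>2)"
  unfolding power2_norm_eq_inner using assms
  by (simp add: inner_vec_def col_proj_def sum.reindex power2_eq_square)

lemma onb_columns: "orthogonal_matrix Q \<longleftrightarrow> onb (\<lambda>j. column j Q)"
proof -
  have "(transpose Q ** Q) $ i $ j = column i Q \<bullet> column j Q" for i j
    by (simp add: matrix_matrix_mult_def transpose_def column_def inner_vec_def)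
  then show ?thesis unfolding orthogonal_matrix onb_def by (simp add: vec_eq_iff mat_def)
qed

lemma image_cylinder:
  assumes Q: "orthogonal_matrix Q"
  shows "(\<lambda>y. Q *v y) ` cylinder e \<omega> = {y. col_proj (\<lambda>j. column j Q) e y \<in> \<omega>}"
proof -
  have t: "(transpose Q *v y) $ i = column i Q \<bullet> y" for y i
    by (simp add: matrix_vector_mult_def transpose_def column_def inner_vec_def del: transpose_matrix_vector)
  have p: "(\<chi> i. (transpose Q *v y) $ e i) = col_proj (\<lambda>j. column j Q) e y" for y by (simp add: col_proj_def t del: transpose_matrix_vector)
  have 1: "transpose Q *v (Q *v y) = y" "Q *v (transpose Q *v y) = y" for y
    using Q by (simp_all add: matrix_vector_mul_assoc orthogonal_matrix_def del: transpose_matrix_vector)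
  show ?thesis
  proof (intro equalityI subsetI)
    fix y assume "y \<in> (\<lambda>y. Q *v y) ` cylinder e \<omega>"
    then obtain x where "y = Q *v x" "(\<chi> i. x $ e i) \<in> \<omega>" by (auto simp: cylinder_def)
    then show "y \<in> {y. col_proj (\<lambda>j. column j Q) e y \<in> \<omega>}" using p[of y] by (simp add: 1 del: transpose_matrix_vector)
  next
    fix y assume "y \<in> {y. col_proj (\<lambda>j. column j Q) e y \<in> \<omega>}"
    then have "transpose Q *v y \<in> cylinder e \<omega>" using p[of y] by (simp add: cylinder_def del: transpose_matrix_vector)
    then show "y \<in> (\<lambda>y. Q *v y) ` cylinder e \<omega>" using 1(2)[of y] by (metis image_eqI)
  qed
qed

lemma open_halfspace_strict:
  fixes a :: "'a::euclidean_space"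
  assumes "open \<omega>" "\<And>w. w \<in> \<omega> \<Longrightarrow> b \<le> a \<bullet> w" "a \<noteq> 0" "w \<in> \<omega>"
  shows "b < a \<bullet> w"
proof -
  obtain e where e: "e > 0" "ball w e \<subseteq> \<omega>" using assms(1,4) open_contains_ball by blast
  let ?v = "w - (e / (2 * norm a)) *\<^sub>R a"
  have "?v \<in> ball w e" using e assms(3) by (simp add: dist_norm)
  then have "b \<le> a \<bullet> ?v" using e assms(2) by blast
  moreover have "e / (2 * norm a) * (a \<bullet> a) > 0" using e assms(3) by (simp add: divide_pos_pos)
  ultimately show ?thesis by (simp add: inner_diff_right)
qed

text \<open>The projection of z is a boundary point of a strictly convex base, so a supporting
  hyperplane touches the closed base nowhere else. The quadratic bound there is pulled back along
  the projection, whose norm sees only the directions in J.\<close>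

lemma cylinder_class_barrier:
  fixes \<Omega> :: "(real^'n) set"
  assumes \<Omega>: "\<Omega> \<in> cylinder_class TYPE('j::finite)" and z: "z \<in> frontier \<Omega>"
  shows "\<exists>(\<xi> :: 'n \<Rightarrow> real^'n) J. onb \<xi> \<and> card J = CARD('j) \<and>
    (\<forall>a>0. \<exists>b. \<forall>y\<in>closure \<Omega>. (\<Sum>j\<in>J. (\<xi> j \<bullet> (y - z))\<^sup>2) \<le> a + b \<bullet> (y - z))"
proof -
  obtain Q C where QC: "orthogonal_matrix Q" "C \<in> cylinders TYPE('j)" "\<Omega> \<subseteq> (\<lambda>y. Q *v y) ` C" "z \<in> frontier ((\<lambda>y. Q *v y) ` C)"
    using \<Omega> z unfolding cylinder_class_def by blast
  obtain e :: "'j \<Rightarrow> 'n" and \<omega> where e: "C = cylinder e \<omega>" "inj e" "bounded \<omega>" "strictly_convex_domain \<omega>"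
    using QC(2) unfolding cylinders_def by blast
  define \<xi> where "\<xi> j = column j Q" for j
  have \<xi>: "onb \<xi>" using QC(1) by (simp add: onb_columns \<xi>_def[abs_def])
  let ?\<pi> = "col_proj \<xi> e"
  have im: "(\<lambda>y. Q *v y) ` C = ?\<pi> -` \<omega>" unfolding e(1) image_cylinder[OF QC(1)] \<xi>_def[abs_def] by auto
  have o\<omega>: "open \<omega>" and ne: "\<omega> \<noteq> {}" using e(4) by (auto simp: strictly_convex_domain_def is_domain_def)
  have "open (?\<pi> -` \<omega>)" using o\<omega> by (intro open_vimage continuous_col_proj)
  then have "z \<notin> ?\<pi> -` \<omega>" using QC(4) unfolding im frontier_def by (simp add: interior_open)
  then have z\<omega>: "?\<pi> z \<notin> \<omega>" by simp
  have cl: "?\<pi> y \<in> closure \<omega>" if y: "y \<in> closure \<Omega>" for y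
  proof -
    have "?\<pi> ` closure \<Omega> \<subseteq> closure \<omega>"
      by (rule image_closure_subset[OF continuous_col_proj closed_closure])
         (use QC(3) closure_subset[of \<omega>] in \<open>unfold im; auto\<close>)
    then show ?thesis using y by blast
  qed
  have zcl: "?\<pi> z \<in> closure \<omega>" using cl z by (simp add: frontier_def)
  obtain a b where ab: "a \<noteq> 0" "\<forall>x\<in>{?\<pi> z}. a \<bullet> x \<le> b" "\<forall>x\<in>\<omega>. b \<le> a \<bullet> x"
    using separating_hyperplane_sets[of "{?\<pi> z}" \<omega>] strictly_convex_domain_convex[OF e(4)] ne z\<omega> by auto
  have ge: "b \<le> a \<bullet> w" if "w \<in> closure \<omega>" for w
  proof -
    have "closure \<omega> \<subseteq> {w. b \<le> a \<bullet> w}" by (rule closure_minimal) (use ab(3) in \<open>auto intro: closed_halfspace_ge\<close>)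
    then show ?thesis using that by blast
  qed
  have bz: "a \<bullet> ?\<pi> z = b" using ab(2) ge[OF zcl] by simp
  have pos: "0 < a \<bullet> (w - ?\<pi> z)" if w: "w \<in> closure \<omega>" "w \<noteq> ?\<pi> z" for w
  proof -
    have "\<forall>x\<in>closure \<omega>. \<forall>y\<in>closure \<omega>. \<forall>t. x \<noteq> y \<and> 0 < t \<and> t < 1 \<longrightarrow> (1 - t) *\<^sub>R x + t *\<^sub>R y \<in> \<omega>"
      using e(4) by (simp add: strictly_convex_domain_def)
    note mid = this[rule_format, OF w(1) zcl]
    \<comment> \<open>The midpoint lies in the open base, where the supporting function is strictly
      above its minimum b; hence it is so at w.\<close>
    have "(1 - 1/2) *\<^sub>R w + (1/2) *\<^sub>R ?\<pi> z \<in> \<omega>" by (rule mid) (use w in simp)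
    then have "b < a \<bullet> ((1 - 1/2) *\<^sub>R w + (1/2) *\<^sub>R ?\<pi> z)" using ab(1,3) o\<omega> by (intro open_halfspace_strict[of \<omega>]) auto
    then show ?thesis using bz by (simp add: inner_add_right inner_diff_right)
  qed
  have K: "compact (closure \<omega>)" using e(3) by (simp add: compact_closure)
  have "\<exists>b. \<forall>y\<in>closure \<Omega>. (\<Sum>j\<in>range e. (\<xi> j \<bullet> (y - z))\<^sup>2) \<le> t + b \<bullet> (y - z)" if tp: "t > 0" for t
  proof -
    obtain c where c: "\<And>w. w \<in> closure \<omega> \<Longrightarrow> (norm (w - ?\<pi> z))\<^sup>2 \<le> t + c * (a \<bullet> (w - ?\<pi> z))"
      using exposed_quadratic_bound[OF K pos tp] by blast
    have "(\<Sum>j\<in>range e. (\<xi> j \<bullet> (y - z))\<^sup>2) \<le> t + (c *\<^sub>R (\<Sum>i\<in>UNIV. a $ i *\<^sub>R \<xi> (e i))) \<bullet> (y - z)" if y: "y \<in> closure \<Omega>" for y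
    proof -
      have d: "?\<pi> y - ?\<pi> z = ?\<pi> (y - z)" by (rule linear_diff[OF linear_col_proj, symmetric])
      have "a \<bullet> ?\<pi> (y - z) = (\<Sum>i\<in>UNIV. a $ i *\<^sub>R \<xi> (e i)) \<bullet> (y - z)"
        by (simp add: inner_vec_def[of a] col_proj_def inner_sum_left)
      then show ?thesis using c[OF cl[OF y]] unfolding d norm_col_proj[OF e(2)] by simp
    qed
    then show ?thesis by blast
  qed
  moreover have "card (range e) = CARD('j)" using e(2) by (simp add: card_image)
  ultimately show ?thesis using \<xi> by blast
qed

section \<open>Barriers for the Dirichlet problem\<close>

lemma C2_subsolution:
  fixes b :: "real^'n \<Rightarrow> real"
  assumes k: "1 \<le> k" "k \<le> CARD('n)" and b: "C2_on UNIV b G H" and ge: "\<And>x. x \<in> \<Omega> \<Longrightarrow> f x \<le> Pplus k (H x)"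
  shows "viscosity_subsolution k f \<Omega> b"
  unfolding viscosity_subsolution_def
proof (intro conjI ballI allI impI)
  show "usc_on \<Omega> b" using C2_on_continuous[OF b] continuous_on_subset by (intro continuous_on_imp_usc_on) blast
  fix x \<phi> X assume x: "x \<in> \<Omega>" and a: "C2_near x \<phi> X \<and> (\<forall>\<^sub>F y in nhds x. b y - \<phi> y \<le> b x - \<phi> x)"
  then obtain U G' H' where U: "x \<in> U" "C2_on U \<phi> G' H'" "H' x = X" unfolding C2_near_iff by blast
  have D: "C2_on U (\<lambda>y. \<phi> y - b y) (\<lambda>y. G' y - G y) (\<lambda>y. H' y - H y)"
    by (intro C2_on_diff U(2) C2_on_subset[OF b] C2_onD(1)[OF U(2)]) auto
  have "\<forall>\<^sub>F y in nhds x. \<phi> x - b x \<le> \<phi> y - b y" using a[THEN conjunct2] by eventually_elim simp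
  then have "0 \<le> v \<bullet> ((H' x - H x) *v v)" for v by (rule C2_on_local_min[OF D U(1)])
  then have "v \<bullet> (H x *v v) \<le> v \<bullet> (X *v v)" for v by (simp add: U(3) matrix_vector_mult_diff_rdistrib inner_diff_right)
  then have "Pplus k (H x) \<le> Pplus k X"
    using C2_on_symmetric[OF b, of x] C2_near_symmetric[OF a[THEN conjunct1]] by (intro Pplus_mono k) auto
  then show "f x \<le> Pplus k X" using ge[OF x] by simp
qed

text \<open>A C^2 function is its own test function at a maximum of w - \<psi>, so strictness yields
  the comparison directly.\<close>

lemma subsolution_le_C2_supersolution:
  fixes \<psi> :: "real^'n \<Rightarrow> real"
  assumes \<Omega>: "open \<Omega>" "bounded \<Omega>" and \<psi>: "C2_on UNIV \<psi> G H" and lt: "\<And>x. x \<in> \<Omega> \<Longrightarrow> Pplus k (H x) < f x"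
    and \<psi>0: "\<And>x. x \<in> frontier \<Omega> \<Longrightarrow> 0 \<le> \<psi> x" and w: "w \<in> dirichlet_subsolutions k f \<Omega>" and x: "x \<in> closure \<Omega>"
  shows "w x \<le> \<psi> x"
proof (rule ccontr)
  assume gt: "\<not> w x \<le> \<psi> x"
  have w': "usc_on (closure \<Omega>) w" "viscosity_subsolution k f \<Omega> w" "\<And>x. x \<in> frontier \<Omega> \<Longrightarrow> w x \<le> 0"
    using w by (auto simp: dirichlet_subsolutions_def)
  have usc: "usc_on (closure \<Omega>) (\<lambda>y. w y + - \<psi> y)"
    by (rule usc_on_add_continuous[OF w'(1)])
       (intro continuous_on_minus continuous_on_subset[OF C2_on_continuous[OF \<psi>] subset_UNIV])
  have "compact (closure \<Omega>)" using \<Omega>(2) by (simp add: compact_closure)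
  moreover have "closure \<Omega> \<noteq> {}" using x by (auto simp del: closure_eq_empty)
  ultimately have "\<exists>y\<in>closure \<Omega>. \<forall>z\<in>closure \<Omega>. w z + - \<psi> z \<le> w y + - \<psi> y"
    using usc by (rule usc_on_attains_sup)
  then obtain y where y: "y \<in> closure \<Omega>" "\<And>z. z \<in> closure \<Omega> \<Longrightarrow> w z + - \<psi> z \<le> w y + - \<psi> y" by blast
  have "y \<notin> frontier \<Omega>" using y(2)[OF x] gt w'(3)[of y] \<psi>0[of y] by force
  then have y\<Omega>: "y \<in> \<Omega>" using y(1) \<Omega>(1) by (simp add: frontier_def interior_open)
  have "\<forall>\<^sub>F z in nhds y. z \<in> \<Omega>" using y\<Omega> \<Omega>(1) by (rule eventually_nhds_in_open[rotated])
  then have "\<forall>\<^sub>F z in nhds y. w z - \<psi> z \<le> w y - \<psi> y"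
    by eventually_elim (use y(2) closure_subset[of \<Omega>] in force)
  then have "f y \<le> Pplus k (H y)" using w'(2) y\<Omega> C2_on_near[OF \<psi>, of y] unfolding viscosity_subsolution_def by blast
  then show False using lt[OF y\<Omega>] by simp
qed

lemma convex_support:
  fixes \<Omega> :: "'a::euclidean_space set"
  assumes \<Omega>: "open \<Omega>" "convex \<Omega>" "\<Omega> \<noteq> {}" and z: "z \<in> frontier \<Omega>"
  shows "\<exists>a. norm a = 1 \<and> (\<forall>y\<in>closure \<Omega>. 0 \<le> a \<bullet> (y - z)) \<and> (\<forall>y\<in>\<Omega>. 0 < a \<bullet> (y - z))"
proof -
  have "z \<notin> \<Omega>" using z \<Omega>(1) by (simp add: frontier_def interior_open)
  then obtain a b where ab: "a \<noteq> 0" "\<forall>x\<in>{z}. a \<bullet> x \<le> b" "\<forall>x\<in>\<Omega>. b \<le> a \<bullet> x"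
    using separating_hyperplane_sets[of "{z}" \<Omega>] \<Omega> by auto
  let ?a = "(1 / norm a) *\<^sub>R a"
  have a1: "norm ?a = 1" "?a \<noteq> 0" using ab(1) by auto
  have ge: "0 \<le> ?a \<bullet> (y - z)" if "y \<in> \<Omega>" for y
  proof -
    have "0 \<le> a \<bullet> (y - z)" using ab(2,3) that by (fastforce simp: inner_diff_right)
    then show ?thesis by simp
  qed
  have "0 \<le> ?a \<bullet> (y - z)" if "y \<in> closure \<Omega>" for y
  proof -
    have "closure \<Omega> \<subseteq> {y. 0 \<le> ?a \<bullet> (y - z)}"
    proof (rule closure_minimal)
      show "\<Omega> \<subseteq> {y. 0 \<le> ?a \<bullet> (y - z)}" using ge by blast
      show "closed {y. 0 \<le> ?a \<bullet> (y - z)}" by (intro closed_Collect_le continuous_intros)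
    qed
    then show ?thesis using that by blast
  qed
  moreover have "0 < ?a \<bullet> (y - z)" if "y \<in> \<Omega>" for y
  proof -
    have "?a \<bullet> z < ?a \<bullet> y"
    proof (rule open_halfspace_strict[OF \<Omega>(1) _ a1(2) that])
      fix w assume "w \<in> \<Omega>"
      from ge[OF this] show "?a \<bullet> z \<le> ?a \<bullet> w" by (simp only: inner_diff_right)
    qed
    then show ?thesis by (simp add: inner_diff_right)
  qed
  ultimately show ?thesis using a1(1) by blast
qed

text \<open>With d the distance to a supporting hyperplane and D a bound for it, the barrier is M /
  2 times d (d - D): nonpositive on the closure, zero at z, with second derivative M in the normal
  direction a and 0 in all others. A k-frame that contains a therefore has trace M.\<close>

lemma convex_lower_barrier:
  fixes \<Omega> :: "(real^'n) set"
  assumes k: "1 \<le> k" "k \<le> CARD('n)" and \<Omega>: "open \<Omega>" "bounded \<Omega>" "convex \<Omega>" "\<Omega> \<noteq> {}"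
    and f: "\<And>x. x \<in> \<Omega> \<Longrightarrow> f x \<le> M" and M: "M \<ge> 0" and z: "z \<in> frontier \<Omega>"
  shows "\<exists>b. continuous_on (closure \<Omega>) b \<and> b \<in> dirichlet_subsolutions k f \<Omega> \<and> b z = 0"
proof -
  obtain a where a: "norm a = 1" "\<And>y. y \<in> closure \<Omega> \<Longrightarrow> 0 \<le> a \<bullet> (y - z)" using convex_support[OF \<Omega>(1,3,4) z] by blast
  obtain \<xi> :: "'n \<Rightarrow> real^'n" where \<xi>: "onb \<xi>" "a \<in> range \<xi>" using onb_of_set[of "{a}"] a(1) by auto
  then obtain i where i: "\<xi> i = a" by auto
  obtain I where I: "i \<in> I" "card I = k"
    using exists_subset_between[of "{i}" k UNIV] k by auto
  obtain D where D: "\<And>y. y \<in> closure \<Omega> \<Longrightarrow> a \<bullet> (y - z) \<le> D"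
  proof -
    have "bounded ((\<lambda>y. a \<bullet> (y - z)) ` closure \<Omega>)"
      using \<Omega>(2) by (intro compact_imp_bounded compact_continuous_image continuous_intros) (simp add: compact_closure)
    then obtain D where "\<And>y. y \<in> closure \<Omega> \<Longrightarrow> \<bar>a \<bullet> (y - z)\<bar> \<le> D" unfolding bounded_iff by auto
    then show ?thesis using that[of D] by (simp add: abs_le_iff)
  qed
  define b where "b y = (M / 2) * (\<Sum>j\<in>{i}. (\<xi> j \<bullet> (y - z))\<^sup>2) - (M * D / 2) * (a \<bullet> (y - z))" for y
  let ?H = "\<lambda>y :: real^'n. (M / 2) *\<^sub>R (2 *\<^sub>R proj_mat \<xi> {i}) - (M * D / 2) *\<^sub>R (0 :: real^'n^'n)"
  have b2: "C2_on UNIV b (\<lambda>y. (M / 2) *\<^sub>R (2 *\<^sub>R (proj_mat \<xi> {i} *v (y - z))) - (M * D / 2) *\<^sub>R a) ?H"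
    unfolding b_def[abs_def] by (intro C2_on_diff C2_on_scale C2_on_proj C2_on_linear)
  have "M \<le> Pplus k (?H x)" for x :: "real^'n"
  proof -
    have q: "\<xi> j \<bullet> (?H x *v \<xi> j) = (if j = i then M else 0)" for j
    proof -
      have "\<xi> j \<bullet> (?H x *v \<xi> j) = M * (\<xi> j \<bullet> (proj_mat \<xi> {i} *v \<xi> j))" by (simp flip: scaleR_matrix_vector_assoc)
      then show ?thesis by (simp add: proj_mat_quad onb_inner[OF \<xi>(1)])
    qed
    have "(\<Sum>j\<in>I. \<xi> j \<bullet> (?H x *v \<xi> j)) \<le> Pplus k (?H x)"
      by (rule Pplus_ge[OF _ k \<xi>(1) I(2)]) (rule C2_on_symmetric[OF b2], simp)
    then show ?thesis using I(1) by (simp only: q sum.delta) simp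
  qed
  then have "viscosity_subsolution k f \<Omega> b" using f by (intro C2_subsolution[OF k b2]) (meson order_trans)
  moreover have c: "continuous_on (closure \<Omega>) b" using C2_on_continuous[OF b2] continuous_on_subset by blast
  moreover have "b x \<le> 0" if "x \<in> closure \<Omega>" for x
  proof -
    have "b x = - (M / 2) * ((a \<bullet> (x - z)) * (D - a \<bullet> (x - z)))"
    proof -
      have "(M / 2) * d\<^sup>2 - (M * D / 2) * d = - (M / 2) * (d * (D - d))" for d
        by (simp add: power2_eq_square field_simps)
      then show ?thesis by (simp only: b_def i sum.insert finite.emptyI empty_iff sum.empty not_False_eq_True add_0_right)
    qed
    also have "\<dots> \<le> 0" using a(2)[OF that] D[OF that] M by (simp add: mult_nonneg_nonneg)
    finally show ?thesis .
  qed
  ultimately have "b \<in> dirichlet_subsolutions k f \<Omega>"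
    by (auto simp: dirichlet_subsolutions_def frontier_def intro: continuous_on_imp_usc_on)
  then show ?thesis using c by (intro exI[of _ b]) (simp add: b_def)
qed

text \<open>The quadratic bound with a = 2 e / (M + 1), multiplied by (M + 1) / 2, has the value e
  at z. Its Hessian is - (M + 1) times a projection, so \<open>Pplus\<close> is at most - (M + 1),
  strictly below f.\<close>

lemma cylinder_class_upper_barrier:
  fixes \<Omega> :: "(real^'n) set"
  assumes k: "1 \<le> k" "k \<le> CARD('n)" and j: "CARD('j::finite) = CARD('n) - k + 1" and \<Omega>: "\<Omega> \<in> cylinder_class TYPE('j)"
    and f: "\<And>x. x \<in> \<Omega> \<Longrightarrow> - M \<le> f x" and M: "M \<ge> 0" and z: "z \<in> frontier \<Omega>" and e: "e > 0"
  shows "\<exists>\<psi>. continuous_on (closure \<Omega>) \<psi> \<and> \<psi> z \<le> e \<and> (\<forall>w\<in>dirichlet_subsolutions k f \<Omega>. \<forall>x\<in>closure \<Omega>. w x \<le> \<psi> x)"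
proof -
  have \<Omega>': "open \<Omega>" "bounded \<Omega>" using \<Omega> by (auto simp: cylinder_class_def is_domain_def)
  obtain \<xi> :: "'n \<Rightarrow> real^'n" and J where \<xi>: "onb \<xi>" "card J = CARD('j)"
    and B: "\<And>a. a > 0 \<Longrightarrow> \<exists>b. \<forall>y\<in>closure \<Omega>. (\<Sum>j\<in>J. (\<xi> j \<bullet> (y - z))\<^sup>2) \<le> a + b \<bullet> (y - z)"
    using cylinder_class_barrier[OF \<Omega> z] by blast
  let ?m = "M + 1"
  have m: "?m > 0" using M by simp
  have "2 * e / ?m > 0" using e m by simp
  then obtain b where b: "\<And>y. y \<in> closure \<Omega> \<Longrightarrow> (\<Sum>j\<in>J. (\<xi> j \<bullet> (y - z))\<^sup>2) \<le> 2 * e / ?m + b \<bullet> (y - z)" using B by blast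
  define \<psi> where "\<psi> y = (?m / 2) * ((2 * e / ?m + b \<bullet> (y - z)) - (\<Sum>j\<in>J. (\<xi> j \<bullet> (y - z))\<^sup>2))" for y
  let ?H = "\<lambda>y :: real^'n. (?m / 2) *\<^sub>R ((0 + 0) - 2 *\<^sub>R proj_mat \<xi> J)"
  have \<psi>2: "C2_on UNIV \<psi> (\<lambda>y. (?m / 2) *\<^sub>R ((0 + b) - 2 *\<^sub>R (proj_mat \<xi> J *v (y - z)))) ?H"
    unfolding \<psi>_def[abs_def] by (intro C2_on_scale C2_on_diff C2_on_add C2_on_const C2_on_linear C2_on_proj)
  have "Pplus k (?H x) \<le> - ?m" for x :: "real^'n"
  proof -
    have "?H x = (- ?m) *\<^sub>R proj_mat \<xi> J" by (simp add: vec_eq_iff field_simps)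
    then show ?thesis using Pplus_neg_proj_le[OF k \<xi>(1) _ less_imp_le[OF m], of J] \<xi>(2) j by (simp only:)
  qed
  then have lt: "Pplus k (?H x) < f x" if "x \<in> \<Omega>" for x using f[OF that] by (smt (verit))
  have "0 \<le> \<psi> x" if "x \<in> closure \<Omega>" for x using b[OF that] m by (simp add: \<psi>_def)
  then have "w x \<le> \<psi> x" if "w \<in> dirichlet_subsolutions k f \<Omega>" "x \<in> closure \<Omega>" for w x
    using subsolution_le_C2_supersolution[OF \<Omega>' \<psi>2 lt _ that] by (simp add: frontier_def)
  moreover have "continuous_on (closure \<Omega>) \<psi>" using C2_on_continuous[OF \<psi>2] continuous_on_subset by blast
  moreover have "\<psi> z = e" using m by (simp add: \<psi>_def)
  ultimately show ?thesis by (intro exI[of _ \<psi>]) auto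
qed

section \<open>Flat discs in the boundary\<close>

text \<open>Contracting the disc towards an interior point p by the factor 1 - t carries it into the
  domain, where the sphere inequality with h = 0 and B = - 1 bounds u at its centre from below by (1
  - t)^2 r^2 / (2 k). As t tends to 0 this contradicts u x = 0.\<close>

lemma no_disc_in_frontier:
  fixes \<Omega> :: "(real^'n) set" and \<xi> :: "'n \<Rightarrow> real^'n"
  assumes k: "1 \<le> k" "k \<le> CARD('n)" and \<Omega>: "open \<Omega>" "bounded \<Omega>" "convex \<Omega>" "\<Omega> \<noteq> {}"
    and u: "dirichlet_solution k (\<lambda>_. - 1) \<Omega> u" and \<xi>: "onb \<xi>" and I: "card I = k"
    and x: "x \<in> frontier \<Omega>" and r: "r > 0" and disc: "frame.disc_on \<xi> I x r \<subseteq> closure \<Omega>"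
  shows False
proof -
  let ?S = "closure \<Omega>"
  have uc: "continuous_on ?S u" and super: "viscosity_supersolution k (\<lambda>_. - 1) \<Omega> u" and u0: "\<And>x. x \<in> frontier \<Omega> \<Longrightarrow> u x = 0"
    using u by (auto simp: dirichlet_solution_def viscosity_solution_def)
  have \<Omega>S: "\<Omega> \<subseteq> ?S" by (rule closure_subset)
  have SF: "?S = \<Omega> \<union> frontier \<Omega>" using \<Omega>(1) by (simp add: closure_Un_frontier)
  have S: "compact ?S" "?S \<noteq> {}" using \<Omega>(2,4) by (auto simp: compact_closure)
  have Ine: "I \<noteq> {}" using I k by auto
  \<comment> \<open>A negative minimum would be interior and tested by a constant, whose
    \<open>Pplus\<close> is 0 and not at most - 1.\<close>
  have u_nonneg: "0 \<le> u y" if y: "y \<in> ?S" for y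
  proof (rule ccontr)
    assume neg: "\<not> 0 \<le> u y"
    obtain z where z: "z \<in> ?S" "\<And>y. y \<in> ?S \<Longrightarrow> u z \<le> u y" using continuous_attains_inf[OF S uc] by blast
    have "z \<notin> frontier \<Omega>" using u0[of z] z(2)[OF y] neg by auto
    then have z\<Omega>: "z \<in> \<Omega>" using z(1) SF by blast
    have "\<forall>\<^sub>F w in nhds z. w \<in> \<Omega>" using z\<Omega> \<Omega>(1) by (rule eventually_nhds_in_open[rotated])
    then have "\<forall>\<^sub>F w in nhds z. u z - 0 \<le> u w - 0" by eventually_elim (use z(2) \<Omega>S in auto)
    moreover have "C2_near z (\<lambda>_. 0) 0" using C2_on_near[OF C2_on_const] by blast
    ultimately have "Pplus k (0 :: real^'n^'n) \<le> - 1" using super z\<Omega> unfolding viscosity_supersolution_def by blast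
    moreover have "Pplus k (0 :: real^'n^'n) = 0"
    proof -
      have t: "transpose (0 :: real^'n^'n) = 0" by (simp add: transpose_def vec_eq_iff)
      obtain \<eta> :: "'n \<Rightarrow> real^'n" and J where "Pplus k (0 :: real^'n^'n) = (\<Sum>i\<in>J. \<eta> i \<bullet> ((0 :: real^'n^'n) *v \<eta> i))"
        using Pplus_attained[OF t k] by blast
      then show ?thesis by simp
    qed
    ultimately show False by simp
  qed
  \<comment> \<open>The mean value lemma asks for continuity on the whole space, while the
    supersolution property in the open set depends only on the values there.\<close>
  obtain V where V: "continuous_on UNIV V" "\<And>y. y \<in> ?S \<Longrightarrow> V y = u y"
    using Tietze_unbounded[OF uc, of UNIV] by (auto simp: closed_closedin[symmetric])
  have superV: "viscosity_supersolution k (\<lambda>_. - 1) \<Omega> V"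
    by (rule viscosity_supersolution_cong[OF super \<Omega>(1)]) (use V(2) \<Omega>S in auto)
  have below: "r'\<^sup>2 / (2 * real (card I)) \<le> u y" if y: "frame.disc_on \<xi> I y r' \<subseteq> \<Omega>" "r' > 0" for y r'
  proof -
    interpret frame \<xi> I y by unfold_locales (fact \<xi>, fact Ine)
    have "sphere_super r' V (r'\<^sup>2 / (2 * real (card I)) * (- 1))"
    proof (rule viscosity_sphere_super[OF V(1) \<Omega>(1) y])
      fix z \<phi> X assume z: "z \<in> \<Omega>" "C2_near z \<phi> X" "\<forall>\<^sub>F w in nhds z. V z - \<phi> z \<le> V w - \<phi> w"
      have "(\<Sum>i\<in>I. \<xi> i \<bullet> (X *v \<xi> i)) \<le> Pplus k X" by (rule Pplus_ge[OF C2_near_symmetric[OF z(2)] k \<xi> I])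
      also have "\<dots> \<le> - 1" using superV z unfolding viscosity_supersolution_def by blast
      finally show "(\<Sum>i\<in>I. \<xi> i \<bullet> (X *v \<xi> i)) \<le> - 1" .
    qed
    moreover have "0 \<le> V z" if "z \<in> sphere_on r'" for z
    proof -
      have "z \<in> ?S" using that sphere_subset_disc y(1) \<Omega>S by blast
      then show ?thesis using u_nonneg V(2) by simp
    qed
    ultimately have "0 \<le> V y + r'\<^sup>2 / (2 * real (card I)) * (- 1)"
      using harmonic_const[of 0] unfolding sphere_super_def by blast
    moreover have "y \<in> ?S" using center_in_disc y(1) \<Omega>S by blast
    ultimately show ?thesis using V(2) by simp
  qed
  obtain p where p: "p \<in> \<Omega>" using \<Omega>(4) by blast
  define \<gamma> where "\<gamma> t = x - t *\<^sub>R (x - p)" for t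
  have lower: "((1 - t) * r)\<^sup>2 / (2 * real (card I)) \<le> u (\<gamma> t)" if t: "0 < t" "t < 1" for t
  proof (rule below)
    show "(1 - t) * r > 0" using t r by simp
    interpret X: frame \<xi> I x by unfold_locales (fact \<xi>, fact Ine)
    interpret T: frame \<xi> I "\<gamma> t" by unfold_locales (fact \<xi>, fact Ine)
    show "T.disc_on ((1 - t) * r) \<subseteq> \<Omega>"
    proof
      fix y assume y: "y \<in> T.disc_on ((1 - t) * r)"
      \<comment> \<open>The preimage of y under the contraction with centre p and factor 1 - t,
        which maps x to \<gamma> t.\<close>
      let ?z = "x + (1 / (1 - t)) *\<^sub>R (y - \<gamma> t)"
      have c: "X.coord i ?z = (1 / (1 - t)) * T.coord i y" for i by (simp add: X.coord_def T.coord_def)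
      have "X.rho ?z = (1 / (1 - t))\<^sup>2 * T.rho y"
        unfolding X.rho_def T.rho_def c by (simp add: power_mult_distrib power_divide sum_distrib_left)
      also have "\<dots> \<le> (1 / (1 - t))\<^sup>2 * ((1 - t) * r)\<^sup>2" using y by (intro mult_left_mono) (auto simp: T.disc_on_def)
      also have "\<dots> = r\<^sup>2" using t by (simp add: power_mult_distrib power_divide)
      finally have "?z \<in> X.disc_on r" using y by (simp add: X.disc_on_def T.disc_on_def c)
      then have "?z \<in> ?S" using disc by blast
      then have "?z - t *\<^sub>R (?z - p) \<in> interior \<Omega>"
        using \<Omega>(1,3) p t by (intro mem_interior_closure_convex_shrink) (auto simp: interior_open)
      moreover have "?z - t *\<^sub>R (?z - p) = y"
      proof -
        have "w - t *\<^sub>R (w - p) = (1 - t) *\<^sub>R w + t *\<^sub>R p" for w by (simp add: algebra_simps)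
        then have "?z - t *\<^sub>R (?z - p) = (1 - t) *\<^sub>R ?z + t *\<^sub>R p" .
        also have "\<dots> = (1 - t) *\<^sub>R x + (y - \<gamma> t) + t *\<^sub>R p"
        proof -
          have "(1 - t) * (1 / (1 - t)) = 1" using t by simp
          then show ?thesis by (simp only: scaleR_add_right scaleR_scaleR scaleR_one)
        qed
        also have "\<dots> = y" by (simp add: \<gamma>_def algebra_simps)
        finally show ?thesis .
      qed
      ultimately show "y \<in> \<Omega>" using \<Omega>(1) by (simp add: interior_open)
    qed
  qed
  have \<gamma>S: "\<gamma> t \<in> ?S" if "t \<in> {0..1}" for t
  proof (cases "t = 0")
    case True
    then show ?thesis using x SF by (simp add: \<gamma>_def)
  next
    case False
    then have "\<gamma> t \<in> interior \<Omega>" unfolding \<gamma>_def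
      using that x SF \<Omega>(1,3) p by (intro mem_interior_closure_convex_shrink) (auto simp: interior_open)
    then show ?thesis using interior_subset \<Omega>S by blast
  qed
  have "continuous_on {0..1} (\<lambda>t. u (\<gamma> t))"
    by (rule continuous_on_compose2[OF uc]) (use \<gamma>S in \<open>auto simp: \<gamma>_def[abs_def] intro!: continuous_intros\<close>)
  then have "((\<lambda>t. u (\<gamma> t)) \<longlongrightarrow> u (\<gamma> 0)) (at 0 within {0..1})" by (simp add: continuous_on_def)
  then have "((\<lambda>t. u (\<gamma> t)) \<longlongrightarrow> 0) (at 0 within {0..1})" using u0[OF x] by (simp add: \<gamma>_def)
  moreover have "r\<^sup>2 / (8 * real (card I)) > 0" using r Ine by (simp add: card_gt_0_iff)
  ultimately have "\<forall>\<^sub>F t in at 0 within {0..1}. u (\<gamma> t) < r\<^sup>2 / (8 * real (card I))" by (rule order_tendstoD(2))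
  then obtain d where d: "d > 0" "\<And>t. t \<in> {0..1} \<Longrightarrow> t \<noteq> 0 \<Longrightarrow> dist t 0 < d \<Longrightarrow> u (\<gamma> t) < r\<^sup>2 / (8 * real (card I))"
    unfolding eventually_at by blast
  \<comment> \<open>With t at most 1/2 the contracted radius is at least r / 2, which explains the
    threshold r^2 / (8 k).\<close>
  define t where "t = min (d / 2) (1 / 2)"
  have t: "0 < t" "t \<le> 1 / 2" "t < d" using d(1) by (auto simp: t_def)
  have "u (\<gamma> t) < r\<^sup>2 / (8 * real (card I))" using t by (intro d(2)) auto
  moreover have "r\<^sup>2 / (8 * real (card I)) \<le> ((1 - t) * r)\<^sup>2 / (2 * real (card I))"
  proof -
    have "(1 / 2 * r)\<^sup>2 \<le> ((1 - t) * r)\<^sup>2" using t r by (intro power_mono mult_right_mono) auto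
    then have "(1 / 2 * r)\<^sup>2 / (2 * real (card I)) \<le> ((1 - t) * r)\<^sup>2 / (2 * real (card I))" by (rule divide_right_mono) simp
    then show ?thesis by (simp add: power_mult_distrib power_divide)
  qed
  moreover have "((1 - t) * r)\<^sup>2 / (2 * real (card I)) \<le> u (\<gamma> t)" using lower[of t] t by simp
  ultimately show False by simp
qed

text \<open>A face of dimension at least k contains a k-dimensional disc around a relative interior
  point, and the face lies in the frontier because a is positive on the open set.\<close>

lemma exposed_face_dim_less:
  fixes \<Omega> :: "(real^'n) set"
  assumes k: "1 \<le> k" "k \<le> CARD('n)" and \<Omega>: "open \<Omega>" "bounded \<Omega>" "convex \<Omega>" "\<Omega> \<noteq> {}"
    and u: "dirichlet_solution k (\<lambda>_. - 1) \<Omega> u" and z: "z \<in> frontier \<Omega>"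
    and a: "\<And>y. y \<in> \<Omega> \<Longrightarrow> 0 < a \<bullet> (y - z)"
  shows "dim ((\<lambda>y. y - z) ` {y \<in> closure \<Omega>. a \<bullet> (y - z) = 0}) < k"
proof (rule ccontr)
  let ?F = "{y \<in> closure \<Omega>. a \<bullet> (y - z) = 0}"
  let ?T = "span ((\<lambda>y. y - z) ` ?F)"
  assume "\<not> dim ((\<lambda>y. y - z) ` ?F) < k"
  then have dT: "k \<le> dim ?T" by (simp add: dim_span)
  have SF: "closure \<Omega> = \<Omega> \<union> frontier \<Omega>" using \<Omega>(1) by (simp add: closure_Un_frontier)
  have zF: "z \<in> ?F" using z SF by auto
  have "?F = closure \<Omega> \<inter> {y. a \<bullet> y = a \<bullet> z}" by (auto simp: inner_diff_right)
  then have "convex ?F" using \<Omega>(3) by (simp add: convex_Int convex_closure convex_hyperplane)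
  then have "rel_interior ?F \<noteq> {}" using zF rel_interior_eq_empty by blast
  then obtain x e where x: "x \<in> ?F" "e > 0" "ball x e \<inter> affine hull ?F \<subseteq> ?F" using mem_rel_interior_ball by (metis (no_types, lifting) ex_in_conv)
  \<comment> \<open>Translation to z turns the affine hull into the linear span, from which k
    orthonormal directions can be taken.\<close>
  have aff: "affine hull ?F = (\<lambda>v. z + v) ` ?T"
  proof -
    have "(\<lambda>v. - z + v) = (\<lambda>y. y - z)" by auto
    then show ?thesis using affine_hull_span_gen[OF hull_inc[OF zF]] by (simp only:)
  qed
  obtain B where B: "B \<subseteq> ?T" "pairwise orthogonal B" "\<And>v. v \<in> B \<Longrightarrow> norm v = 1" "independent B" "card B = dim ?T" "span B = ?T"
    by (rule orthonormal_basis_subspace[OF subspace_span]) blast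
  obtain \<xi> :: "'n \<Rightarrow> real^'n" where \<xi>: "onb \<xi>" "B \<subseteq> range \<xi>" using onb_of_set[OF B(2,3)] by blast
  have "finite B" using B(4) by (rule independent_imp_finite)
  then obtain B' where B': "B' \<subseteq> B" "card B' = k"
    using obtain_subset_with_card_n[of k B] dT B(5) by auto
  define I where "I = \<xi> -` B'"
  have "\<xi> ` I = B'" using B'(1) \<xi>(2) unfolding I_def by (intro image_vimage_eq[THEN trans]) auto
  then have I: "card I = k" using B'(2) onb_inj[OF \<xi>(1)] by (metis card_image inj_on_subset subset_UNIV)
  have Ine: "I \<noteq> {}" using I k by auto
  have IT: "\<xi> i \<in> ?T" if "i \<in> I" for i using that B'(1) B(1) by (auto simp: I_def)
  interpret frame \<xi> I x by unfold_locales (fact \<xi>(1), fact Ine)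
  have "disc_on (e / 2) \<subseteq> ?F"
  proof
    fix y assume y: "y \<in> disc_on (e / 2)"
    have "y - x = (\<Sum>i\<in>UNIV. coord i y *\<^sub>R \<xi> i)" using onb_expand[OF \<xi>(1), of "y - x"] by (simp add: coord_def)
    also have "\<dots> = (\<Sum>i\<in>I. coord i y *\<^sub>R \<xi> i)" by (rule sum.mono_neutral_right) (use y in \<open>auto simp: disc_on_def\<close>)
    also have "\<dots> \<in> ?T" by (intro span_sum span_scale IT)
    finally have "(x - z) + (y - x) \<in> ?T" using x(1) by (intro span_add) (auto intro: span_base)
    then have "y \<in> affine hull ?F" unfolding aff by (intro image_eqI[of _ _ "(x - z) + (y - x)"]) auto
    moreover have "y \<in> ball x e" using disc_on_norm[OF y] x(2) by (simp add: dist_norm norm_minus_commute)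
    ultimately show "y \<in> ?F" using x(3) by blast
  qed
  then have "disc_on (e / 2) \<subseteq> closure \<Omega>" by blast
  moreover have "x \<in> frontier \<Omega>" using x(1) a[of x] SF by auto
  ultimately show False using no_disc_in_frontier[OF k \<Omega> u \<xi>(1) I, of x "e / 2"] x(2) by simp
qed

text \<open>The projection forgets a set L of k - 1 frame directions that contains all directions of
  the exposed face and avoids the normal a. The remaining coordinates still see a, while the whole
  face collapses to the image of z. This image is thus an exposed point of the projected closure,
  and \<open>strictly_convex_enclosure\<close> supplies the base of the cylinder.\<close>

lemma cylinder_class_of_solvable:
  fixes \<Omega> :: "(real^'n) set"
  assumes k: "1 \<le> k" "k < CARD('n)" and j: "CARD('j::finite) = CARD('n) - k + 1"
    and \<Omega>: "is_domain \<Omega>" "bounded \<Omega>" "convex \<Omega>" and u: "dirichlet_solution k (\<lambda>_. - 1) \<Omega> u"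
  shows "\<Omega> \<in> cylinder_class TYPE('j)"
proof -
  have o: "open \<Omega>" and ne: "\<Omega> \<noteq> {}" using \<Omega>(1) by (auto simp: is_domain_def)
  have k': "k \<le> CARD('n)" using k by simp
  have SF: "closure \<Omega> = \<Omega> \<union> frontier \<Omega>" using o by (simp add: closure_Un_frontier)
  have "\<exists>Q C. orthogonal_matrix Q \<and> C \<in> cylinders TYPE('j) \<and> \<Omega> \<subseteq> (\<lambda>y. Q *v y) ` C \<and> z \<in> frontier ((\<lambda>y. Q *v y) ` C)"
    if z: "z \<in> frontier \<Omega>" for z
  proof -
    obtain a where a: "norm a = 1" "\<And>y. y \<in> closure \<Omega> \<Longrightarrow> 0 \<le> a \<bullet> (y - z)" "\<And>y. y \<in> \<Omega> \<Longrightarrow> 0 < a \<bullet> (y - z)"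
      using convex_support[OF o \<Omega>(3) ne z] by blast
    let ?F = "{y \<in> closure \<Omega>. a \<bullet> (y - z) = 0}"
    let ?T = "span ((\<lambda>y. y - z) ` ?F)"
    have dT: "dim ?T < k" using exposed_face_dim_less[OF k(1) k' o \<Omega>(2,3) ne u z a(3)] by (simp add: dim_span)
    obtain B where B: "B \<subseteq> ?T" "pairwise orthogonal B" "\<And>v. v \<in> B \<Longrightarrow> norm v = 1" "independent B" "card B = dim ?T" "span B = ?T"
      by (rule orthonormal_basis_subspace[OF subspace_span]) blast
    have aT: "orthogonal a v" if "v \<in> ?T" for v
      using that by (intro orthogonal_to_span[of v]) (auto simp: orthogonal_def)
    have aB: "a \<notin> B" using aT[of a] B(1) a(1) by (auto simp: orthogonal_self)
    have "pairwise orthogonal (insert a B)" unfolding pairwise_insert using B(1,2) aT by (auto simp: orthogonal_commute)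
    then obtain \<xi> :: "'n \<Rightarrow> real^'n" where \<xi>: "onb \<xi>" "insert a B \<subseteq> range \<xi>" using onb_of_set[of "insert a B"] B(3) a(1) by auto
    obtain i where i: "\<xi> i = a" using \<xi>(2) by auto
    define L0 where "L0 = \<xi> -` B"
    have "\<xi> ` L0 = B" using \<xi>(2) unfolding L0_def by (intro image_vimage_eq[THEN trans]) auto
    then have L0: "card L0 \<le> k - 1" using dT B(5) k onb_inj[OF \<xi>(1)] card_image[of \<xi> L0] by (auto simp: inj_on_def)
    have "L0 \<subseteq> UNIV - {i}" using aB i by (auto simp: L0_def)
    moreover have "k - 1 \<le> card (UNIV - {i})" using k by (simp add: card_Diff_subset)
    \<comment> \<open>The face may have dimension less than k - 1. L is filled up to exactly k - 1
      directions so that its complement has CARD('j) elements, and i is kept out so that the normal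
      survives the projection.\<close>
    ultimately obtain L where L: "L0 \<subseteq> L" "i \<notin> L" "card L = k - 1"
      using exists_subset_between[OF L0, of "UNIV - {i}"] by auto
    have "card (- L) = CARD('j)" using j L(3) k by (simp add: Compl_eq_Diff_UNIV card_Diff_subset)
    then obtain e :: "'j \<Rightarrow> 'n" where e: "bij_betw e UNIV (- L)"
      using finite_same_card_bij[of "UNIV :: 'j set" "- L"] by auto
    have inj: "inj e" and ran: "range e = - L" using e by (auto simp: bij_betw_def)
    let ?\<pi> = "col_proj \<xi> e"
    \<comment> \<open>The coordinate vector of the index that \<open>e\<close> sends to i, so that
      pairing the projection with n recovers the supporting function given by a.\<close>
    define n :: "real^'j" where "n = (\<chi> m. if e m = i then 1 else 0)"
    obtain m0 where m0: "e m0 = i" using ran L(2) by (metis ComplI imageE)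
    have n: "n \<bullet> (?\<pi> y - ?\<pi> z) = a \<bullet> (y - z)" for y
    proof -
      have "(e m = i) = (m = m0)" for m using inj m0 by (auto dest: injD)
      then have "n = axis m0 1" by (simp add: n_def axis_def vec_eq_iff)
      then have "n \<bullet> (?\<pi> y - ?\<pi> z) = \<xi> (e m0) \<bullet> y - \<xi> (e m0) \<bullet> z"
        by (simp add: inner_axis' col_proj_def)
      then show ?thesis using m0 i by (simp add: inner_diff_right)
    qed
    have flat: "?\<pi> y = ?\<pi> z" if y: "y \<in> closure \<Omega>" "a \<bullet> (y - z) = 0" for y
    proof -
      have yT: "y - z \<in> span B" unfolding B(6) by (rule span_base) (use y in auto)
      have "\<xi> (e m) \<bullet> (y - z) = 0" for m
      proof -
        have "e m \<notin> L0" using ran L(1) by auto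
        then have "\<xi> (e m) \<bullet> v = 0" if "v \<in> B" for v
          using that \<xi>(2) by (auto simp: L0_def onb_inner[OF \<xi>(1)] subset_iff image_iff dest!: spec[of _ v])
        then have "orthogonal (\<xi> (e m)) (y - z)" by (intro orthogonal_to_span[OF yT]) (simp add: orthogonal_def)
        then show ?thesis by (simp add: orthogonal_def)
      qed
      then show ?thesis by (simp add: col_proj_def vec_eq_iff inner_diff_right)
    qed
    let ?K = "?\<pi> ` closure \<Omega>"
    have K: "compact ?K" using \<Omega>(2) by (intro compact_continuous_image continuous_col_proj) (simp add: compact_closure)
    have pos: "0 < n \<bullet> (w - ?\<pi> z)" if w: "w \<in> ?K" "w \<noteq> ?\<pi> z" for w
    proof -
      obtain y where y: "y \<in> closure \<Omega>" "w = ?\<pi> y" using w(1) by blast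
      then have "a \<bullet> (y - z) \<noteq> 0" using flat w(2) by auto
      then show ?thesis using a(2)[OF y(1)] n[of y] y(2) by simp
    qed
    have ne\<pi>: "?\<pi> y \<noteq> ?\<pi> z" if "y \<in> \<Omega>" for y using n[of y] a(3)[OF that] by auto
    obtain p where p: "p \<in> \<Omega>" using ne by blast
    have "?\<pi> p \<in> ?K" using p closure_subset by blast
    then obtain \<omega> where \<omega>: "strictly_convex_domain \<omega>" "bounded \<omega>" "?K - {?\<pi> z} \<subseteq> \<omega>" "?\<pi> z \<notin> \<omega>"
      using strictly_convex_enclosure[OF K pos, of "?\<pi> p"] ne\<pi>[OF p] by auto
    define Q :: "real^'n^'n" where "Q = (\<chi> r c. \<xi> c $ r)"
    have col: "(\<lambda>j. column j Q) = \<xi>" by (simp add: Q_def column_def fun_eq_iff vec_eq_iff)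
    have Q: "orthogonal_matrix Q" using \<xi>(1) by (simp add: onb_columns col)
    have im: "(\<lambda>y. Q *v y) ` cylinder e \<omega> = {y. ?\<pi> y \<in> \<omega>}" using image_cylinder[OF Q, of e \<omega>] by (simp add: col)
    have "cylinder e \<omega> \<in> cylinders TYPE('j)" using inj \<omega>(1,2) by (auto simp: cylinders_def)
    moreover have sub: "\<Omega> \<subseteq> (\<lambda>y. Q *v y) ` cylinder e \<omega>"
      unfolding im using \<omega>(3) ne\<pi> closure_subset[of \<Omega>] by blast
    moreover have "z \<in> frontier ((\<lambda>y. Q *v y) ` cylinder e \<omega>)"
    proof -
      have "z \<in> closure \<Omega>" using z SF by blast
      then have "z \<in> closure ((\<lambda>y. Q *v y) ` cylinder e \<omega>)" using closure_mono[OF sub] by blast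
      moreover have "z \<notin> interior ((\<lambda>y. Q *v y) ` cylinder e \<omega>)" using \<omega>(4) interior_subset unfolding im by blast
      ultimately show ?thesis by (simp add: frontier_def)
    qed
    ultimately show ?thesis using Q by blast
  qed
  then show ?thesis using \<Omega> by (simp add: cylinder_class_def)
qed

section \<open>Uniqueness and the equivalence\<close>

lemma dirichlet_solution_le:
  fixes f :: "real^'n \<Rightarrow> real"
  assumes k: "1 \<le> k" "k \<le> CARD('n)" and \<Omega>: "open \<Omega>" "bounded \<Omega>" and f: "continuous_on \<Omega> f"
    and u: "dirichlet_solution k f \<Omega> u" and v: "dirichlet_solution k f \<Omega> v" and x: "x \<in> closure \<Omega>"
  shows "u x \<le> v x"
proof -
  have SF: "closure \<Omega> = \<Omega> \<union> frontier \<Omega>" using \<Omega>(1) by (simp add: closure_Un_frontier)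
  note defs = dirichlet_solution_def viscosity_solution_def
  have vc: "continuous_on (closure \<Omega>) v" using v by (simp add: defs)
  have "compact (closure \<Omega>)" using \<Omega>(2) by (simp add: compact_closure)
  then obtain M where M: "\<And>x. x \<in> closure \<Omega> \<Longrightarrow> \<bar>v x\<bar> \<le> M"
    using compact_imp_bounded[OF compact_continuous_image[OF vc]] unfolding bounded_iff by auto
  have bd: "u y \<le> v y" if "y \<in> frontier \<Omega>" for y using u v that by (simp add: defs)
  show ?thesis
  proof (cases "x \<in> \<Omega>")
    case True
    show ?thesis
      by (rule comparison[OF k \<Omega> f _ _ _ _ bd M True])
         (use u v in \<open>auto simp: defs intro: continuous_on_imp_usc_on continuous_on_imp_lsc_on\<close>)
  next
    case False
    then show ?thesis using x SF bd by blast
  qed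
qed

theorem theorem1:
  fixes \<Omega> :: "(real^'n) set" and k :: nat
  assumes "1 \<le> k" and "k < CARD('n)"
    and "is_domain \<Omega>" and "bounded \<Omega>" and "convex \<Omega>"
    and "CARD('j::finite) = CARD('n) - k + 1"
  shows "(\<forall>f. continuous_on \<Omega> f \<and> bounded (f ` \<Omega>) \<longrightarrow>
            (\<exists>u. dirichlet_solution k f \<Omega> u \<and>
               (\<forall>v. dirichlet_solution k f \<Omega> v \<longrightarrow> (\<forall>x\<in>closure \<Omega>. v x = u x))))
         \<longleftrightarrow> \<Omega> \<in> cylinder_class TYPE('j)"
proof
  assume solvable: "\<forall>f. continuous_on \<Omega> f \<and> bounded (f ` \<Omega>) \<longrightarrow>
            (\<exists>u. dirichlet_solution k f \<Omega> u \<and>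
               (\<forall>v. dirichlet_solution k f \<Omega> v \<longrightarrow> (\<forall>x\<in>closure \<Omega>. v x = u x)))"
  have "bounded ((\<lambda>_. - 1 :: real) ` \<Omega>)" by (rule boundedI[of _ 1]) auto
  then obtain u where "dirichlet_solution k (\<lambda>_. - 1) \<Omega> u" using solvable continuous_on_const by blast
  then show "\<Omega> \<in> cylinder_class TYPE('j)" by (rule cylinder_class_of_solvable[OF assms(1,2,6,3-5)])
next
  assume C: "\<Omega> \<in> cylinder_class TYPE('j)"
  have k: "1 \<le> k" "k \<le> CARD('n)" using assms by simp_all
  have \<Omega>: "open \<Omega>" "bounded \<Omega>" "\<Omega> \<noteq> {}" using assms by (auto simp: is_domain_def)
  show "\<forall>f. continuous_on \<Omega> f \<and> bounded (f ` \<Omega>) \<longrightarrow>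
            (\<exists>u. dirichlet_solution k f \<Omega> u \<and>
               (\<forall>v. dirichlet_solution k f \<Omega> v \<longrightarrow> (\<forall>x\<in>closure \<Omega>. v x = u x)))"
  proof (intro allI impI, elim conjE)
    fix f :: "real^'n \<Rightarrow> real" assume f: "continuous_on \<Omega> f" "bounded (f ` \<Omega>)"
    obtain M where M: "\<And>x. x \<in> \<Omega> \<Longrightarrow> \<bar>f x\<bar> \<le> M" using f(2) unfolding bounded_iff by auto
    have M0: "M \<ge> 0" using \<Omega>(3) M by (meson abs_ge_zero all_not_in_conv order_trans)
    \<comment> \<open>Convexity yields the lower barriers from f \<le> M, and the cylinder class the
      upper ones from - M \<le> f.\<close>
    have "\<exists>u. dirichlet_solution k f \<Omega> u"
    proof (rule perron[OF k \<Omega> f(1)])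
      fix z assume z: "z \<in> frontier \<Omega>"
      show "\<exists>b. continuous_on (closure \<Omega>) b \<and> b \<in> dirichlet_subsolutions k f \<Omega> \<and> b z = 0"
        by (rule convex_lower_barrier[OF k \<Omega>(1,2) assms(5) \<Omega>(3) _ M0 z]) (use M in \<open>fastforce simp: abs_le_iff\<close>)
      fix e :: real assume "e > 0"
      then show "\<exists>\<psi>. continuous_on (closure \<Omega>) \<psi> \<and> \<psi> z \<le> e \<and>
          (\<forall>w\<in>dirichlet_subsolutions k f \<Omega>. \<forall>x\<in>closure \<Omega>. w x \<le> \<psi> x)"
        by (intro cylinder_class_upper_barrier[OF k assms(6) C _ M0 z]) (use M in \<open>fastforce simp: abs_le_iff\<close>)
    qed
    then obtain u where u: "dirichlet_solution k f \<Omega> u" by blast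
    have "v x = u x" if v: "dirichlet_solution k f \<Omega> v" and x: "x \<in> closure \<Omega>" for v x
      using dirichlet_solution_le[OF k \<Omega>(1,2) f(1) u v x] dirichlet_solution_le[OF k \<Omega>(1,2) f(1) v u x] by simp
    then show "\<exists>u. dirichlet_solution k f \<Omega> u \<and>
               (\<forall>v. dirichlet_solution k f \<Omega> v \<longrightarrow> (\<forall>x\<in>closure \<Omega>. v x = u x))" using u by blast
  qed
qed

end
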